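(* Let $p,w\in\mathcal{AP}_+(\mathbb{R},\mathbb{R})$ and $q\in\mathcal{AP}(\mathbb{R},\mathbb{R})$, write $\mathbf{v}=(\frac1p,q,w)$, and let $L_{\mathbf{v}}$ be the self-adjoint Sturm-Liouville operator $L_{\mathbf{v}}f=\frac1w(-(pf')'+qf)$ on $\mathcal{L}^2(\mathbb{R},w\,\mathrm{d}x)$, with Green's function $G(x,y,z;\mathbf{v})$. For every $z\in\mathbb{C}\setminus\sigma(L_{\mathbf{v}})$, the functions $$x\mapsto G(x,x,z;\mathbf{v})\quad\text{and}\quad x\mapsto\frac{\mathrm{d}}{\mathrm{d}x}G(x,x,z;\mathbf{v})$$ both belong to $\mathcal{AP}_{\mathcal{M}_{\mathbf{v}}}(\mathbb{R},\mathbb{C})$.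
   Context: A continuous $f:\mathbb{R}\to\mathbb{K}$ ($\mathbb{K}=\mathbb{R}$ or $\mathbb{C}$) is Bohr almost periodic if every real sequence has a subsequence $\{t_n\}$ such that the shifts $f\cdot t_n:=f(\cdot+t_n)$ converge uniformly on $\mathbb{R}$; $\mathcal{AP}(\mathbb{R},\mathbb{K})$ is the set of such functions. The hull $\mathrm{E}(f)$ is the closure of $\{f\cdot t:t\in\mathbb{R}\}$ in the uniform norm. $\mathcal{AP}_+(\mathbb{R},\mathbb{R})$ is the set of $f\in\mathcal{AP}(\mathbb{R},\mathbb{R})$ such that every $\widetilde f\in\mathrm{E}(f)$ is positive, i.e. $\widetilde f(x)>0$ for all $x\in\mathbb{R}$. For $f\in\mathcal{AP}(\mathbb{R},\mathbb{K})$ and $\lambda\in\mathbb{R}$, $\hat f(\lambda):=\lim_{t\to+\infty}\frac1t\int_0^t f(x)\mathrm{e}^{-\mathrm{i}\lambda x}\,\mathrm{d}x$; the frequency module $\mathcal{M}_f$ is the smallest additive subgroup of $\mathbb{R}$ containing $\{\lambda\in\mathbb{R}:\hat f(\lambda)\ne0\}$. $\mathcal{M}_{\mathbf{v}}$ is the additive subgroup of $\mathbb{R}$ generated by $\mathcal{M}_p\cup\mathcal{M}_q\cup\mathcal{M}_w$. $\mathcal{AP}_{\mathcal{M}_{\mathbf{v}}}(\mathbb{R},\mathbb{C})$ is the set of $f\in\mathcal{AP}(\mathbb{R},\mathbb{C})$ with $\mathcal{M}_f\subseteq\mathcal{M}_{\mathbf{v}}$. The domain of $L_{\mathbf{v}}$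 is $\{f\in\mathcal{L}^2(\mathbb{R},w\,\mathrm{d}x): f,\,pf'\text{ locally absolutely continuous},\ \frac1w(-(pf')'+qf)\in\mathcal{L}^2(\mathbb{R},w\,\mathrm{d}x)\}$; $L_{\mathbf{v}}$ is self-adjoint and the differential expression is limit point at $\pm\infty$. For $z\in\mathbb{C}\setminus\sigma(L_{\mathbf{v}})$ there are, up to constant multiples, unique non-trivial solutions $\phi_\pm(\cdot,z;\mathbf{v})$ of $-(p\phi')'+q\phi=zw\phi$ with $\phi_\pm\in\mathcal{L}^2(\mathbb{R}_\pm,w\,\mathrm{d}x)$. With the modified Wronskian $\mathrm{W}(f_1,f_2)=f_1(pf_2')-(pf_1')f_2$ (constant in $x$ for two solutions), the Green's function is $$G(x,y,z;\mathbf{v})=\frac{1}{\mathrm{W}(\phi_+,\phi_-)}\begin{cases}\phi_+(x,z;\mathbf{v})\phi_-(y,z;\mathbf{v}),&x\ge y,\\ \phi_-(x,z;\mathbf{v})\phi_+(y,z;\mathbf{v}),&x\le y.\end{cases}$$ *)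

theory Defs
  imports "HOL-Analysis.Analysis" "HOL-Computational_Algebra.Group_Closure"
begin

section \<open>Almost periodic functions\<close>

definition shift :: "(real \<Rightarrow> 'a) \<Rightarrow> real \<Rightarrow> real \<Rightarrow> 'a" where
  "shift f t = (\<lambda>x. f (x + t))"

definition AP :: "(real \<Rightarrow> 'a::real_normed_vector) set" where
  "AP = {f. continuous_on UNIV f \<and>
        (\<forall>s :: nat \<Rightarrow> real. \<exists>r :: nat \<Rightarrow> nat. strict_mono r \<and>
           uniformly_convergent_on UNIV (\<lambda>n. shift f (s (r n))))}"

text \<open>The closure of the orbit in the uniform norm, spelled out with the uniform distance.\<close>

definition AP_hull :: "(real \<Rightarrow> 'a::real_normed_vector) \<Rightarrow> (real \<Rightarrow> 'a) set" where
  "AP_hull f = {g. \<forall>\<epsilon>>0. \<exists>t. \<forall>x. norm (g x - shift f t x) \<le> \<epsilon>}"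

definition AP_plus :: "(real \<Rightarrow> real) set" where
  "AP_plus = {f \<in> AP. \<forall>g \<in> AP_hull f. \<forall>x. g x > 0}"

definition fourier_coeff :: "(real \<Rightarrow> complex) \<Rightarrow> real \<Rightarrow> complex" where
  "fourier_coeff f \<xi> =
     Lim at_top (\<lambda>t. complex_of_real (1 / t) *
       integral {0..t} (\<lambda>x. f x * exp (- (\<i> * complex_of_real \<xi> * complex_of_real x))))"

definition freq_module :: "(real \<Rightarrow> complex) \<Rightarrow> real set" where
  "freq_module f = group_closure {\<xi>. fourier_coeff f \<xi> \<noteq> 0}"

definition freq_module_v :: "(real \<Rightarrow> real) \<Rightarrow> (real \<Rightarrow> real) \<Rightarrow> (real \<Rightarrow> real) \<Rightarrow> real set" where
  "freq_module_v p q w = group_closure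
     (freq_module (\<lambda>x. complex_of_real (p x)) \<union>
      freq_module (\<lambda>x. complex_of_real (q x)) \<union>
      freq_module (\<lambda>x. complex_of_real (w x)))"

definition AP_module :: "real set \<Rightarrow> (real \<Rightarrow> complex) set" where
  "AP_module M = {f \<in> AP. freq_module f \<subseteq> M}"


section \<open>The Sturm-Liouville operator\<close>

definition weighted :: "(real \<Rightarrow> real) \<Rightarrow> real set \<Rightarrow> real measure" where
  "weighted w S = density (lebesgue_on S) (\<lambda>x. ennreal (w x))"

text \<open>
  Elements of the Hilbert space are represented by functions; equality in it is equality almost
  everywhere.
\<close>

definition L2 :: "real measure \<Rightarrow> (real \<Rightarrow> complex) set" where
  "L2 M = {f. f \<in> borel_measurable M \<and> integrable M (\<lambda>x. (cmod (f x))\<^sup>2)}"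

definition L2_nrm :: "real measure \<Rightarrow> (real \<Rightarrow> complex) \<Rightarrow> real" where
  "L2_nrm M f = sqrt (\<integral>x. (cmod (f x))\<^sup>2 \<partial>M)"

definition loc_abs_cont :: "(real \<Rightarrow> complex) \<Rightarrow> bool" where
  "loc_abs_cont f \<longleftrightarrow> (\<forall>a b. \<forall>\<epsilon>>0. \<exists>\<delta>>0. \<forall>(n::nat) (s :: nat \<Rightarrow> real) (t :: nat \<Rightarrow> real).
     (\<forall>i<n. a \<le> s i \<and> s i \<le> t i \<and> t i \<le> b) \<longrightarrow>
     disjoint_family_on (\<lambda>i. {s i<..<t i}) {..<n} \<longrightarrow>
     (\<Sum>i<n. t i - s i) < \<delta> \<longrightarrow>
     (\<Sum>i<n. norm (f (t i) - f (s i))) < \<epsilon>)"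

definition quasi_deriv :: "(real \<Rightarrow> real) \<Rightarrow> (real \<Rightarrow> complex) \<Rightarrow> real \<Rightarrow> complex" where
  "quasi_deriv p f x = complex_of_real (p x) * vector_derivative f (at x)"

text \<open>
  The functions \<open>f\<close> for which \<open>f\<close> and \<open>p f'\<close> are locally absolutely continuous. The
  two conditions on differentiability almost everywhere are consequences of local absolute
  continuity (Lebesgue); they are recorded because \<^const>\<open>vector_derivative\<close> is total and has an
  unspecified value where there is no derivative.
\<close>

definition sl_regular :: "(real \<Rightarrow> real) \<Rightarrow> (real \<Rightarrow> complex) set" where
  "sl_regular p = {f.
     loc_abs_cont f \<and> (AE x in lebesgue. f differentiable (at x)) \<and>
     loc_abs_cont (quasi_deriv p f) \<and> (AE x in lebesgue. quasi_deriv p f differentiable (at x))}"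

definition sl_op ::
  "(real \<Rightarrow> real) \<Rightarrow> (real \<Rightarrow> real) \<Rightarrow> (real \<Rightarrow> real) \<Rightarrow> (real \<Rightarrow> complex) \<Rightarrow> real \<Rightarrow> complex" where
  "sl_op p q w f x = complex_of_real (1 / w x) *
     (- vector_derivative (quasi_deriv p f) (at x) + complex_of_real (q x) * f x)"

definition sl_domain ::
  "(real \<Rightarrow> real) \<Rightarrow> (real \<Rightarrow> real) \<Rightarrow> (real \<Rightarrow> real) \<Rightarrow> (real \<Rightarrow> complex) set" where
  "sl_domain p q w = {f \<in> L2 (weighted w UNIV).
     f \<in> sl_regular p \<and> sl_op p q w f \<in> L2 (weighted w UNIV)}"

text \<open>
  The resolvent set of an operator \<open>T\<close> with domain \<open>D\<close> in the space \<^term>\<open>L2 M\<close>: the operator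
  \<open>T - z\<close> maps \<open>D\<close> one-to-one onto the whole space, with bounded inverse.
\<close>

definition resolvent_set ::
  "real measure \<Rightarrow> (real \<Rightarrow> complex) set \<Rightarrow> ((real \<Rightarrow> complex) \<Rightarrow> real \<Rightarrow> complex) \<Rightarrow> complex set" where
  "resolvent_set M D T = {z.
     (\<forall>f\<in>D. (AE x in M. T f x - z * f x = 0) \<longrightarrow> (AE x in M. f x = 0)) \<and>
     (\<forall>g\<in>L2 M. \<exists>f\<in>D. AE x in M. T f x - z * f x = g x) \<and>
     (\<exists>C. \<forall>f\<in>D. L2_nrm M f \<le> C * L2_nrm M (\<lambda>x. T f x - z * f x))}"

definition sl_spectrum :: "(real \<Rightarrow> real) \<Rightarrow> (real \<Rightarrow> real) \<Rightarrow> (real \<Rightarrow> real) \<Rightarrow> complex set" where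
  "sl_spectrum p q w = - resolvent_set (weighted w UNIV) (sl_domain p q w) (sl_op p q w)"


section \<open>Weyl solutions and the Green's function\<close>

definition sl_solution ::
  "(real \<Rightarrow> real) \<Rightarrow> (real \<Rightarrow> real) \<Rightarrow> (real \<Rightarrow> real) \<Rightarrow> complex \<Rightarrow> (real \<Rightarrow> complex) \<Rightarrow> bool" where
  "sl_solution p q w z \<phi> \<longleftrightarrow> \<phi> \<in> sl_regular p \<and>
     (AE x in lebesgue. - vector_derivative (quasi_deriv p \<phi>) (at x) + complex_of_real (q x) * \<phi> x
        = z * complex_of_real (w x) * \<phi> x)"

definition weyl_solution ::
  "(real \<Rightarrow> real) \<Rightarrow> (real \<Rightarrow> real) \<Rightarrow> (real \<Rightarrow> real) \<Rightarrow> complex \<Rightarrow> real set \<Rightarrow> (real \<Rightarrow> complex) \<Rightarrow> bool" where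
  "weyl_solution p q w z S \<phi> \<longleftrightarrow>
     sl_solution p q w z \<phi> \<and> (\<exists>x. \<phi> x \<noteq> 0) \<and> \<phi> \<in> L2 (weighted w S)"

text \<open>
  Outside the spectrum such solutions exist and are unique up to constant multiples; a choice is
  made here, and the Green's function below does not depend on it.
\<close>

definition \<phi>_plus ::
  "(real \<Rightarrow> real) \<Rightarrow> (real \<Rightarrow> real) \<Rightarrow> (real \<Rightarrow> real) \<Rightarrow> complex \<Rightarrow> real \<Rightarrow> complex" where
  "\<phi>_plus p q w z = (SOME \<phi>. weyl_solution p q w z {0..} \<phi>)"

definition \<phi>_minus ::
  "(real \<Rightarrow> real) \<Rightarrow> (real \<Rightarrow> real) \<Rightarrow> (real \<Rightarrow> real) \<Rightarrow> complex \<Rightarrow> real \<Rightarrow> complex" where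
  "\<phi>_minus p q w z = (SOME \<phi>. weyl_solution p q w z {..0} \<phi>)"

definition wronskian ::
  "(real \<Rightarrow> real) \<Rightarrow> (real \<Rightarrow> complex) \<Rightarrow> (real \<Rightarrow> complex) \<Rightarrow> real \<Rightarrow> complex" where
  "wronskian p f g x = f x * quasi_deriv p g x - quasi_deriv p f x * g x"

text \<open>The Wronskian of two solutions is constant, so it may be evaluated at 0.\<close>

definition greens ::
  "(real \<Rightarrow> real) \<Rightarrow> (real \<Rightarrow> real) \<Rightarrow> (real \<Rightarrow> real) \<Rightarrow> complex \<Rightarrow> real \<Rightarrow> real \<Rightarrow> complex" where
  "greens p q w z x y =
     1 / wronskian p (\<phi>_plus p q w z) (\<phi>_minus p q w z) 0 *
     (if x \<ge> y then \<phi>_plus p q w z x * \<phi>_minus p q w z y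
      else \<phi>_minus p q w z x * \<phi>_plus p q w z y)"

end

theory Submission
  imports Defs "HOL-Complex_Analysis.Great_Picard"
begin

text \<open>
  Two facts combine. First, the diagonal Green's function depends on the coefficients in a Lipschitz
  way: if \<open>\<delta>\<close> is the uniform distance between the translates of \<open>(1 / p, q, w)\<close> by \<open>t\<close>
  and by \<open>t'\<close>, then \<open>G(t, t)\<close> and \<open>G(t', t')\<close> differ by at most \<open>L \<delta>\<close>, and so
  do the values of \<open>p G'\<close>. The boundedness of the resolvent enters through a test function that
  glues a Weyl solution at \<open>+\<infinity>\<close> to a multiple of one at \<open>-\<infinity>\<close>; it yields
  \<open>\<bar>\<Phi>\<^sub>-(x)\<bar>\<^sup>2 \<integral>\<^sub>x\<^sup>\<infinity> \<bar>\<Phi>\<^sub>+\<bar>\<^sup>2 \<le> C \<bar>W\<bar>\<^sup>2\<close> for the vectors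
  \<open>\<Phi> = (\<phi>, p \<phi>')\<close>, and the Lagrange identity for the two translated equations does the rest.

  Second, a function dominated in this sense by almost periodic functions is almost periodic and its
  frequencies lie in the module they generate. If \<open>\<xi>\<close> is a frequency outside the
  module, there are translations fixing every character of the module up to a small error but moving
  the character \<open>\<xi>\<close>. They nearly fix the coefficients, because an almost periodic function is determined by
  its Fourier coefficients, hence they nearly fix \<open>G\<close>, which contradicts the nonzero coefficient at
  \<open>\<xi>\<close>. Nonvanishing of some Fourier coefficient of \<open>g \<noteq> 0\<close> comes from
  Parseval's identity for the discrete Fourier transform of samples of \<open>g\<close>: the almost periods
  of \<open>g\<close> force one discrete coefficient to be large independently of the mesh and of the length.
\<close>


section \<open>Almost periodic functions and domination\<close>

text \<open>The obstacle is that a Weyl solution itself need not be almost periodic: it may decay at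
  one end and grow at the other, and it is fixed only up to a factor. Unaffected by rescaling are
  expressions of degree one in each of the two solutions, divided by the Wronskian. Hence every
  estimate weighs one solution by the size of the other and ends in the matching power of
  \<open>|W|\<close>, so that the constants survive the division by \<open>W\<close>. Two translates
  of one operator are compared instead of different operators in the hull, so a single pair of Weyl
  solutions and a single resolvent serve throughout. The relation \<open>dominated\<close> is made
  for this: it compares values at two points, covers whole translates because \<open>near\<close> is
  invariant under a common shift, and serves both for almost periodicity and for locating
  frequencies. The resolvent enters through sources supported in a unit interval, with a bound
  independent of where that interval lies. This uniformity is the source of uniform constants along
  the line.\<close>

definition near :: "(real \<Rightarrow> 'a::real_normed_vector) \<Rightarrow> real \<Rightarrow> real \<Rightarrow> real \<Rightarrow> bool" where
  "near V d t s \<longleftrightarrow> (\<forall>x. norm (V (x + t) - V (x + s)) \<le> d)"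

text \<open>Uniform continuity of f for the pseudometric on the line that assigns to t and s the
  uniform distance of the translates of V. Values at t and s are enough: a common shift of t and s
  extends the bound to the translates of f.\<close>

definition dominated ::
  "(real \<Rightarrow> 'a::real_normed_vector) \<Rightarrow> (real \<Rightarrow> 'b::real_normed_vector) \<Rightarrow> bool" where
  "dominated V f \<longleftrightarrow> (\<forall>e>0. \<exists>d>0. \<forall>t s. near V d t s \<longrightarrow> norm (f t - f s) \<le> e)"

lemma nearD: "near V d t s \<Longrightarrow> norm (V t - V s) \<le> d"
  unfolding near_def by (metis add_0)

lemma near_commute: "near V d t s \<Longrightarrow> near V d s t"
  by (simp add: near_def norm_minus_commute)

lemma near_mono: "near V d t s \<Longrightarrow> d \<le> e \<Longrightarrow> near V e t s"
  unfolding near_def by (meson order_trans)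

lemma near_shift: "near V d t s \<Longrightarrow> near V d (t + a) (s + a)"
  unfolding near_def by (metis add.assoc add.commute)

lemma near_trans:
  assumes "near V d t s" "near V e s r"
  shows "near V (d + e) t r"
  unfolding near_def
proof
  fix x
  have "norm (V (x + t) - V (x + r)) \<le> norm (V (x + t) - V (x + s)) + norm (V (x + s) - V (x + r))"
    using norm_triangle_ineq[of "V (x + t) - V (x + s)" "V (x + s) - V (x + r)"] by simp
  with assms show "norm (V (x + t) - V (x + r)) \<le> d + e"
    unfolding near_def by (smt (verit))
qed

lemma AP_subsequence_near:
  assumes "V \<in> AP"
  obtains r where "strict_mono (r :: nat \<Rightarrow> nat)"
    "\<And>e. e > 0 \<Longrightarrow> \<exists>N. \<forall>m\<ge>N. \<forall>n\<ge>N. near V e (s (r m)) (s (r n))"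
proof -
  obtain r where r: "strict_mono r" "uniformly_convergent_on UNIV (\<lambda>n. shift V (s (r n)))"
    using assms unfolding AP_def by blast
  obtain G where G: "uniform_limit UNIV (\<lambda>n. shift V (s (r n))) G sequentially"
    using r(2) unfolding uniformly_convergent_on_def by blast
  have "\<exists>N. \<forall>m\<ge>N. \<forall>n\<ge>N. near V e (s (r m)) (s (r n))" if "e > 0" for e
  proof -
    have "\<forall>\<^sub>F n in sequentially. \<forall>x. norm (V (x + s (r n)) - G x) < e/2"
      using uniform_limitD[OF G, of "e/2"] that by (simp add: shift_def dist_norm)
    then obtain N where N: "\<And>n x. n \<ge> N \<Longrightarrow> norm (V (x + s (r n)) - G x) < e/2"
      unfolding eventually_sequentially by blast
    have "norm (V (x + s (r m)) - V (x + s (r n))) \<le> e" if "m \<ge> N" "n \<ge> N" for m n x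
      using norm_triangle_ineq4[of "V (x + s (r m)) - G x" "V (x + s (r n)) - G x"]
        N[OF that(1), of x] N[OF that(2), of x] by simp
    then show ?thesis unfolding near_def by blast
  qed
  with r(1) show ?thesis using that by blast
qed

lemma AP_continuous: "V \<in> AP \<Longrightarrow> continuous_on UNIV V"
  by (simp add: AP_def)

lemma AP_tendsto: "V \<in> AP \<Longrightarrow> (X \<longlongrightarrow> x) F \<Longrightarrow> ((\<lambda>n. V (X n)) \<longlongrightarrow> V x) F"
  using AP_continuous[of V] by (metis UNIV_I continuous_on_def continuous_on_eq_continuous_at isCont_tendsto_compose open_UNIV)

text \<open>Uniform continuity. If shifts tending to 0 moved V by more than e, some subsequence of
  translates would still be uniformly Cauchy; fixing one index and letting the other tend to
  infinity compares a translate with V itself.\<close>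

lemma AP_near_close:
  assumes V: "V \<in> AP" and e: "e > 0"
  obtains d where "d > 0" "\<And>t s. \<bar>t - s\<bar> < d \<Longrightarrow> near V e t s"
proof -
  have "\<exists>d>0. \<forall>t. \<bar>t\<bar> < d \<longrightarrow> near V e t 0"
  proof (rule ccontr)
    assume "\<not> ?thesis"
    then have "\<exists>t. \<bar>t\<bar> < 1 / (real n + 1) \<and> \<not> near V e t 0" for n :: nat
      by (auto dest!: spec[of _ "1 / (real n + 1)"])
    then obtain t where t: "\<And>n::nat. \<bar>t n\<bar> < 1 / (real n + 1)" "\<And>n. \<not> near V e (t n) 0"
      by metis
    obtain r where r: "strict_mono (r :: nat \<Rightarrow> nat)"
      "\<And>e. e > 0 \<Longrightarrow> \<exists>N. \<forall>m\<ge>N. \<forall>n\<ge>N. near V e (t (r m)) (t (r n))"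
      by (rule AP_subsequence_near[OF V, of t]) blast
    obtain N where N: "\<And>m n. m \<ge> N \<Longrightarrow> n \<ge> N \<Longrightarrow> near V e (t (r m)) (t (r n))"
      using r(2)[OF e] by blast
    have t0: "t \<longlonglongrightarrow> 0"
      by (rule LIMSEQ_norm_0) (use t(1) in \<open>simp add: add.commute less_imp_le\<close>)
    have "near V e (t (r N)) 0"
      unfolding near_def
    proof
      fix x
      have "(\<lambda>n. t (r n)) \<longlonglongrightarrow> 0" using LIMSEQ_subseq_LIMSEQ[OF t0 r(1)] by (simp add: o_def)
      then have "(\<lambda>n. norm (V (x + t (r N)) - V (x + t (r n)))) \<longlonglongrightarrow> norm (V (x + t (r N)) - V (x + 0))"
        by (intro tendsto_intros AP_tendsto[OF V])
      moreover have "\<forall>n\<ge>N. norm (V (x + t (r N)) - V (x + t (r n))) \<le> e"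
        using N unfolding near_def by blast
      ultimately show "norm (V (x + t (r N)) - V (x + 0)) \<le> e"
        by (meson Lim_bounded)
    qed
    with t(2) show False by blast
  qed
  then obtain d where d: "d > 0" "\<And>t. \<bar>t\<bar> < d \<Longrightarrow> near V e t 0" by blast
  have "near V e t s" if "\<bar>t - s\<bar> < d" for t s
    using near_shift[OF d(2)[OF that], of s] by simp
  with d(1) that show ?thesis by blast
qed

lemma AP_bounded:
  assumes V: "V \<in> AP"
  obtains B where "B > 0" "\<And>x. norm (V x) \<le> B"
proof -
  have "\<exists>B. \<forall>x. norm (V x) \<le> B"
  proof (rule ccontr)
    assume "\<not> ?thesis"
    then have "\<forall>n::nat. \<exists>t. norm (V t) > real n" by (metis not_le)
    then obtain t where t: "\<And>n::nat. norm (V (t n)) > real n" by metis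
    obtain r where r: "strict_mono (r :: nat \<Rightarrow> nat)"
      "\<And>e. e > 0 \<Longrightarrow> \<exists>N. \<forall>m\<ge>N. \<forall>n\<ge>N. near V e (t (r m)) (t (r n))"
      by (rule AP_subsequence_near[OF V, of t]) blast
    obtain N where N: "\<And>m n. m \<ge> N \<Longrightarrow> n \<ge> N \<Longrightarrow> near V 1 (t (r m)) (t (r n))"
      using r(2)[of 1] by auto
    obtain n where n: "real n > norm (V (t (r N))) + 1" using reals_Archimedean2 by blast
    define m where "m = max n N"
    have "norm (V (0 + t (r m)) - V (0 + t (r N))) \<le> 1"
      using N[of m N] unfolding near_def m_def by (meson max.cobounded2 order_refl)
    then have "norm (V (t (r m))) \<le> norm (V (t (r N))) + 1"
      by (smt (verit) add_0 norm_triangle_ineq2)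
    moreover have "real m < norm (V (t (r m)))"
      using t[of "r m"] seq_suble[OF r(1), of m] by linarith
    ultimately show False using n unfolding m_def by linarith
  qed
  then obtain B where "\<And>x. norm (V x) \<le> B" by blast
  then have "max B 1 > 0" "\<And>x. norm (V x) \<le> max B 1"
    by (auto simp: le_max_iff_disj)
  then show ?thesis using that by blast
qed

text \<open>Total boundedness of the set of translates. Otherwise a greedy choice produces points
  that are pairwise not near, and almost periodicity forbids such a sequence.\<close>

lemma AP_net:
  assumes V: "V \<in> AP" and e: "e > 0"
  obtains T where "finite T" "T \<noteq> {}" "\<And>t. \<exists>s\<in>T. near V e t s"
proof -
  have "\<exists>T. finite T \<and> (\<forall>t. \<exists>s\<in>T. near V e t s)"
  proof (rule ccontr)
    assume *: "\<not> ?thesis"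
    define g where "g T = (SOME t. \<forall>s\<in>T. \<not> near V e t s)" for T
    have g: "\<not> near V e (g T) s" if "finite T" "s \<in> T" for T s
    proof -
      have "\<exists>t. \<forall>s\<in>T. \<not> near V e t s" using * that(1) by blast
      then have "\<forall>s\<in>T. \<not> near V e (g T) s" unfolding g_def by (rule someI_ex)
      with that(2) show ?thesis by blast
    qed
    define S where "S = rec_nat {} (\<lambda>_ T. insert (g T) T)"
    have S: "S 0 = {}" "S (Suc n) = insert (g (S n)) (S n)" for n
      by (simp_all add: S_def)
    have fin: "finite (S n)" for n by (induction n) (simp_all add: S)
    have mem: "g (S m) \<in> S n" if "m < n" for m n
      using that by (induction n) (auto simp: S less_Suc_eq)
    obtain r where r: "strict_mono (r :: nat \<Rightarrow> nat)"
      "\<And>e. e > 0 \<Longrightarrow> \<exists>N. \<forall>m\<ge>N. \<forall>n\<ge>N. near V e (g (S (r m))) (g (S (r n)))"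
      by (rule AP_subsequence_near[OF V, of "\<lambda>n. g (S n)"]) blast
    obtain N where "near V e (g (S (r (Suc N)))) (g (S (r N)))"
      using r(2)[OF e] by (meson le_Suc_eq order_refl)
    moreover have "r N < r (Suc N)" using r(1) by (simp add: strict_mono_def)
    ultimately show False using g[OF fin] mem by blast
  qed
  then obtain T where "finite T" "\<And>t. \<exists>s\<in>T. near V e t s" by blast
  then show ?thesis using that by blast
qed

lemma dominatedD:
  assumes "dominated V f" "e > 0"
  obtains d where "d > 0" "\<And>t s. near V d t s \<Longrightarrow> near f e t s"
proof -
  obtain d where d: "d > 0" "\<And>t s. near V d t s \<Longrightarrow> norm (f t - f s) \<le> e"
    using assms unfolding dominated_def by blast
  have "near f e t s" if "near V d t s" for t s
    unfolding near_def
  proof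
    fix x
    show "norm (f (x + t) - f (x + s)) \<le> e"
      using d(2)[OF near_shift[OF that, of x]] by (simp add: add.commute)
  qed
  with d(1) that show ?thesis by blast
qed

lemma dominated_self: "dominated V V"
  unfolding dominated_def near_def by (metis add_0)

lemma dominatedI:
  assumes "\<And>e. e > 0 \<Longrightarrow> \<exists>d>0. \<forall>t s. near V d t s \<longrightarrow> norm (f t - f s) \<le> e"
  shows "dominated V f"
  using assms unfolding dominated_def by blast

lemma dominated_AP:
  fixes f :: "real \<Rightarrow> 'b::banach"
  assumes V: "V \<in> AP" and f: "dominated V f"
  shows "f \<in> AP"
proof -
  have "continuous_on UNIV f"
    unfolding continuous_on_iff
  proof (intro ballI allI impI)
    fix x e :: real assume "e > 0"
    then have "e/2 > 0" by simp
    then obtain d where d: "d > 0" "\<And>t s. near V d t s \<Longrightarrow> near f (e/2) t s" by (rule dominatedD[OF f]) blast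
    obtain c where c: "c > 0" "\<And>t s. \<bar>t - s\<bar> < c \<Longrightarrow> near V d t s" by (rule AP_near_close[OF V d(1)]) blast
    show "\<exists>d>0. \<forall>x'\<in>UNIV. dist x' x < d \<longrightarrow> dist (f x') (f x) < e"
    proof (intro exI[of _ c] conjI c(1) ballI impI)
      fix x' :: real assume "dist x' x < c"
      then have "near f (e/2) x' x" using c(2) d(2) by (simp add: dist_real_def)
      then have "norm (f (0 + x') - f (0 + x)) \<le> e/2" unfolding near_def by blast
      then show "dist (f x') (f x) < e" using \<open>e > 0\<close> by (simp add: dist_norm)
    qed
  qed
  moreover have "\<exists>r :: nat \<Rightarrow> nat. strict_mono r \<and> uniformly_convergent_on UNIV (\<lambda>n. shift f (s (r n)))" for s
  proof -
    obtain r where r: "strict_mono (r :: nat \<Rightarrow> nat)"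
      "\<And>e. e > 0 \<Longrightarrow> \<exists>N. \<forall>m\<ge>N. \<forall>n\<ge>N. near V e (s (r m)) (s (r n))"
      by (rule AP_subsequence_near[OF V, of s]) blast
    have "uniformly_Cauchy_on UNIV (\<lambda>n. shift f (s (r n)))"
      unfolding uniformly_Cauchy_on_def
    proof (intro allI impI)
      fix e :: real assume "e > 0"
      then have "e/2 > 0" by simp
      then obtain d where d: "d > 0" "\<And>t s. near V d t s \<Longrightarrow> near f (e/2) t s" by (rule dominatedD[OF f]) blast
      obtain N where N: "\<And>m n. m \<ge> N \<Longrightarrow> n \<ge> N \<Longrightarrow> near V d (s (r m)) (s (r n))"
        using r(2)[OF d(1)] by blast
      show "\<exists>M. \<forall>x\<in>UNIV. \<forall>m\<ge>M. \<forall>n\<ge>M. dist (shift f (s (r m)) x) (shift f (s (r n)) x) < e"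
      proof (intro exI[of _ N] ballI allI impI)
        fix x m n assume "N \<le> m" "N \<le> n"
        then have "norm (f (x + s (r m)) - f (x + s (r n))) \<le> e/2"
          using d(2) N unfolding near_def by blast
        then show "dist (shift f (s (r m)) x) (shift f (s (r n)) x) < e"
          using \<open>e > 0\<close> by (simp add: shift_def dist_norm)
      qed
    qed
    with r(1) show ?thesis using uniformly_convergent_eq_Cauchy by blast
  qed
  ultimately show ?thesis by (simp add: AP_def)
qed

text \<open>Arzela-Ascoli for the pseudometric of V. The line is totally bounded for it, so the
  countable union of finite nets acts as a dense set: a diagonal subsequence converges there, and
  equicontinuity spreads the convergence uniformly over the line.\<close>

lemma AP_compactness:
  fixes F :: "nat \<Rightarrow> real \<Rightarrow> 'b::{banach,heine_borel}"
  assumes V: "V \<in> AP" and bd: "\<And>n x. norm (F n x) \<le> B"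
    and dom: "\<And>e. e > 0 \<Longrightarrow> \<exists>d>0. \<forall>n t s. near V d t s \<longrightarrow> norm (F n t - F n s) \<le> e"
  obtains r G where "strict_mono (r :: nat \<Rightarrow> nat)" "uniform_limit UNIV (\<lambda>n. F (r n)) G sequentially"
    "dominated V G"
proof -
  have "\<forall>n::nat. \<exists>T. finite T \<and> (\<forall>t. \<exists>s\<in>T. near V (1 / (real n + 1)) t s)"
  proof
    fix n :: nat
    have "1 / (real n + 1) > 0" by simp
    then obtain T where "finite T" "T \<noteq> {}" "\<And>t. \<exists>s\<in>T. near V (1 / (real n + 1)) t s"
      by (rule AP_net[OF V]) blast
    then show "\<exists>T. finite T \<and> (\<forall>t. \<exists>s\<in>T. near V (1 / (real n + 1)) t s)" by blast
  qed
  then obtain T where T: "\<And>n::nat. finite (T n)" "\<And>n t. \<exists>s\<in>T n. near V (1 / (real n + 1)) t s"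
    by metis
  have cnt: "countable (\<Union>n. T n)" using T(1) by (simp add: countable_finite)
  obtain r where r: "strict_mono (r :: nat \<Rightarrow> nat)" "\<And>x. x \<in> (\<Union>n. T n) \<Longrightarrow> \<exists>l. (\<lambda>n. F (r n) x) \<longlonglongrightarrow> l"
    by (rule function_convergent_subsequence[OF cnt, of F B]) (use bd in blast)+
  have "uniformly_Cauchy_on UNIV (\<lambda>n. F (r n))"
    unfolding uniformly_Cauchy_on_def
  proof (intro allI impI)
    fix e :: real assume e: "e > 0"
    then obtain d where d: "d > 0" "\<And>n t s. near V d t s \<Longrightarrow> norm (F n t - F n s) \<le> e/4"
      using dom[of "e/4"] by auto
    obtain k :: nat where k: "1 / (real k + 1) < d"
      using d(1) by (metis nat_approx_posE of_nat_Suc add.commute)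
    have "\<forall>s\<in>T k. \<exists>M. \<forall>m\<ge>M. \<forall>n\<ge>M. norm (F (r m) s - F (r n) s) < e/4"
    proof
      fix s assume "s \<in> T k"
      then obtain l where "(\<lambda>n. F (r n) s) \<longlonglongrightarrow> l" using r(2) by blast
      then have "Cauchy (\<lambda>n. F (r n) s)" by (rule LIMSEQ_imp_Cauchy)
      then show "\<exists>M. \<forall>m\<ge>M. \<forall>n\<ge>M. norm (F (r m) s - F (r n) s) < e/4"
        using e unfolding Cauchy_def dist_norm by (meson divide_pos_pos zero_less_numeral)
    qed
    then obtain M where M: "\<And>s m n. s \<in> T k \<Longrightarrow> m \<ge> M s \<Longrightarrow> n \<ge> M s \<Longrightarrow> norm (F (r m) s - F (r n) s) < e/4"
      by metis
    show "\<exists>M. \<forall>x\<in>UNIV. \<forall>m\<ge>M. \<forall>n\<ge>M. dist (F (r m) x) (F (r n) x) < e"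
    proof (intro exI[of _ "Max (insert 0 (M ` T k))"] ballI allI impI)
      fix x m n assume m: "Max (insert 0 (M ` T k)) \<le> m" and n: "Max (insert 0 (M ` T k)) \<le> n"
      obtain s where s: "s \<in> T k" "near V (1 / (real k + 1)) x s" using T(2) by blast
      have "M s \<le> Max (insert 0 (M ` T k))" using s(1) T(1) by simp
      then have 1: "norm (F (r m) s - F (r n) s) < e/4" using M s(1) m n by (meson order_trans)
      have nr: "near V d x s" using near_mono[OF s(2)] k by simp
      have "norm (F (r m) x - F (r n) x) \<le> norm (F (r m) x - F (r m) s) + norm (F (r m) s - F (r n) s) + norm (F (r n) x - F (r n) s)"
        using norm_triangle_ineq[of "F (r m) x - F (r m) s" "F (r m) s - F (r n) s"]
          norm_triangle_ineq4[of "F (r m) x - F (r n) s" "F (r n) x - F (r n) s"] by simp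
      also have "\<dots> < e" using 1 d(2)[OF nr, of "r m"] d(2)[OF nr, of "r n"] e by linarith
      finally show "dist (F (r m) x) (F (r n) x) < e" by (simp add: dist_norm)
    qed
  qed
  then obtain G where G: "uniform_limit UNIV (\<lambda>n. F (r n)) G sequentially"
    using uniformly_convergent_eq_Cauchy uniformly_convergent_on_def by blast
  have "dominated V G"
  proof (rule dominatedI)
    fix e :: real assume "e > 0"
    then obtain d where d: "d > 0" "\<And>n t s. near V d t s \<Longrightarrow> norm (F n t - F n s) \<le> e"
      using dom by blast
    have "norm (G t - G s) \<le> e" if "near V d t s" for t s
    proof -
      have "(\<lambda>n. norm (F (r n) t - F (r n) s)) \<longlonglongrightarrow> norm (G t - G s)"
        by (intro tendsto_intros tendsto_uniform_limitI[OF G]) auto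
      then show ?thesis using d(2)[OF that] by (meson Lim_bounded)
    qed
    with d(1) show "\<exists>d>0. \<forall>t s. near V d t s \<longrightarrow> norm (G t - G s) \<le> e" by blast
  qed
  with r(1) G that show ?thesis by blast
qed

section \<open>Pairs, sums, products and characters\<close>

lemma uniformly_convergent_on_subseq:
  assumes "uniformly_convergent_on X F" "strict_mono (r :: nat \<Rightarrow> nat)"
  shows "uniformly_convergent_on X (\<lambda>n. F (r n))"
  using assms unfolding uniformly_convergent_on_def
  by (metis filterlim_compose filterlim_subseq)

lemma uniform_limit_Pair:
  fixes f :: "'i \<Rightarrow> 'c \<Rightarrow> 'a::real_normed_vector" and g :: "'i \<Rightarrow> 'c \<Rightarrow> 'b::real_normed_vector"
  assumes f: "uniform_limit X f F net" and g: "uniform_limit X g G net"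
  shows "uniform_limit X (\<lambda>n x. (f n x, g n x)) (\<lambda>x. (F x, G x)) net"
proof (rule uniform_limitI)
  fix e :: real assume "e > 0"
  then have "e/2 > 0" by simp
  from uniform_limitD[OF f this] uniform_limitD[OF g this]
  show "\<forall>\<^sub>F n in net. \<forall>x\<in>X. dist (f n x, g n x) (F x, G x) < e"
  proof eventually_elim
    case (elim n)
    show ?case
    proof
      fix x assume x: "x \<in> X"
      have "norm (f n x - F x, g n x - G x) \<le> norm (f n x - F x) + norm (g n x - G x)"
        by (rule norm_Pair_le)
      also have "\<dots> < e" using elim x by (fastforce simp: dist_norm)
      finally show "dist (f n x, g n x) (F x, G x) < e" by (simp add: dist_norm)
    qed
  qed
qed

text \<open>Passing to a subsequence twice. Pairs allow several coefficients to be treated as one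
  vector-valued function, and the algebraic closure properties follow from domination by the
  pair.\<close>

lemma AP_Pair:
  assumes f: "f \<in> AP" and g: "g \<in> AP"
  shows "(\<lambda>x. (f x, g x)) \<in> AP"
proof -
  have "\<exists>r :: nat \<Rightarrow> nat. strict_mono r \<and> uniformly_convergent_on UNIV (\<lambda>n. shift (\<lambda>x. (f x, g x)) (s (r n)))" for s
  proof -
    obtain r1 where r1: "strict_mono (r1 :: nat \<Rightarrow> nat)" "uniformly_convergent_on UNIV (\<lambda>n. shift f (s (r1 n)))"
      using f by (auto simp: AP_def)
    have "\<And>s. \<exists>r :: nat \<Rightarrow> nat. strict_mono r \<and> uniformly_convergent_on UNIV (\<lambda>n. shift g (s (r n)))"
      using g by (simp add: AP_def)
    from this[of "\<lambda>k. s (r1 k)"]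
    obtain r2 where r2: "strict_mono (r2 :: nat \<Rightarrow> nat)" "uniformly_convergent_on UNIV (\<lambda>n. shift g (s (r1 (r2 n))))"
      by auto
    have "uniformly_convergent_on UNIV (\<lambda>n. shift f (s (r1 (r2 n))))"
      using uniformly_convergent_on_subseq[OF r1(2) r2(1)] .
    then obtain F G where "uniform_limit UNIV (\<lambda>n. shift f (s (r1 (r2 n)))) F sequentially"
      "uniform_limit UNIV (\<lambda>n. shift g (s (r1 (r2 n)))) G sequentially"
      using r2(2) unfolding uniformly_convergent_on_def by blast
    from uniform_limit_Pair[OF this]
    have "uniformly_convergent_on UNIV (\<lambda>n. shift (\<lambda>x. (f x, g x)) (s (r1 (r2 n))))"
      unfolding uniformly_convergent_on_def shift_def by blast
    moreover have "strict_mono (\<lambda>n. r1 (r2 n))" using r1(1) r2(1) by (simp add: strict_mono_def)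
    ultimately show ?thesis by blast
  qed
  moreover have "continuous_on UNIV (\<lambda>x. (f x, g x))"
    using f g by (intro continuous_on_Pair AP_continuous)
  ultimately show ?thesis by (simp add: AP_def)
qed

lemma near_Pair1: "near (\<lambda>x. (f x, g x)) d t s \<Longrightarrow> near f d t s"
  and near_Pair2: "near (\<lambda>x. (f x, g x)) d t s \<Longrightarrow> near g d t s"
  unfolding near_def diff_Pair
  by (meson norm_fst_le norm_snd_le order_trans)+

lemma dominated_fst: "dominated (\<lambda>x. (f x, g x)) f"
  and dominated_snd: "dominated (\<lambda>x. (f x, g x)) g"
  unfolding dominated_def using near_Pair1[THEN nearD] near_Pair2[THEN nearD] by blast+

lemma dominated_compose:
  fixes V :: "real \<Rightarrow> 'a::real_normed_vector" and f :: "real \<Rightarrow> 'b::real_normed_vector"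
    and h :: "'b \<Rightarrow> 'c::real_normed_vector"
  assumes f: "dominated V f" and h: "uniformly_continuous_on S h" and S: "\<And>x. f x \<in> S"
  shows "dominated V (\<lambda>x. h (f x))"
proof (rule dominatedI)
  fix e :: real assume "e > 0"
  then obtain d where d: "d > 0" "\<And>x y. x \<in> S \<Longrightarrow> y \<in> S \<Longrightarrow> dist y x < d \<Longrightarrow> dist (h y) (h x) < e"
    using h unfolding uniformly_continuous_on_def by metis
  have "d/2 > 0" using d(1) by simp
  then obtain c where c: "c > 0" "\<And>t s. near V c t s \<Longrightarrow> norm (f t - f s) \<le> d/2"
    using f unfolding dominated_def by blast
  have "norm (h (f t) - h (f s)) \<le> e" if "near V c t s" for t s
    using d(2)[OF S[of s] S[of t]] c(2)[OF that] d(1) by (simp add: dist_norm)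
  with c(1) show "\<exists>d>0. \<forall>t s. near V d t s \<longrightarrow> norm (h (f t) - h (f s)) \<le> e" by blast
qed

lemma dominated_bounded_linear:
  assumes f: "dominated V f" and h: "bounded_linear h"
  shows "dominated V (\<lambda>x. h (f x))"
  using dominated_compose[OF f, of UNIV h] bounded_linear.uniformly_continuous_on[OF h, of UNIV "\<lambda>x. x"]
  by (simp add: uniformly_continuous_on_id)

lemma dominated_Pair:
  assumes "dominated V f" "dominated V g"
  shows "dominated V (\<lambda>x. (f x, g x))"
proof (rule dominatedI)
  fix e :: real assume e: "e > 0"
  then obtain d1 where d1: "d1 > 0" "\<And>t s. near V d1 t s \<Longrightarrow> norm (f t - f s) \<le> e/2"
    using assms(1) unfolding dominated_def by (meson half_gt_zero)
  obtain d2 where d2: "d2 > 0" "\<And>t s. near V d2 t s \<Longrightarrow> norm (g t - g s) \<le> e/2"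
    using assms(2) e unfolding dominated_def by (meson half_gt_zero)
  have "norm ((f t, g t) - (f s, g s)) \<le> e" if "near V (min d1 d2) t s" for t s
    using d1(2)[OF near_mono[OF that]] d2(2)[OF near_mono[OF that]] norm_Pair_le[of "f t - f s" "g t - g s"]
    by simp
  with d1(1) d2(1) show "\<exists>d>0. \<forall>t s. near V d t s \<longrightarrow> norm ((f t, g t) - (f s, g s)) \<le> e"
    by (meson min_less_iff_conj)
qed

lemma dominated_add: "dominated V f \<Longrightarrow> dominated V g \<Longrightarrow> dominated V (\<lambda>x. f x + g x)"
  using dominated_bounded_linear[OF dominated_Pair bounded_linear_add[OF bounded_linear_fst bounded_linear_snd]]
  by fastforce

lemma dominated_minus: "dominated V f \<Longrightarrow> dominated V g \<Longrightarrow> dominated V (\<lambda>x. f x - g x)"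
  using dominated_bounded_linear[OF dominated_Pair bounded_linear_sub[OF bounded_linear_fst bounded_linear_snd]]
  by fastforce

lemma dominated_mult:
  fixes f g :: "real \<Rightarrow> 'b::real_normed_algebra"
  assumes f: "dominated V f" and g: "dominated V g"
    and bf: "\<And>x. norm (f x) \<le> B" and bg: "\<And>x. norm (g x) \<le> B"
  shows "dominated V (\<lambda>x. f x * g x)"
proof (rule dominatedI)
  fix e :: real assume e: "e > 0"
  have B: "B \<ge> 0" using bf[of 0] norm_ge_zero order_trans by blast
  \<comment> \<open>The summand 1 keeps the divisor positive when B = 0.\<close>
  define e' where "e' = e / (2 * B + 1)"
  have e': "e' > 0" using e B by (simp add: e'_def)
  obtain d1 where d1: "d1 > 0" "\<And>t s. near V d1 t s \<Longrightarrow> norm (f t - f s) \<le> e'"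
    using f e' unfolding dominated_def by blast
  obtain d2 where d2: "d2 > 0" "\<And>t s. near V d2 t s \<Longrightarrow> norm (g t - g s) \<le> e'"
    using g e' unfolding dominated_def by blast
  have "norm (f t * g t - f s * g s) \<le> e" if "near V (min d1 d2) t s" for t s
  proof -
    have "f t * g t - f s * g s = (f t - f s) * g t + f s * (g t - g s)"
      by (simp add: algebra_simps)
    then have "norm (f t * g t - f s * g s) \<le> norm (f t - f s) * norm (g t) + norm (f s) * norm (g t - g s)"
      by (smt (verit) norm_mult_ineq norm_triangle_ineq)
    also have "\<dots> \<le> e' * B + B * e'"
      using d1(2)[OF near_mono[OF that]] d2(2)[OF near_mono[OF that]] bf bg e' B
      by (intro add_mono mult_mono) auto
    also have "\<dots> = (2 * B) * e'" by simp
    also have "\<dots> \<le> e" unfolding e'_def using e B by (simp add: field_simps)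
    finally show ?thesis .
  qed
  with d1(1) d2(1) show "\<exists>d>0. \<forall>t s. near V d t s \<longrightarrow> norm (f t * g t - f s * g s) \<le> e"
    by (meson min_less_iff_conj)
qed

lemma AP_add: "f \<in> AP \<Longrightarrow> g \<in> AP \<Longrightarrow> (\<lambda>x. f x + g x :: 'a::banach) \<in> AP"
  using dominated_AP[OF AP_Pair dominated_add[OF dominated_fst dominated_snd]] by blast

lemma AP_minus: "f \<in> AP \<Longrightarrow> g \<in> AP \<Longrightarrow> (\<lambda>x. f x - g x :: 'a::banach) \<in> AP"
  using dominated_AP[OF AP_Pair dominated_minus[OF dominated_fst dominated_snd]] by blast

lemma AP_bounded_linear: "f \<in> AP \<Longrightarrow> bounded_linear h \<Longrightarrow> (\<lambda>x. h (f x) :: 'a::banach) \<in> AP"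
  using dominated_AP[OF _ dominated_bounded_linear[OF dominated_self]] by blast

lemma AP_const: "(\<lambda>x. c :: 'a::real_normed_vector) \<in> AP"
proof -
  have "uniformly_convergent_on UNIV (\<lambda>n::nat. shift (\<lambda>x. c) (s n))" for s
    unfolding shift_def by simp
  then show ?thesis unfolding AP_def using strict_mono_id by fastforce
qed

lemma AP_mult:
  fixes f g :: "real \<Rightarrow> 'a::{real_normed_algebra,banach}"
  assumes "f \<in> AP" "g \<in> AP"
  shows "(\<lambda>x. f x * g x) \<in> AP"
proof -
  obtain B1 where B1: "B1 > 0" "\<And>x. norm (f x) \<le> B1" by (rule AP_bounded[OF assms(1)]) blast
  obtain B2 where B2: "B2 > 0" "\<And>x. norm (g x) \<le> B2" by (rule AP_bounded[OF assms(2)]) blast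
  have "dominated (\<lambda>x. (f x, g x)) (\<lambda>x. f x * g x)"
    by (rule dominated_mult[OF dominated_fst dominated_snd, where B = "max B1 B2"])
      (use B1 B2 in \<open>auto simp: le_max_iff_disj\<close>)
  then show ?thesis using dominated_AP[OF AP_Pair[OF assms]] by blast
qed

text \<open>Translation multiplies a character by a number of modulus 1, so compactness of the unit
  circle suffices.\<close>

lemma AP_cis: "(\<lambda>x. cis (\<xi> * x)) \<in> AP"
proof -
  have "\<exists>r :: nat \<Rightarrow> nat. strict_mono r \<and> uniformly_convergent_on UNIV (\<lambda>n. shift (\<lambda>x. cis (\<xi> * x)) (s (r n)))" for s
  proof -
    have "\<exists>l\<in>sphere 0 1. \<exists>r :: nat \<Rightarrow> nat. strict_mono r \<and> ((\<lambda>n. cis (\<xi> * s n)) \<circ> r) \<longlonglongrightarrow> l"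
      using compact_sphere[of "0::complex" 1, unfolded compact_def] by simp
    then obtain l r where r: "strict_mono (r :: nat \<Rightarrow> nat)" "(\<lambda>n. cis (\<xi> * s (r n))) \<longlonglongrightarrow> l"
      by (auto simp: o_def)
    have "uniform_limit UNIV (\<lambda>n. shift (\<lambda>x. cis (\<xi> * x)) (s (r n))) (\<lambda>x. cis (\<xi> * x) * l) sequentially"
    proof (rule uniform_limitI)
      fix e :: real assume "e > 0"
      then have "\<forall>\<^sub>F n in sequentially. dist (cis (\<xi> * s (r n))) l < e" using r(2) tendstoD by blast
      then show "\<forall>\<^sub>F n in sequentially. \<forall>x\<in>UNIV. dist (shift (\<lambda>x. cis (\<xi> * x)) (s (r n)) x) (cis (\<xi> * x) * l) < e"
      proof eventually_elim
        case (elim n)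
        have "norm (cis (\<xi> * (x + s (r n))) - cis (\<xi> * x) * l) = norm (cis (\<xi> * s (r n)) - l)" for x
        proof -
          have "cis (\<xi> * (x + s (r n))) - cis (\<xi> * x) * l = cis (\<xi> * x) * (cis (\<xi> * s (r n)) - l)"
            by (simp add: cis_mult ring_distribs)
          then show ?thesis by (simp add: norm_mult)
        qed
        with elim show ?case by (simp add: shift_def dist_norm)
      qed
    qed
    with r(1) show ?thesis unfolding uniformly_convergent_on_def by blast
  qed
  then show ?thesis by (simp add: AP_def continuous_intros)
qed

lemma AP_shift: "f \<in> AP \<Longrightarrow> (\<lambda>x. f (x + t) :: 'a::banach) \<in> AP"
proof (rule dominated_AP, assumption, rule dominatedI)
  fix e :: real assume e: "e > 0"
  show "\<exists>d>0. \<forall>ta s. near f d ta s \<longrightarrow> norm (f (ta + t) - f (s + t)) \<le> e"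
    by (intro exI[of _ e] conjI e) (auto simp: near_def add.commute)
qed

section \<open>Means and Fourier coefficients\<close>

lemma integral_shift_0:
  fixes f :: "real \<Rightarrow> 'a::euclidean_space"
  assumes "continuous_on UNIV f"
  shows "integral {a..a + T} f = integral {0..T} (\<lambda>x. f (x + a))"
  using integral_shift[of 0 a T f] continuous_on_subset[OF assms] by (simp add: o_def add.commute)

lemma norm_average_le:
  assumes "c > 0" "norm I \<le> B * c"
  shows "norm (complex_of_real (1 / c) * I) \<le> B"
  using assms by (simp add: norm_mult norm_divide pos_divide_le_eq)

definition mean :: "(real \<Rightarrow> complex) \<Rightarrow> complex" where
  "mean f = Lim at_top (\<lambda>t. complex_of_real (1 / t) * integral {0..t} f)"

lemma AP_integrable: "f \<in> AP \<Longrightarrow> f integrable_on {a..b}"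
  for f :: "real \<Rightarrow> complex"
  by (rule integrable_continuous_interval) (metis AP_continuous continuous_on_subset subset_UNIV)

text \<open>Averages over windows of length n + 1, regarded as functions of the left endpoint,
  satisfy the same \<open>near\<close> bounds as f and so have a uniformly convergent subsequence.
  Its limit is constant, and one good window length then controls all long windows.\<close>

lemma AP_uniform_mean:
  assumes f: "f \<in> AP"
  obtains m where "\<And>e. e > 0 \<Longrightarrow> \<exists>T0>0. \<forall>T\<ge>T0. \<forall>a. norm (complex_of_real (1 / T) * integral {a..a + T} f - m) \<le> e"
proof -
  note cont = AP_continuous[OF f]
  have contab: "continuous_on {a..b} f" for a b
    using continuous_on_subset[OF cont] by blast
  obtain B where B: "B > 0" "\<And>x. norm (f x) \<le> B" by (rule AP_bounded[OF f]) blast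
  define F where "F n a = complex_of_real (1 / (real n + 1)) * integral {a..a + (real n + 1)} f" for n :: nat and a
  have ibd: "norm (integral {a..b} f) \<le> B * (b - a)" if "a \<le> b" for a b
    by (rule integral_bound[OF that contab]) (use B in auto)
  have Fbd: "norm (F n a) \<le> B" for n a
    unfolding F_def by (rule norm_average_le) (use ibd[of a "a + (real n + 1)"] in auto)
  have dom: "norm (F n t - F n s) \<le> e" if "near f e t s" for n t s e
  proof -
    have "integral {t..t + (real n + 1)} f - integral {s..s + (real n + 1)} f =
        integral {0..real n + 1} (\<lambda>x. f (x + t)) - integral {0..real n + 1} (\<lambda>x. f (x + s))"
      using cont by (simp only: integral_shift_0)
    also have "\<dots> = integral {0..real n + 1} (\<lambda>x. f (x + t) - f (x + s))"
      by (rule integral_diff[symmetric]; rule integrable_continuous_interval;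
          rule continuous_on_compose2[OF cont]) (auto intro!: continuous_intros)
    finally have eq: "integral {t..t + (real n + 1)} f - integral {s..s + (real n + 1)} f =
        integral {0..real n + 1} (\<lambda>x. f (x + t) - f (x + s))" .
    have "norm (integral {t..t + (real n + 1)} f - integral {s..s + (real n + 1)} f) \<le> e * (real n + 1 - 0)"
      unfolding eq
    proof (rule integral_bound)
      show "continuous_on {0..real n + 1} (\<lambda>x. f (x + t) - f (x + s))"
        by (intro continuous_on_diff continuous_on_compose2[OF cont] continuous_intros) auto
    qed (use that in \<open>auto simp: near_def\<close>)
    then show ?thesis
      unfolding F_def right_diff_distrib[symmetric] by (intro norm_average_le) auto
  qed
  obtain r G where r: "strict_mono (r :: nat \<Rightarrow> nat)" and G: "uniform_limit UNIV (\<lambda>n. F (r n)) G sequentially"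
    by (rule AP_compactness[OF f, of F B]) (use dom Fbd in blast)+
  have Gconst: "G a = G 0" for a
  proof -
    \<comment> \<open>Moving a window by \<open>a\<close> exchanges two end pieces of length
      \<open>\<bar>a\<bar>\<close>; after averaging the effect is of order 1 / n.\<close>
    have "norm (F n a - F n 0) \<le> 2 * B * \<bar>a\<bar> * inverse (real (Suc n))" for n
    proof -
      have split: "norm (integral {a..a + c} f - integral {b..b + c} f) \<le> 2 * B * (b - a)" if "a \<le> b" "c \<ge> 0" for a b c
      proof -
        have "integral {a..b} f + integral {b..b + c} f = integral {a..b + c} f"
          by (rule Henstock_Kurzweil_Integration.integral_combine) (use that AP_integrable[OF f] in auto)
        moreover have "integral {a..a + c} f + integral {a + c..b + c} f = integral {a..b + c} f"
          by (rule Henstock_Kurzweil_Integration.integral_combine) (use that AP_integrable[OF f] in auto)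
        ultimately have "integral {a..a + c} f - integral {b..b + c} f = integral {a..b} f - integral {a + c..b + c} f"
          by (simp add: algebra_simps)
        also have "norm \<dots> \<le> norm (integral {a..b} f) + norm (integral {a + c..b + c} f)"
          by (rule norm_triangle_ineq4)
        also have "\<dots> \<le> B * (b - a) + B * (b + c - (a + c))"
          by (intro add_mono ibd) (use that in auto)
        finally show ?thesis by (simp add: algebra_simps)
      qed
      have le: "norm (integral {a..a + (real n + 1)} f - integral {0..0 + (real n + 1)} f) \<le> 2 * B * \<bar>a\<bar>"
        using split[of a 0 "real n + 1"] split[of 0 a "real n + 1"]
        by (cases "a \<le> 0") (auto simp: norm_minus_commute)
      have eq: "2 * B * \<bar>a\<bar> = 2 * B * \<bar>a\<bar> * inverse (real (Suc n)) * (real n + 1)"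
        by (simp add: field_simps)
      show ?thesis
        unfolding F_def right_diff_distrib[symmetric]
        by (rule norm_average_le[OF _ order_trans[OF le eq_refl[OF eq]]]) simp
    qed
    then have nle: "norm (F (r n) a - F (r n) 0) \<le> 2 * B * \<bar>a\<bar> * inverse (real (Suc n))" for n
    proof -
      have "inverse (real (Suc (r n))) \<le> inverse (real (Suc n))"
        using seq_suble[OF r, of n] by (intro le_imp_inverse_le) auto
      then have "2 * B * \<bar>a\<bar> * inverse (real (Suc (r n))) \<le> 2 * B * \<bar>a\<bar> * inverse (real (Suc n))"
        using B(1) by (intro mult_left_mono) auto
      with \<open>\<And>n. norm (F n a - F n 0) \<le> 2 * B * \<bar>a\<bar> * inverse (real (Suc n))\<close>[of "r n"] show ?thesis by linarith
    qed
    have "(\<lambda>n. 2 * B * \<bar>a\<bar> * inverse (real (Suc n))) \<longlonglongrightarrow> 0"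
      using tendsto_mult_right_zero[OF LIMSEQ_inverse_real_of_nat] .
    then have "(\<lambda>n. F (r n) a - F (r n) 0) \<longlonglongrightarrow> 0"
      by (rule Lim_null_comparison[OF always_eventually, rotated]) (use nle in blast)
    moreover have "(\<lambda>n. F (r n) a - F (r n) 0) \<longlonglongrightarrow> G a - G 0"
      by (intro tendsto_diff tendsto_uniform_limitI[OF G]) auto
    ultimately have "G a - G 0 = 0" using LIMSEQ_unique by blast
    then show ?thesis by simp
  qed
  define c where "c = G 0"
  have "\<exists>T0>0. \<forall>T\<ge>T0. \<forall>a. norm (complex_of_real (1 / T) * integral {a..a + T} f - c) \<le> e" if e: "e > 0" for e
  proof -
    have "\<forall>\<^sub>F n in sequentially. \<forall>a\<in>UNIV. dist (F (r n) a) (G a) < e/2"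
      using uniform_limitD[OF G, of "e/2"] e by simp
    then obtain n where "\<And>a. dist (F (r n) a) (G a) < e/2"
      unfolding eventually_sequentially by blast
    then have n: "norm (F (r n) a - c) \<le> e/2" for a
      unfolding c_def using Gconst[of a] by (metis dist_norm less_imp_le)
    \<comment> \<open>A single window length that is good for every left endpoint. Longer windows
      are cut into copies of it and a remainder of length at most T.\<close>
    define T where "T = real (r n) + 1"
    have T: "T > 0" by (simp add: T_def)
    have blk: "norm (integral {a..a + T} f - of_real T * c) \<le> T * (e/2)" for a
    proof -
      have "integral {a..a + T} f - of_real T * c = of_real T * (F (r n) a - c)"
        using T unfolding F_def T_def[symmetric] by (simp add: field_simps)
      then show ?thesis using n[of a] T by (simp add: norm_mult)
    qed
    have blks: "norm (integral {a..a + real K * T} f - of_real (real K * T) * c) \<le> real K * T * (e/2)" for a K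
    proof (induction K)
      case (Suc K)
      have le: "a \<le> a + real K * T" "a + real K * T \<le> a + real K * T + T" using T by auto
      have "integral {a..a + real K * T} f + integral {a + real K * T..a + real K * T + T} f = integral {a..a + real K * T + T} f"
        by (rule Henstock_Kurzweil_Integration.integral_combine[OF le]) (use AP_integrable[OF f] in auto)
      then have "integral {a..a + real (Suc K) * T} f - of_real (real (Suc K) * T) * c =
         (integral {a..a + real K * T} f - of_real (real K * T) * c) + (integral {a + real K * T..a + real K * T + T} f - of_real T * c)"
        by (simp add: algebra_simps)
      also have "norm \<dots> \<le> real K * T * (e/2) + T * (e/2)"
        using Suc.IH blk[of "a + real K * T"] by (meson add_mono norm_triangle_ineq order_trans)
      finally show ?case by (simp add: algebra_simps)
    qed auto
    \<comment> \<open>From this length on, the cost \<open>T * (B + norm c)\<close> of the remainder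
      is at most half of the allowed error \<open>S * e\<close>.\<close>
    define T0 where "T0 = max T (2 * T * (B + norm c) / e)"
    have "norm (complex_of_real (1 / S) * integral {a..a + S} f - c) \<le> e" if S: "S \<ge> T0" for S a
    proof -
      define K where "K = nat \<lfloor>S / T\<rfloor>"
      have ST: "S \<ge> T" "S * e \<ge> 2 * T * (B + norm c)" using S e unfolding T0_def by (auto simp: field_simps)
      have S0: "S > 0" using ST T by linarith
      have K1: "real K \<le> S / T" "S / T < real K + 1"
        using S0 T unfolding K_def by (auto simp: le_floor_iff) 
      have K: "real K * T \<le> S" "S \<le> real K * T + T" using K1 T by (auto simp: field_simps)
      have le: "a \<le> a + real K * T" "a + real K * T \<le> a + S" using T K by auto
      have "integral {a..a + real K * T} f + integral {a + real K * T..a + S} f = integral {a..a + S} f"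
        by (rule Henstock_Kurzweil_Integration.integral_combine[OF le]) (use AP_integrable[OF f] in auto)
      then have "integral {a..a + S} f - of_real S * c =
         (integral {a..a + real K * T} f - of_real (real K * T) * c) + (integral {a + real K * T..a + S} f - of_real (S - real K * T) * c)"
        by (simp add: algebra_simps)
      moreover have "norm (integral {a + real K * T..a + S} f - of_real (S - real K * T) * c) \<le> T * (B + norm c)"
      proof -
        have "norm (integral {a + real K * T..a + S} f - of_real (S - real K * T) * c) \<le> B * (S - real K * T) + (S - real K * T) * norm c"
          using ibd[OF le(2)] K
          by (intro order_trans[OF norm_triangle_ineq4] add_mono) (auto simp: norm_mult simp flip: of_real_mult of_real_diff)
        also have "\<dots> = (S - real K * T) * (B + norm c)" by (simp add: algebra_simps)
        also have "\<dots> \<le> T * (B + norm c)" using K B by (intro mult_right_mono) auto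
        finally show ?thesis .
      qed
      ultimately have "norm (integral {a..a + S} f - of_real S * c) \<le> real K * T * (e/2) + T * (B + norm c)"
        using blks[of a K] by (smt (verit) norm_triangle_ineq)
      also have "\<dots> \<le> S * (e/2) + S * (e/2)"
        using K ST e by (intro add_mono mult_right_mono) auto
      finally have *: "norm (integral {a..a + S} f - of_real S * c) \<le> S * e" by simp
      have "complex_of_real (1 / S) * integral {a..a + S} f - c = of_real (1/S) * (integral {a..a + S} f - of_real S * c)"
        using S0 by (simp add: field_simps)
      then show ?thesis using * S0 by (simp add: norm_mult norm_divide field_simps)
    qed
    then show ?thesis using T by (intro exI[of _ T0]) (auto simp: T0_def)
  qed
  then show ?thesis using that by blast
qed

lemma AP_mean_uniform:
  assumes f: "f \<in> AP" and e: "e > 0"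
  obtains T0 where "T0 > 0"
    "\<And>T a. T \<ge> T0 \<Longrightarrow> norm (complex_of_real (1 / T) * integral {a..a + T} f - mean f) \<le> e"
proof -
  obtain m where m: "\<And>e. e > 0 \<Longrightarrow> \<exists>T0>0. \<forall>T\<ge>T0. \<forall>a. norm (complex_of_real (1 / T) * integral {a..a + T} f - m) \<le> e"
    by (rule AP_uniform_mean[OF f]) blast
  have "((\<lambda>t. complex_of_real (1 / t) * integral {0..t} f) \<longlongrightarrow> m) at_top"
  proof (rule tendstoI)
    fix e :: real assume "e > 0"
    then obtain T0 where T0: "\<And>T a. T \<ge> T0 \<Longrightarrow> norm (complex_of_real (1 / T) * integral {a..a + T} f - m) \<le> e/2"
      using m[of "e/2"] by auto
    show "\<forall>\<^sub>F t in at_top. dist (complex_of_real (1 / t) * integral {0..t} f) m < e"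
      unfolding eventually_at_top_linorder
    proof (intro exI[of _ T0] allI impI)
      fix t assume "t \<ge> T0"
      from T0[OF this, of 0] \<open>e > 0\<close> show "dist (complex_of_real (1 / t) * integral {0..t} f) m < e"
        by (simp add: dist_norm)
    qed
  qed
  then have "mean f = m" unfolding mean_def by (intro tendsto_Lim) auto
  with m[OF e] that show ?thesis by blast
qed

lemma mean_tendsto_shift:
  assumes f: "f \<in> AP"
  shows "((\<lambda>t. complex_of_real (1 / t) * integral {a..a + t} f) \<longlongrightarrow> mean f) at_top"
proof (rule tendstoI)
  fix e :: real assume e: "e > 0"
  then have "e/2 > 0" by simp
  then obtain T0 where T0: "T0 > 0" "\<And>T a. T \<ge> T0 \<Longrightarrow> norm (complex_of_real (1 / T) * integral {a..a + T} f - mean f) \<le> e/2"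
    by (rule AP_mean_uniform[OF f]) blast
  show "\<forall>\<^sub>F t in at_top. dist (complex_of_real (1 / t) * integral {a..a + t} f) (mean f) < e"
    unfolding eventually_at_top_linorder
  proof (intro exI[of _ T0] allI impI)
    fix t assume "t \<ge> T0"
    from T0(2)[OF this, of a] e show "dist (complex_of_real (1 / t) * integral {a..a + t} f) (mean f) < e"
      by (simp add: dist_norm)
  qed
qed

lemma mean_tendsto:
  "f \<in> AP \<Longrightarrow> ((\<lambda>t. complex_of_real (1 / t) * integral {0..t} f) \<longlongrightarrow> mean f) at_top"
  using mean_tendsto_shift[of f 0] by simp

lemma mean_eqI: "((\<lambda>t. complex_of_real (1 / t) * integral {0..t} f) \<longlongrightarrow> m) at_top \<Longrightarrow> mean f = m"
  unfolding mean_def by (intro tendsto_Lim) auto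

lemma mean_add: "f \<in> AP \<Longrightarrow> g \<in> AP \<Longrightarrow> mean (\<lambda>x. f x + g x) = mean f + mean g"
  using tendsto_add[OF mean_tendsto mean_tendsto, of f g]
  by (intro mean_eqI) (simp add: integral_add AP_integrable distrib_left)

lemma mean_diff: "f \<in> AP \<Longrightarrow> g \<in> AP \<Longrightarrow> mean (\<lambda>x. f x - g x) = mean f - mean g"
  using tendsto_diff[OF mean_tendsto mean_tendsto, of f g]
  by (intro mean_eqI) (simp add: integral_diff AP_integrable right_diff_distrib)

lemma mean_cmult: "f \<in> AP \<Longrightarrow> mean (\<lambda>x. c * f x) = c * mean f"
  using tendsto_mult[OF tendsto_const mean_tendsto, of f c]
  by (intro mean_eqI) (simp add: mult.left_commute)

lemma mean_shift: "f \<in> AP \<Longrightarrow> mean (\<lambda>x. f (x + a)) = mean f"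
  using mean_tendsto_shift[of f a]
  by (intro mean_eqI) (simp add: integral_shift_0[OF AP_continuous])

lemma mean_const: "mean (\<lambda>x. c) = c"
proof (rule mean_eqI, rule tendsto_eventually)
  show "\<forall>\<^sub>F t in at_top. complex_of_real (1 / t) * integral {0..t} (\<lambda>x. c) = c"
    using eventually_gt_at_top[of 0]
    by eventually_elim (simp add: scaleR_conv_of_real)
qed

lemma norm_mean_le:
  assumes f: "f \<in> AP" and "\<And>x. norm (f x) \<le> B"
  shows "norm (mean f) \<le> B"
proof -
  have "((\<lambda>t. norm (complex_of_real (1 / t) * integral {0..t} f)) \<longlongrightarrow> norm (mean f)) at_top"
    by (intro tendsto_norm mean_tendsto f)
  moreover have "\<forall>\<^sub>F t in at_top. norm (complex_of_real (1 / t) * integral {0..t} f) \<le> B"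
    using eventually_gt_at_top[of 0]
  proof eventually_elim
    case (elim t)
    then have "norm (integral {0..t} f) \<le> B * (t - 0)"
      using assms(2) by (intro integral_bound continuous_on_subset[OF AP_continuous[OF f]]) auto
    then show ?case using elim by (simp add: norm_mult norm_divide field_simps)
  qed
  ultimately show ?thesis by (rule tendsto_upperbound) auto
qed

lemma Re_mean_nonneg:
  assumes f: "f \<in> AP" and "\<And>x. Re (f x) \<ge> 0"
  shows "Re (mean f) \<ge> 0"
proof -
  have "((\<lambda>t. Re (complex_of_real (1 / t) * integral {0..t} f)) \<longlongrightarrow> Re (mean f)) at_top"
    by (intro tendsto_Re mean_tendsto f)
  moreover have "\<forall>\<^sub>F t in at_top. Re (complex_of_real (1 / t) * integral {0..t} f) \<ge> 0"
    using eventually_gt_at_top[of 0]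
  proof eventually_elim
    case (elim t)
    have "Re (integral {0..t} f) = integral {0..t} (\<lambda>x. Re (f x))"
      using integral_linear[OF AP_integrable[OF f] bounded_linear_Re, of 0 t] by (simp add: o_def)
    also have "\<dots> \<ge> 0" using assms(2) by (intro integral_nonneg integrable_continuous_interval
        continuous_on_Re continuous_on_subset[OF AP_continuous[OF f]]) auto
    finally show ?case using elim by simp
  qed
  ultimately show ?thesis by (rule tendsto_lowerbound) auto
qed

lemma AP_sum: "(\<And>i. i \<in> A \<Longrightarrow> f i \<in> AP) \<Longrightarrow> (\<lambda>x. \<Sum>i\<in>A. f i x :: 'a::banach) \<in> AP"
  by (induction A rule: infinite_finite_induct) (simp_all add: AP_const AP_add)

lemma mean_sum: "finite A \<Longrightarrow> (\<And>i. i \<in> A \<Longrightarrow> f i \<in> AP) \<Longrightarrow> mean (\<lambda>x. \<Sum>i\<in>A. f i x) = (\<Sum>i\<in>A. mean (f i))"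
  by (induction A rule: finite_induct) (simp_all add: mean_const mean_add AP_sum)

text \<open>A finite net of translates: summing \<open>f\<close> over it gives a function bounded below.\<close>

lemma Re_mean_pos:
  assumes f: "f \<in> AP" and nn: "\<And>x. Re (f x) \<ge> 0" and pos: "Re (f x0) > 0"
  shows "Re (mean f) > 0"
proof -
  define e where "e = Re (f x0) / 2"
  have e: "e > 0" using pos by (simp add: e_def)
  obtain T where T: "finite T" "T \<noteq> {}" "\<And>t. \<exists>s\<in>T. near f e t s"
    by (rule AP_net[OF f e]) blast
  \<comment> \<open>If x is near s, then \<open>f (x + (x0 - s))\<close> is within e of
    \<open>f x0\<close>. Since every x is near some s in T, some summand always has real part at
    least e.\<close>
  define g where "g x = (\<Sum>s\<in>T. f (x + (x0 - s)))" for x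
  have g: "g \<in> AP" unfolding g_def using f by (intro AP_sum AP_shift)
  have mg: "mean g = of_nat (card T) * mean f"
    unfolding g_def using T f by (simp add: mean_sum AP_shift mean_shift)
  have "Re (g x - of_real e) \<ge> 0" for x
  proof -
    obtain s where s: "s \<in> T" "near f e x s" using T(3) by blast
    have "norm (f (x0 - s + x) - f (x0 - s + s)) \<le> e" using s(2) unfolding near_def by blast
    then have "\<bar>Re (f (x0 - s + x) - f x0)\<bar> \<le> e" using abs_Re_le_cmod order_trans by fastforce
    moreover have "x0 - s + x = x + (x0 - s)" by simp
    ultimately have "\<bar>Re (f (x + (x0 - s))) - Re (f x0)\<bar> \<le> e" by (metis minus_complex.sel(1))
    then have "e \<le> Re (f (x + (x0 - s)))" unfolding e_def by linarith
    also have "\<dots> \<le> (\<Sum>s\<in>T. Re (f (x + (x0 - s))))"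
      using s(1) T(1) nn by (intro member_le_sum) auto
    finally show ?thesis by (simp add: g_def)
  qed
  then have "Re (mean (\<lambda>x. g x - of_real e)) \<ge> 0"
    by (intro Re_mean_nonneg AP_minus g AP_const)
  then have "real (card T) * Re (mean f) \<ge> e"
    using g by (simp add: mean_diff AP_const mean_const mg)
  then show ?thesis using e by (smt (verit) mult_nonneg_nonpos of_nat_0_le_iff)
qed

lemma mean_uniform_limit:
  assumes F: "\<And>n. F n \<in> AP" and G: "G \<in> AP" and lim: "uniform_limit UNIV F G sequentially"
  shows "(\<lambda>n. mean (F n)) \<longlonglongrightarrow> mean G"
proof (rule LIMSEQ_I)
  fix e :: real assume e: "e > 0"
  then have "\<forall>\<^sub>F n in sequentially. \<forall>x\<in>UNIV. dist (F n x) (G x) < e/2"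
    using uniform_limitD[OF lim, of "e/2"] by simp
  then obtain N where N: "\<And>n x. n \<ge> N \<Longrightarrow> norm (F n x - G x) < e/2"
    unfolding eventually_sequentially dist_norm by blast
  have "norm (mean (F n) - mean G) < e" if "n \<ge> N" for n
  proof -
    have "norm (mean (\<lambda>x. F n x - G x)) \<le> e/2"
      using N[OF that] by (intro norm_mean_le AP_minus F G) (simp add: less_imp_le)
    then show ?thesis using e by (simp add: mean_diff F G)
  qed
  then show "\<exists>no. \<forall>n\<ge>no. norm (mean (F n) - mean G) < e" by blast
qed

section \<open>Fourier coefficients and translations\<close>

lemma fourier_coeff_mean: "fourier_coeff f \<xi> = mean (\<lambda>x. f x * cis (- \<xi> * x))"
  unfolding fourier_coeff_def mean_def by (simp add: cis_conv_exp mult.assoc)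

lemma AP_mult_cis: "f \<in> AP \<Longrightarrow> (\<lambda>x. f x * cis (\<xi> * x)) \<in> AP"
  by (intro AP_mult AP_cis)

lemma fourier_diff: "f \<in> AP \<Longrightarrow> g \<in> AP \<Longrightarrow> fourier_coeff (\<lambda>x. f x - g x) \<xi> = fourier_coeff f \<xi> - fourier_coeff g \<xi>"
  unfolding fourier_coeff_mean left_diff_distrib by (intro mean_diff AP_mult_cis)

lemma fourier_add: "f \<in> AP \<Longrightarrow> g \<in> AP \<Longrightarrow> fourier_coeff (\<lambda>x. f x + g x) \<xi> = fourier_coeff f \<xi> + fourier_coeff g \<xi>"
  unfolding fourier_coeff_mean distrib_right by (intro mean_add AP_mult_cis)

lemma fourier_cmult: "f \<in> AP \<Longrightarrow> fourier_coeff (\<lambda>x. c * f x) \<xi> = c * fourier_coeff f \<xi>"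
  unfolding fourier_coeff_mean mult.assoc by (intro mean_cmult AP_mult_cis)

lemma norm_fourier_le: "f \<in> AP \<Longrightarrow> (\<And>x. norm (f x) \<le> B) \<Longrightarrow> norm (fourier_coeff f \<xi>) \<le> B"
  unfolding fourier_coeff_mean by (intro norm_mean_le AP_mult_cis) (simp_all add: norm_mult)

lemma fourier_shift:
  assumes f: "f \<in> AP"
  shows "fourier_coeff (\<lambda>x. f (x + t)) \<xi> = cis (\<xi> * t) * fourier_coeff f \<xi>"
proof -
  have "f (x + t) * cis (- \<xi> * x) = cis (\<xi> * t) * (f (x + t) * cis (- \<xi> * (x + t)))" for x
  proof -
    have "cis (- \<xi> * x) = cis (\<xi> * t) * cis (- \<xi> * (x + t))"
      unfolding cis_mult by (simp add: algebra_simps)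
    then show ?thesis by (simp only: ac_simps)
  qed
  then have "fourier_coeff (\<lambda>x. f (x + t)) \<xi> = mean (\<lambda>x. cis (\<xi> * t) * (f (x + t) * cis (- \<xi> * (x + t))))"
    unfolding fourier_coeff_mean by (simp only:)
  also have "\<dots> = cis (\<xi> * t) * mean (\<lambda>x. f (x + t) * cis (- \<xi> * (x + t)))"
    by (rule mean_cmult[OF AP_shift[OF AP_mult_cis[OF f]]])
  also have "mean (\<lambda>x. f (x + t) * cis (- \<xi> * (x + t))) = fourier_coeff f \<xi>"
    unfolding fourier_coeff_mean by (rule mean_shift[OF AP_mult_cis[OF f]])
  finally show ?thesis .
qed

text \<open>A translation multiplies the coefficient at \<xi> by a character value. Near translates
  therefore force that character to move little, with a strength given by the size of the
  coefficient.\<close>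

lemma fourier_near:
  assumes f: "f \<in> AP" and "near f d t s"
  shows "norm (cis (\<xi> * t) - cis (\<xi> * s)) * norm (fourier_coeff f \<xi>) \<le> d"
proof -
  have "norm (fourier_coeff (\<lambda>x. f (x + t) - f (x + s)) \<xi>) \<le> d"
    using assms(2) unfolding near_def by (intro norm_fourier_le AP_minus AP_shift f) blast
  moreover have "fourier_coeff (\<lambda>x. f (x + t) - f (x + s)) \<xi> = (cis (\<xi> * t) - cis (\<xi> * s)) * fourier_coeff f \<xi>"
    using f by (simp add: fourier_diff AP_shift fourier_shift algebra_simps)
  ultimately show ?thesis by (simp add: norm_mult)
qed

lemma fourier_mult_cis: "fourier_coeff (\<lambda>x. f x * cis (\<mu> * x)) \<nu> = fourier_coeff f (\<nu> - \<mu>)"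
  unfolding fourier_coeff_mean by (simp add: mult.assoc cis_mult algebra_simps)

text \<open>The shift by \<open>pi / \<nu>\<close> multiplies the coefficient by -1 but leaves the
  constant function unchanged.\<close>

lemma fourier_one: "\<nu> \<noteq> 0 \<Longrightarrow> fourier_coeff (\<lambda>x. 1) \<nu> = 0"
  using fourier_shift[of "\<lambda>x. 1" "pi / \<nu>" \<nu>] by (simp add: AP_const)

lemma fourier_uniform_limit:
  assumes F: "\<And>n. F n \<in> AP" and G: "G \<in> AP" and lim: "uniform_limit UNIV F G sequentially"
  shows "(\<lambda>n. fourier_coeff (F n) \<xi>) \<longlonglongrightarrow> fourier_coeff G \<xi>"
  unfolding fourier_coeff_mean
proof (rule mean_uniform_limit)
  show "uniform_limit UNIV (\<lambda>n x. F n x * cis (- \<xi> * x)) (\<lambda>x. G x * cis (- \<xi> * x)) sequentially"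
    using lim unfolding uniform_limit_iff dist_norm by (simp add: norm_mult flip: left_diff_distrib)
qed (intro AP_mult_cis F G)+

section \<open>A Fourier coefficient for every nonzero almost periodic function\<close>

lemma sum_cis_roots:
  fixes m :: int and n :: nat
  assumes n: "n > 0" and m: "\<bar>m\<bar> < int n"
  shows "(\<Sum>k<n. cis (2 * pi * real k * of_int m / real n)) = (if m = 0 then of_nat n else 0)"
proof (cases "m = 0")
  case False
  define z where "z = cis (2 * pi * of_int m / real n)"
  have zk: "z ^ k = cis (2 * pi * real k * of_int m / real n)" for k
  proof -
    have "z ^ k = cis (real k * (2 * pi * of_int m / real n))" unfolding z_def by (rule Complex.DeMoivre)
    also have "real k * (2 * pi * of_int m / real n) = 2 * pi * real k * of_int m / real n" by simp
    finally show ?thesis .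
  qed
  have "z \<noteq> 1"
  proof
    assume "z = 1"
    then have "cos (2 * pi * of_int m / real n) = 1"
      unfolding z_def by (metis cis.sel(1) one_complex.sel(1))
    then obtain j :: int where "2 * pi * of_int m / real n = of_int j * 2 * pi"
      unfolding cos_one_2pi_int by blast
    then have "of_int m = of_int j * real n" using n by (simp add: field_simps)
    then have mj: "m = j * int n" by (metis of_int_eq_iff of_int_mult of_int_of_nat_eq)
    with False have "\<bar>j\<bar> \<ge> 1" by auto
    then have "\<bar>j\<bar> * int n \<ge> 1 * int n" by (rule mult_right_mono) simp
    then have "\<bar>m\<bar> \<ge> int n" unfolding mj by (simp add: abs_mult)
    with m show False by simp
  qed
  have "2 * pi * real n * of_int m / real n = 2 * pi * of_int m" using n by simp
  then have "z ^ n = cis (2 * pi * of_int m)" unfolding zk by (simp only:)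
  then have "z ^ n = 1" using cis_multiple_2pi[of "of_int m"] by simp
  then have "(\<Sum>k<n. z ^ k) = 0" using geometric_sum[OF \<open>z \<noteq> 1\<close>, of n] by simp
  with False show ?thesis unfolding zk by simp
qed simp

text \<open>The set A is arbitrary because the identity is applied both to the samples of g and to
  the indicator of a set of shifts.\<close>

lemma dft_parseval:
  fixes G H :: "nat \<Rightarrow> complex"
  assumes n: "n > 0" and A: "A \<subseteq> {..<n}"
  shows "(\<Sum>k<n. (norm (\<Sum>a\<in>A. G a * cis (- (2 * pi * real k / real n) * real a)))\<^sup>2) = real n * (\<Sum>a\<in>A. (norm (G a))\<^sup>2)"
proof -
  define e where "e k a = cis (- (2 * pi * real k / real n) * real a)" for k a :: nat
  have fA: "finite A" using A finite_subset by blast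
  have ee: "(\<Sum>k<n. e k a * cnj (e k b)) = (if a = b then of_nat n else 0)" if "a \<in> A" "b \<in> A" for a b
  proof -
    have "e k a * cnj (e k b) = cis (2 * pi * real k * of_int (int b - int a) / real n)" for k
      unfolding e_def cis_cnj cis_mult by (rule arg_cong[of _ _ cis]) (use n in \<open>simp add: field_simps\<close>)
    moreover have "a < n" "b < n" using that A by auto
    then have "\<bar>int b - int a\<bar> < int n" by linarith
    ultimately show ?thesis using sum_cis_roots[OF n, of "int b - int a"] by simp
  qed
  have "complex_of_real (\<Sum>k<n. (norm (\<Sum>a\<in>A. G a * e k a))\<^sup>2)
      = (\<Sum>k<n. \<Sum>a\<in>A. \<Sum>b\<in>A. G a * cnj (G b) * (e k a * cnj (e k b)))"
    unfolding of_real_sum complex_norm_square cnj_sum complex_cnj_mult sum_product by (simp add: mult_ac)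
  also have "\<dots> = (\<Sum>a\<in>A. \<Sum>b\<in>A. G a * cnj (G b) * (\<Sum>k<n. e k a * cnj (e k b)))"
    by (subst sum.swap, rule sum.cong[OF refl], subst sum.swap) (simp add: sum_distrib_left)
  also have "\<dots> = (\<Sum>a\<in>A. \<Sum>b\<in>A. if a = b then of_nat n * (G a * cnj (G a)) else 0)"
    by (intro sum.cong refl) (use ee in \<open>auto simp: mult_ac\<close>)
  also have "\<dots> = (\<Sum>a\<in>A. of_nat n * (G a * cnj (G a)))"
    using fA by (simp add: sum.delta)
  also have "\<dots> = complex_of_real (real n * (\<Sum>a\<in>A. (norm (G a))\<^sup>2))"
    unfolding of_real_mult of_real_sum complex_norm_square by (simp add: sum_distrib_left)
  finally show ?thesis unfolding e_def of_real_eq_iff .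
qed

text \<open>The samples are padded by zeros up to \<open>2 N\<close>, so that the shifts do not wrap around.\<close>

lemma dft_large_coefficient:
  fixes G :: "nat \<Rightarrow> complex"
  assumes N: "N > 0" and P: "P \<subseteq> {..<N}"
  obtains \<theta> where "\<bar>\<theta>\<bar> \<le> pi"
    "norm (\<Sum>u\<in>P. \<Sum>b<N. if b + u < N then G (b + u) * cnj (G b) else 0)
      \<le> norm (\<Sum>a<N. G a * cis (- \<theta> * real a)) * sqrt ((\<Sum>a<N. (norm (G a))\<^sup>2) * real (card P))"
proof -
  define n where "n = 2 * N"
  define e where "e k a = cis (- (2 * pi * real k / real n) * real a)" for k a :: nat
  define c where "c k = (\<Sum>a<N. G a * e k a)" for k
  define \<kappa> where "\<kappa> k = (\<Sum>u\<in>P. e k u)" for k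
  have n: "n > 0" "{..<N} \<subseteq> {..<n}" "P \<subseteq> {..<n}" using N P by (auto simp: n_def)
  have fP: "finite P" using P finite_subset by blast
  have c2: "(\<Sum>k<n. (norm (c k))\<^sup>2) = real n * (\<Sum>a<N. (norm (G a))\<^sup>2)"
    using dft_parseval[OF n(1,2), of G] unfolding c_def e_def .
  have k2: "(\<Sum>k<n. (norm (\<kappa> k))\<^sup>2) = real n * real (card P)"
    using dft_parseval[OF n(1,3), of "\<lambda>_. 1"] unfolding \<kappa>_def e_def by simp
  have eee: "(\<Sum>k<n. e k a * cnj (e k b) * cnj (e k u)) = (if a = b + u then of_nat n else 0)"
    if "a < N" "b < N" "u < N" for a b u
  proof -
    have "e k a * cnj (e k b) * cnj (e k u) = cis (2 * pi * real k * of_int (int b + int u - int a) / real n)" for k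
      unfolding e_def cis_cnj cis_mult by (rule arg_cong[of _ _ cis]) (use n in \<open>simp add: field_simps\<close>)
    moreover have "\<bar>int b + int u - int a\<bar> < int n" using that by (auto simp: n_def)
    ultimately show ?thesis using sum_cis_roots[OF n(1), of "int b + int u - int a"] by auto
  qed
  define S where "S = (\<Sum>u\<in>P. \<Sum>b<N. if b + u < N then G (b + u) * cnj (G b) else 0)"
  have "(\<Sum>k<n. c k * cnj (c k) * cnj (\<kappa> k)) =
      (\<Sum>k<n. \<Sum>u\<in>P. \<Sum>b<N. \<Sum>a<N. G a * cnj (G b) * (e k a * cnj (e k b) * cnj (e k u)))"
  proof (rule sum.cong[OF refl])
    fix k
    have "c k * cnj (c k) * cnj (\<kappa> k) = cnj (\<kappa> k) * (cnj (c k) * c k)" by simp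
    also have "\<dots> = (\<Sum>u\<in>P. \<Sum>b<N. \<Sum>a<N. cnj (e k u) * (cnj (G b * e k b) * (G a * e k a)))"
      unfolding \<kappa>_def c_def cnj_sum sum_product unfolding sum_distrib_left ..
    finally show "c k * cnj (c k) * cnj (\<kappa> k) = (\<Sum>u\<in>P. \<Sum>b<N. \<Sum>a<N. G a * cnj (G b) * (e k a * cnj (e k b) * cnj (e k u)))"
      by (simp add: mult_ac)
  qed
  also have "\<dots> = (\<Sum>u\<in>P. \<Sum>b<N. \<Sum>a<N. G a * cnj (G b) * (\<Sum>k<n. e k a * cnj (e k b) * cnj (e k u)))"
    unfolding sum_distrib_left
    by (subst sum.swap, rule sum.cong[OF refl], subst sum.swap, rule sum.cong[OF refl], rule sum.swap)
  also have "\<dots> = (\<Sum>u\<in>P. \<Sum>b<N. \<Sum>a<N. if a = b + u then of_nat n * (G (b + u) * cnj (G b)) else 0)"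
  proof (intro sum.cong refl)
    fix u b a assume "u \<in> P" "b \<in> {..<N}" "a \<in> {..<N}"
    then have "(\<Sum>k<n. e k a * cnj (e k b) * cnj (e k u)) = (if a = b + u then of_nat n else 0)"
      using P by (intro eee) auto
    then show "G a * cnj (G b) * (\<Sum>k<n. e k a * cnj (e k b) * cnj (e k u)) =
        (if a = b + u then of_nat n * (G (b + u) * cnj (G b)) else 0)"
      by (simp only:) simp
  qed
  also have "\<dots> = (\<Sum>u\<in>P. \<Sum>b<N. if b + u < N then of_nat n * (G (b + u) * cnj (G b)) else 0)"
    by (simp add: sum.delta')
  also have "\<dots> = of_nat n * S"
    unfolding S_def sum_distrib_left by (intro sum.cong refl) auto
  finally have S: "of_nat n * S = (\<Sum>k<n. c k * cnj (c k) * cnj (\<kappa> k))" by simp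
  \<comment> \<open>Only one of the two factors \<open>norm (c k)\<close> is replaced by the
    maximum. The other is kept for Cauchy-Schwarz against \<open>\<kappa>\<close>, where Parseval
    evaluates both sums exactly.\<close>
  define M where "M = Max ((\<lambda>k. norm (c k)) ` {..<n})"
  have "M \<in> (\<lambda>k. norm (c k)) ` {..<n}" unfolding M_def by (rule Max_in) (use n(1) in auto)
  then obtain k0 where k0: "k0 < n" "norm (c k0) = M" by auto
  have M: "norm (c k) \<le> M" if "k < n" for k unfolding M_def using that by (intro Max_ge) auto
  have M0: "M \<ge> 0" using k0(2) norm_ge_zero by metis
  have "real n * norm S = norm (\<Sum>k<n. c k * cnj (c k) * cnj (\<kappa> k))"
    unfolding S[symmetric] by (simp add: norm_mult)
  also have "\<dots> \<le> (\<Sum>k<n. norm (c k * cnj (c k) * cnj (\<kappa> k)))" by (rule norm_sum)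
  also have "\<dots> \<le> (\<Sum>k<n. M * (norm (c k) * norm (\<kappa> k)))"
    by (rule sum_mono) (use M in \<open>auto simp: norm_mult mult.assoc intro!: mult_right_mono\<close>)
  also have "\<dots> = M * (\<Sum>k<n. norm (c k) * norm (\<kappa> k))" by (simp add: sum_distrib_left)
  also have "\<dots> \<le> M * sqrt ((\<Sum>k<n. (norm (c k))\<^sup>2) * (\<Sum>k<n. (norm (\<kappa> k))\<^sup>2))"
    using Cauchy_Schwarz_ineq_sum[of "\<lambda>k. norm (c k)" "\<lambda>k. norm (\<kappa> k)" "{..<n}"] M0
    by (intro mult_left_mono real_le_rsqrt)
  also have "\<dots> = M * sqrt ((real n)\<^sup>2 * ((\<Sum>a<N. (norm (G a))\<^sup>2) * real (card P)))"
    unfolding c2 k2 by (simp add: power2_eq_square mult_ac)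
  also have "\<dots> = real n * (M * sqrt ((\<Sum>a<N. (norm (G a))\<^sup>2) * real (card P)))"
    by (simp add: real_sqrt_mult)
  finally have main: "norm S \<le> norm (c k0) * sqrt ((\<Sum>a<N. (norm (G a))\<^sup>2) * real (card P))"
    using n(1) k0(2) by simp
  \<comment> \<open>The angle is moved into [-pi, pi], so that the frequency obtained from it turns
    by at most half a circle over one mesh width, as \<open>norm_integral_cis_ge\<close>
    requires.\<close>
  define \<theta>0 where "\<theta>0 = 2 * pi * real k0 / real n"
  have t0: "0 \<le> \<theta>0" "\<theta>0 \<le> 2 * pi" using k0(1) n(1) unfolding \<theta>0_def by (auto simp: field_simps)
  show ?thesis
  proof (cases "\<theta>0 \<le> pi")
    case True
    show ?thesis using that[of \<theta>0] True t0 main unfolding S_def c_def e_def \<theta>0_def by auto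
  next
    case False
    have "cis (- (\<theta>0 - 2 * pi) * real a) = cis (- \<theta>0 * real a)" for a
    proof -
      have "cis (- (\<theta>0 - 2 * pi) * real a) = cis (- \<theta>0 * real a) * cis (2 * pi * real_of_int (int a))"
        unfolding cis_mult by (simp add: algebra_simps)
      then show ?thesis by (simp only: cis_multiple_2pi[OF Ints_of_int] mult_1_right)
    qed
    then show ?thesis using that[of "\<theta>0 - 2 * pi"] False t0 main unfolding S_def c_def e_def \<theta>0_def by auto
  qed
qed

section \<open>Passage between samples and integrals, and correlations along almost periods\<close>

lemma riemann_sum_close:
  fixes k :: "real \<Rightarrow> complex"
  assumes cont: "continuous_on UNIV k" and \<delta>: "\<delta> > 0"
    and close: "\<And>x y. \<bar>x - y\<bar> \<le> \<delta> \<Longrightarrow> norm (k x - k y) \<le> e"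
  shows "norm (integral {0..real N * \<delta>} k - of_real \<delta> * (\<Sum>b<N. k (real b * \<delta>))) \<le> real N * \<delta> * e"
proof (induction N)
  case (Suc N)
  have int: "k integrable_on {a..b}" for a b
    by (rule integrable_continuous_interval) (rule continuous_on_subset[OF cont], simp)
  have le: "0 \<le> real N * \<delta>" "real N * \<delta> \<le> real (Suc N) * \<delta>" using \<delta> by auto
  have "integral {real N * \<delta>..real (Suc N) * \<delta>} k - of_real \<delta> * k (real N * \<delta>)
      = integral {real N * \<delta>..real (Suc N) * \<delta>} (\<lambda>x. k x - k (real N * \<delta>))"
    using int le by (subst integral_diff) (auto simp: algebra_simps scaleR_conv_of_real)
  also have "norm \<dots> \<le> e * (real (Suc N) * \<delta> - real N * \<delta>)"
  proof (rule integral_bound[OF le(2)])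
    show "continuous_on {real N * \<delta>..real (Suc N) * \<delta>} (\<lambda>x. k x - k (real N * \<delta>))"
      by (intro continuous_on_diff continuous_on_const continuous_on_subset[OF cont]) auto
    show "norm (k t - k (real N * \<delta>)) \<le> e" if "t \<in> {real N * \<delta>..real (Suc N) * \<delta>}" for t
      using close that by (auto simp: algebra_simps)
  qed
  finally have 1: "norm (integral {real N * \<delta>..real (Suc N) * \<delta>} k - of_real \<delta> * k (real N * \<delta>)) \<le> \<delta> * e"
    by (simp add: algebra_simps)
  have "integral {0..real N * \<delta>} k + integral {real N * \<delta>..real (Suc N) * \<delta>} k = integral {0..real (Suc N) * \<delta>} k"
    by (rule Henstock_Kurzweil_Integration.integral_combine[OF le int])
  then have "integral {0..real (Suc N) * \<delta>} k - of_real \<delta> * (\<Sum>b<Suc N. k (real b * \<delta>)) =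
     (integral {0..real N * \<delta>} k - of_real \<delta> * (\<Sum>b<N. k (real b * \<delta>))) +
     (integral {real N * \<delta>..real (Suc N) * \<delta>} k - of_real \<delta> * k (real N * \<delta>))"
    by (simp add: algebra_simps)
  also have "norm \<dots> \<le> real N * \<delta> * e + \<delta> * e"
    by (rule norm_triangle_le[OF add_mono[OF Suc.IH 1]])
  finally show ?case by (simp add: algebra_simps)
qed simp

lemma mean_periodic:
  assumes f: "f \<in> AP" and \<delta>: "\<delta> > 0" and per: "\<And>x. f (x + \<delta>) = f x"
  shows "mean f = of_real (1 / \<delta>) * integral {0..\<delta>} f"
proof -
  have per': "f (x + real n * \<delta>) = f x" for x n
  proof (induction n)
    case (Suc n)
    have "f (x + real (Suc n) * \<delta>) = f ((x + real n * \<delta>) + \<delta>)" by (simp add: algebra_simps)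
    with Suc per show ?case by simp
  qed simp
  have ints: "integral {0..real n * \<delta>} f = of_nat n * integral {0..\<delta>} f" for n
  proof (induction n)
    case (Suc n)
    have "integral {0..real n * \<delta>} f + integral {real n * \<delta>..real n * \<delta> + \<delta>} f = integral {0..real n * \<delta> + \<delta>} f"
      by (rule Henstock_Kurzweil_Integration.integral_combine) (use \<delta> AP_integrable[OF f] in auto)
    moreover have "integral {real n * \<delta>..real n * \<delta> + \<delta>} f = integral {0..\<delta>} f"
      by (simp add: integral_shift_0[OF AP_continuous[OF f]] per')
    ultimately show ?case using Suc by (simp add: algebra_simps)
  qed simp
  have "filterlim (\<lambda>n. real (Suc n) * \<delta>) at_top sequentially"
    using filterlim_Suc filterlim_real_sequentially
    by (intro filterlim_at_top_mult_tendsto_pos[OF tendsto_const \<delta>] filterlim_compose[OF filterlim_real_sequentially filterlim_Suc])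
  from filterlim_compose[OF mean_tendsto[OF f] this]
  have "(\<lambda>n. complex_of_real (1 / (real (Suc n) * \<delta>)) * integral {0..real (Suc n) * \<delta>} f) \<longlonglongrightarrow> mean f" .
  moreover have "complex_of_real (1 / (real (Suc n) * \<delta>)) * integral {0..real (Suc n) * \<delta>} f = of_real (1 / \<delta>) * integral {0..\<delta>} f" for n
    unfolding ints using \<delta> by (simp add: field_simps del: of_nat_Suc)
  ultimately show ?thesis by (simp add: LIMSEQ_const_iff)
qed

lemma cos_ge_quadratic: "cos u \<ge> 1 - u\<^sup>2 / 2" for u :: real
proof -
  have "cos u = 1 - 2 * (sin (u/2))\<^sup>2" using cos_double_sin[of "u/2"] by simp
  moreover have "(sin (u/2))\<^sup>2 \<le> (u/2)\<^sup>2" using abs_sin_x_le_abs_x[of "u/2"] by (metis abs_le_square_iff)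
  ultimately show ?thesis by (simp add: power_divide)
qed

text \<open>Rotating the phase to be 0 at the midpoint makes the real part a cosine. The minorant
  \<open>1 - u\<^sup>2 / 2\<close> integrates to
  \<open>\<delta> * (1 - (l * \<delta>)\<^sup>2 / 24)\<close>, and \<open>pi < 4\<close> leaves at
  least a third of \<delta>.\<close>

lemma norm_integral_cis_ge:
  fixes \<delta> l :: real
  assumes \<delta>: "\<delta> > 0" and l: "\<bar>l * \<delta>\<bar> \<le> pi"
  shows "norm (integral {0..\<delta>} (\<lambda>x. cis (- l * x))) \<ge> \<delta> / 3"
proof -
  have cont: "continuous_on {0..\<delta>} (\<lambda>x. cis (- l * x))" by (intro continuous_intros)
  have hi: "((\<lambda>x. 1 - (l * (x - \<delta>/2))\<^sup>2 / 2) has_integral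
      ((\<delta> - l\<^sup>2 * (\<delta> - \<delta>/2)^3 / 6) - (0 - l\<^sup>2 * (0 - \<delta>/2)^3 / 6))) {0..\<delta>}"
    by (rule fundamental_theorem_of_calculus)
      (use \<delta> in \<open>auto intro!: derivative_eq_intros simp: has_real_derivative_iff_has_vector_derivative[symmetric] power2_eq_square field_simps\<close>)
  have "Re (cis (l * \<delta>/2) * integral {0..\<delta>} (\<lambda>x. cis (- l * x))) = integral {0..\<delta>} (\<lambda>x. Re (cis (l * \<delta>/2) * cis (- l * x)))"
    using integral_linear[OF integrable_continuous_interval[OF cont] bounded_linear_compose[OF bounded_linear_Re bounded_linear_mult_right], of "cis (l * \<delta>/2)"]
    by (simp add: o_def)
  also have "\<dots> \<ge> integral {0..\<delta>} (\<lambda>x. 1 - (l * (x - \<delta>/2))\<^sup>2 / 2)"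
  proof (rule integral_le)
    show "(\<lambda>x. 1 - (l * (x - \<delta>/2))\<^sup>2 / 2) integrable_on {0..\<delta>}" using hi by blast
    show "(\<lambda>x. Re (cis (l * \<delta>/2) * cis (- l * x))) integrable_on {0..\<delta>}"
      by (intro integrable_continuous_interval continuous_intros)
    show "1 - (l * (x - \<delta>/2))\<^sup>2 / 2 \<le> Re (cis (l * \<delta>/2) * cis (- l * x))" for x
    proof -
      have "Re (cis (l * \<delta>/2) * cis (- l * x)) = cos (l * \<delta>/2 - l * x)" by (simp add: cis_mult)
      also have "\<dots> = cos (l * (x - \<delta>/2))"
        using cos_minus[of "l * (x - \<delta>/2)"] by (simp add: algebra_simps)
      finally show ?thesis using cos_ge_quadratic[of "l * (x - \<delta>/2)"] by simp
    qed
  qed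
  also have "integral {0..\<delta>} (\<lambda>x. 1 - (l * (x - \<delta>/2))\<^sup>2 / 2) = \<delta> * (1 - (l * \<delta>)\<^sup>2 / 24)"
    unfolding integral_unique[OF hi] by (simp add: power2_eq_square power3_eq_cube field_simps)
  finally have "Re (cis (l * \<delta>/2) * integral {0..\<delta>} (\<lambda>x. cis (- l * x))) \<ge> \<delta> * (1 - (l * \<delta>)\<^sup>2 / 24)" .
  moreover have "(l * \<delta>)\<^sup>2 \<le> 16"
    using l pi_less_4 power_mono[of "\<bar>l * \<delta>\<bar>" 4 2] by simp
  then have "\<delta> * (1 - (l * \<delta>)\<^sup>2 / 24) \<ge> \<delta> * (1/3)"
    using \<delta> by (intro mult_left_mono) auto
  moreover have "Re (cis (l * \<delta>/2) * integral {0..\<delta>} (\<lambda>x. cis (- l * x))) \<le> norm (integral {0..\<delta>} (\<lambda>x. cis (- l * x)))"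
    by (rule order_trans[OF complex_Re_le_cmod]) (simp add: norm_mult)
  ultimately show ?thesis by simp
qed

lemma AP_cnj: "f \<in> AP \<Longrightarrow> (\<lambda>x. cnj (f x)) \<in> AP"
  by (rule AP_bounded_linear[OF _ bounded_linear_cnj])

text \<open>Pigeonhole: assign a net point to each u < M. Within one class, subtracting the least
  member gives grid shifts that are e-almost periods, so no class has more members than the set on
  the right.\<close>

lemma near_small_shifts:
  assumes T: "finite T" "\<And>t. \<exists>s\<in>T. near g (e/2) t s"
  shows "real M \<le> real (card T) * real (card {u. u < M \<and> near g e (real u * \<delta>) 0})"
proof (cases "M = 0")
  case False
  define P where "P = {u. u < M \<and> near g e (real u * \<delta>) 0}"
  have "\<forall>u::nat. \<exists>s\<in>T. near g (e/2) (real u * \<delta>) s" using T(2) by blast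
  then obtain s where s: "\<And>u::nat. s u \<in> T" "\<And>u::nat. near g (e/2) (real u * \<delta>) (s u)" by metis
  have fib: "card {u. u < M \<and> s u = c} \<le> card P" for c
  proof (cases "{u. u < M \<and> s u = c} = {}")
    case False
    define X where "X = {u. u < M \<and> s u = c}"
    have fX: "finite X" "X \<noteq> {}" using False by (auto simp: X_def)
    define u0 where "u0 = Min X"
    have u0: "u0 \<in> X" "\<And>u. u \<in> X \<Longrightarrow> u0 \<le> u" using fX by (auto simp: u0_def)
    have "(\<lambda>u. u - u0) ` X \<subseteq> P"
    proof
      fix v assume "v \<in> (\<lambda>u. u - u0) ` X"
      then obtain u where u: "u \<in> X" "v = u - u0" by blast
      have "near g (e/2) (real u * \<delta>) c" "near g (e/2) (real u0 * \<delta>) c"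
        using s(2)[of u] s(2)[of u0] u(1) u0(1) by (auto simp: X_def)
      from near_trans[OF this(1) near_commute[OF this(2)]]
      have "near g e (real u * \<delta>) (real u0 * \<delta>)" by simp
      from near_shift[OF this, of "- (real u0 * \<delta>)"]
      have "near g e (real v * \<delta>) 0" using u u0(2)[OF u(1)] by (simp add: of_nat_diff algebra_simps)
      moreover have "v < M" using u by (auto simp: X_def)
      ultimately show "v \<in> P" by (simp add: P_def)
    qed
    moreover have "inj_on (\<lambda>u. u - u0) X" using u0(2) by (auto simp: inj_on_def) (metis le_add_diff_inverse)
    moreover have "finite P" by (simp add: P_def)
    ultimately have "card X \<le> card P" using card_inj_on_le by blast
    then show ?thesis by (simp add: X_def)
  next
    case True
    then show ?thesis unfolding True by simp
  qed
  have "{..<M} = (\<Union>c\<in>T. {u. u < M \<and> s u = c})" using s(1) by auto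
  then have "M = card (\<Union>c\<in>T. {u. u < M \<and> s u = c})" by (metis card_lessThan)
  also have "\<dots> \<le> (\<Sum>c\<in>T. card {u. u < M \<and> s u = c})" by (rule card_UN_le[OF T(1)])
  also have "\<dots> \<le> (\<Sum>c\<in>T. card P)" by (intro sum_mono fib)
  finally have "M \<le> card T * card P" by simp
  then have "real M \<le> real (card T * card P)" by (rule of_nat_mono)
  then show ?thesis by (simp add: P_def)
qed simp

text \<open>Along an almost period the correlation nearly equals the energy: the u summands that run
  past the end lose at most B^2 each, and every other summand changes by at most e * B.\<close>

lemma sampled_correlation_ge:
  fixes g :: "real \<Rightarrow> complex"
  assumes B: "\<And>x. norm (g x) \<le> B" and u: "u < N" and nr: "near g e (real u * \<delta>) 0"
    and large: "real N * \<mu> \<le> (\<Sum>b<N. (norm (g (real b * \<delta>)))\<^sup>2)"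
  shows "real N * \<mu> - real u * B\<^sup>2 - real N * (e * B) \<le>
    Re (\<Sum>b<N. if b + u < N then g (real (b + u) * \<delta>) * cnj (g (real b * \<delta>)) else 0)"
proof -
  have B0: "B \<ge> 0" using B[of 0] norm_ge_zero order_trans by blast
  have e0: "e \<ge> 0" using nearD[OF nr] norm_ge_zero order_trans by blast
  have "(norm (g (real b * \<delta>)))\<^sup>2 - (if b \<ge> N - u then B\<^sup>2 else 0) - e * B
     \<le> Re (if b + u < N then g (real (b + u) * \<delta>) * cnj (g (real b * \<delta>)) else 0)" if "b < N" for b
  proof (cases "b + u < N")
    case True
    define x where "x = g (real b * \<delta>)"
    define y where "y = g (real (b + u) * \<delta>)"
    have "norm (g (real b * \<delta> + real u * \<delta>) - g (real b * \<delta> + 0)) \<le> e"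
      using nr unfolding near_def by blast
    then have "norm (y - x) \<le> e" by (simp add: x_def y_def algebra_simps)
    then have "norm ((y - x) * cnj x) \<le> e * B"
      unfolding norm_mult complex_mod_cnj using B[of "real b * \<delta>"] e0 by (intro mult_mono) (auto simp: x_def)
    then have "- (e * B) \<le> Re ((y - x) * cnj x)" using abs_Re_le_cmod[of "(y - x) * cnj x"] by linarith
    moreover have "Re (y * cnj x) = Re ((y - x) * cnj x) + (norm x)\<^sup>2"
      by (simp only: cmod_power2) (simp add: algebra_simps power2_eq_square)
    ultimately have "(norm x)\<^sup>2 - e * B \<le> Re (y * cnj x)" by simp
    moreover have "\<not> b \<ge> N - u" using True by simp
    ultimately show ?thesis using True unfolding x_def y_def by simp
  next
    case False
    have "(norm (g (real b * \<delta>)))\<^sup>2 \<le> B\<^sup>2" using B[of "real b * \<delta>"] by (intro power_mono) auto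
    moreover have "b \<ge> N - u" using False by simp
    moreover have "0 \<le> e * B" using e0 B0 by simp
    ultimately show ?thesis using False by simp
  qed
  then have "(\<Sum>b<N. (norm (g (real b * \<delta>)))\<^sup>2 - (if b \<ge> N - u then B\<^sup>2 else 0) - e * B) \<le>
     (\<Sum>b<N. Re (if b + u < N then g (real (b + u) * \<delta>) * cnj (g (real b * \<delta>)) else 0))"
    by (intro sum_mono) auto
  also have "\<dots> = Re (\<Sum>b<N. if b + u < N then g (real (b + u) * \<delta>) * cnj (g (real b * \<delta>)) else 0)"
    by (rule Re_sum[symmetric])
  finally have "(\<Sum>b<N. (norm (g (real b * \<delta>)))\<^sup>2 - (if b \<ge> N - u then B\<^sup>2 else 0) - e * B)
    \<le> Re (\<Sum>b<N. if b + u < N then g (real (b + u) * \<delta>) * cnj (g (real b * \<delta>)) else 0)" .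
  moreover have "(\<Sum>b<N. if b \<ge> N - u then B\<^sup>2 else 0) = real u * B\<^sup>2"
  proof -
    have "{..<N} \<inter> {b. b \<ge> N - u} = {N - u..<N}" by auto
    then show ?thesis using u by (simp add: sum.If_cases)
  qed
  ultimately show ?thesis using large by (simp add: sum_subtractf)
qed

lemma AP_norm_square: "g \<in> AP \<Longrightarrow> (\<lambda>x. complex_of_real ((norm (g x))\<^sup>2)) \<in> AP" for g :: "real \<Rightarrow> complex"
  unfolding complex_norm_square by (intro AP_mult AP_cnj)

text \<open>The order of quantifiers is the point: c does not depend on the mesh \<delta>, so
  \<delta> can be chosen afterwards, fine enough for g to vary by a small fraction of c across
  it.\<close>

lemma AP_large_sampled_coefficient:
  assumes g: "g \<in> AP" and nz: "g x0 \<noteq> (0::complex)"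
  obtains c \<delta>0 where "c > 0" "\<delta>0 > 0"
    "\<And>\<delta>. 0 < \<delta> \<Longrightarrow> \<delta> < \<delta>0 \<Longrightarrow> \<exists>N0. \<forall>N\<ge>N0. N > 0 \<and> (\<exists>\<theta>. \<bar>\<theta>\<bar> \<le> pi \<and> real N * c \<le> norm (\<Sum>a<N. g (real a * \<delta>) * cis (- \<theta> * real a)))"
proof -
  obtain B where B: "B > 0" "\<And>x. norm (g x) \<le> B" by (rule AP_bounded[OF g]) blast
  define k where "k x = complex_of_real ((norm (g x))\<^sup>2)" for x
  have k: "k \<in> AP" unfolding k_def by (rule AP_norm_square[OF g])
  define \<mu> where "\<mu> = Re (mean k)"
  have \<mu>: "\<mu> > 0" unfolding \<mu>_def by (rule Re_mean_pos[OF k, of x0]) (use nz in \<open>auto simp: k_def\<close>)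
  have "\<mu> \<le> norm (mean k)" unfolding \<mu>_def by (rule complex_Re_le_cmod)
  also have "\<dots> \<le> B\<^sup>2" by (rule norm_mean_le[OF k]) (use B in \<open>auto simp: k_def norm_power intro!: power_mono\<close>)
  finally have \<mu>B: "\<mu> \<le> B\<^sup>2" .
  have "\<mu>/4 > 0" using \<mu> by simp
  then obtain \<delta>0 where \<delta>0: "\<delta>0 > 0" "\<And>t s. \<bar>t - s\<bar> < \<delta>0 \<Longrightarrow> near k (\<mu>/4) t s"
    by (rule AP_near_close[OF k]) blast
  \<comment> \<open>The energy per sample will be at least \<mu>/2. The numbers e and \<eta> are
    chosen so that each of the two losses in \<open>sampled_correlation_ge\<close> is at most
    \<mu>/8 per sample, which leaves \<mu>/4.\<close>
  define e where "e = \<mu> / (8 * B)"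
  have e: "e > 0" using \<mu> B by (simp add: e_def)
  then have "e/2 > 0" by simp
  then obtain T where T: "finite T" "T \<noteq> {}" "\<And>t. \<exists>s\<in>T. near g (e/2) t s"
    by (rule AP_net[OF g]) blast
  define \<eta> where "\<eta> = \<mu> / (8 * B\<^sup>2)"
  have \<eta>: "\<eta> > 0" "\<eta> < 1" using \<mu> B \<mu>B by (auto simp: \<eta>_def field_simps)
  define m where "m = real (card T)"
  have m: "m > 0" using T by (simp add: m_def card_gt_0_iff)
  \<comment> \<open>Result of dividing the lower bound \<open>card P * N * \<mu>/4\<close> for the
    double sum by \<open>B * sqrt (N * card P)\<close> and using that \<open>card P\<close> is at
    least \<open>\<eta> * N / m\<close>.\<close>
  define c where "c = sqrt (\<eta> / m) * \<mu> / (4 * B)"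
  have c: "c > 0" using \<eta> m \<mu> B by (simp add: c_def)
  have "\<exists>N0. \<forall>N\<ge>N0. N > 0 \<and> (\<exists>\<theta>. \<bar>\<theta>\<bar> \<le> pi \<and> real N * c \<le> norm (\<Sum>a<N. g (real a * \<delta>) * cis (- \<theta> * real a)))"
    if \<delta>: "0 < \<delta>" "\<delta> < \<delta>0" for \<delta>
  proof -
    obtain T0 where T0: "T0 > 0" "\<And>T a. T \<ge> T0 \<Longrightarrow> norm (complex_of_real (1 / T) * integral {a..a + T} k - mean k) \<le> \<mu>/4"
      by (rule AP_mean_uniform[OF k \<open>\<mu>/4 > 0\<close>]) blast
    obtain N0 :: nat where N0: "real N0 > T0 / \<delta>" using reals_Archimedean2 by blast
    have "N > 0 \<and> (\<exists>\<theta>. \<bar>\<theta>\<bar> \<le> pi \<and> real N * c \<le> norm (\<Sum>a<N. g (real a * \<delta>) * cis (- \<theta> * real a)))"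
      if N: "N \<ge> N0" for N
    proof -
      have "T0 / \<delta> < real N" using N N0 by linarith
      then have Nd: "T0 \<le> real N * \<delta>" using \<delta> by (simp add: field_simps)
      have N1: "N > 0" using Nd T0(1) by (cases N) auto
      define G where "G a = g (real a * \<delta>)" for a :: nat
      have sumG: "(\<Sum>a<N. (norm (G a))\<^sup>2) \<ge> real N * (\<mu>/2)"
      proof -
        define I where "I = integral {0..real N * \<delta>} k"
        have "norm (complex_of_real (1 / (real N * \<delta>)) * I - mean k) \<le> \<mu>/4"
          using T0(2)[OF Nd, of 0] by (simp add: I_def)
        then have "\<bar>Re (complex_of_real (1 / (real N * \<delta>)) * I - mean k)\<bar> \<le> \<mu>/4"
          using abs_Re_le_cmod order_trans by blast
        moreover have "Re (complex_of_real (1 / (real N * \<delta>)) * I - mean k) = Re I / (real N * \<delta>) - \<mu>"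
          by (simp add: \<mu>_def)
        ultimately have "Re I / (real N * \<delta>) \<ge> 3 * \<mu>/4" by linarith
        then have I1: "Re I \<ge> 3 * \<mu>/4 * (real N * \<delta>)" using N1 \<delta> by (simp add: pos_le_divide_eq)
        have "norm (I - of_real \<delta> * (\<Sum>b<N. k (real b * \<delta>))) \<le> real N * \<delta> * (\<mu>/4)"
          unfolding I_def
        proof (rule riemann_sum_close[OF AP_continuous[OF k] \<delta>(1)])
          fix x y :: real assume "\<bar>x - y\<bar> \<le> \<delta>"
          with \<delta> have "near k (\<mu>/4) x y" by (intro \<delta>0(2)) auto
          then show "norm (k x - k y) \<le> \<mu>/4" by (rule nearD)
        qed
        then have "\<bar>Re (I - of_real \<delta> * (\<Sum>b<N. k (real b * \<delta>)))\<bar> \<le> real N * \<delta> * (\<mu>/4)"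
          using abs_Re_le_cmod order_trans by blast
        moreover have "Re (I - of_real \<delta> * (\<Sum>b<N. k (real b * \<delta>))) = Re I - \<delta> * Re (\<Sum>b<N. k (real b * \<delta>))"
          by (simp del: Re_sum)
        ultimately have "\<delta> * Re (\<Sum>b<N. k (real b * \<delta>)) \<ge> Re I - real N * \<delta> * (\<mu>/4)" by linarith
        also have "Re (\<Sum>b<N. k (real b * \<delta>)) = (\<Sum>a<N. (norm (G a))\<^sup>2)" by (simp add: k_def G_def)
        finally have "\<delta> * (\<Sum>a<N. (norm (G a))\<^sup>2) \<ge> \<delta> * (real N * (\<mu>/2))" using I1 by (simp add: algebra_simps)
        then show ?thesis using \<delta>(1) by simp
      qed
      have sumG2: "(\<Sum>a<N. (norm (G a))\<^sup>2) \<le> real N * B\<^sup>2"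
        using sum_bounded_above[of "{..<N}" "\<lambda>a. (norm (G a))\<^sup>2" "B\<^sup>2"] B by (auto simp: G_def power_mono)
      \<comment> \<open>The shifts run from 0 to the floor of \<open>\<eta> * N\<close>; counting
        both ends makes M at least \<open>\<eta> * N\<close>.\<close>
      define M where "M = Suc (nat \<lfloor>\<eta> * real N\<rfloor>)"
      define P where "P = {u. u < M \<and> near g e (real u * \<delta>) 0}"
      have Mfl: "real (nat \<lfloor>\<eta> * real N\<rfloor>) \<le> \<eta> * real N" using \<eta> by (intro of_nat_floor) auto
      have Mge: "real M \<ge> \<eta> * real N" unfolding M_def by linarith
      have uP: "real u \<le> \<eta> * real N" "u < N" if "u \<in> P" for u
      proof -
        have "u \<le> nat \<lfloor>\<eta> * real N\<rfloor>" using that by (auto simp: P_def M_def)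
        then show "real u \<le> \<eta> * real N" using Mfl by (meson of_nat_le_iff order_trans)
        also have "\<dots> < 1 * real N" using \<eta> N1 by (intro mult_strict_right_mono) auto
        finally show "u < N" by simp
      qed
      have PN: "P \<subseteq> {..<N}" using uP by auto
      have cardP: "\<eta> * real N \<le> m * real (card P)"
        using near_small_shifts[OF T(1,3), of M \<delta>] Mge unfolding P_def m_def by linarith
      define S where "S = (\<Sum>u\<in>P. \<Sum>b<N. if b + u < N then G (b + u) * cnj (G b) else 0)"
      have "real N * (\<mu>/4) \<le> Re (\<Sum>b<N. if b + u < N then G (b + u) * cnj (G b) else 0)" if "u \<in> P" for u
      proof -
        have "real N * (\<mu>/2) - real u * B\<^sup>2 - real N * (e * B) \<le> Re (\<Sum>b<N. if b + u < N then G (b + u) * cnj (G b) else 0)"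
          using that sumG unfolding G_def by (intro sampled_correlation_ge[OF B(2) uP(2)]) (auto simp: P_def)
        moreover have "real u * B\<^sup>2 \<le> \<eta> * real N * B\<^sup>2" using uP(1)[OF that] by (intro mult_right_mono) auto
        moreover have "\<eta> * real N * B\<^sup>2 = real N * (\<mu>/8)" "real N * (e * B) = real N * (\<mu>/8)"
          using B by (auto simp: \<eta>_def e_def)
        ultimately show ?thesis by linarith
      qed
      then have "(\<Sum>u\<in>P. real N * (\<mu>/4)) \<le> Re S" unfolding S_def Re_sum by (intro sum_mono) (simp flip: Re_sum)
      then have S: "real (card P) * (real N * (\<mu>/4)) \<le> norm S" using complex_Re_le_cmod[of S] by simp
      obtain \<theta> where \<theta>: "\<bar>\<theta>\<bar> \<le> pi"
        "norm S \<le> norm (\<Sum>a<N. G a * cis (- \<theta> * real a)) * sqrt ((\<Sum>a<N. (norm (G a))\<^sup>2) * real (card P))"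
        unfolding S_def by (rule dft_large_coefficient[OF N1 PN, of G]) blast
      define X where "X = norm (\<Sum>a<N. G a * cis (- \<theta> * real a))"
      have cP: "real (card P) > 0"
      proof -
        have "0 < \<eta> * real N" using \<eta> N1 by simp
        then have "0 < m * real (card P)" using cardP by linarith
        then show ?thesis using m by (simp add: zero_less_mult_iff)
      qed
      have "real (card P) * (real N * (\<mu>/4)) \<le> X * sqrt (real N * B\<^sup>2 * real (card P))"
        using S \<theta>(2) sumG2 unfolding X_def
        by (elim order_trans) (intro order_trans[OF \<theta>(2)] mult_left_mono real_sqrt_le_mono mult_right_mono; simp)
      also have "sqrt (real N * B\<^sup>2 * real (card P)) = B * sqrt (real N * real (card P))"
        using B by (simp add: real_sqrt_mult)
      finally have 1: "real (card P) * real N * (\<mu>/4) \<le> X * B * sqrt (real N * real (card P))" by simp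
      define r where "r = sqrt (real N * real (card P))"
      have r: "r > 0" "r * r = real (card P) * real N" using N1 cP by (auto simp: r_def)
      have "r * (\<mu>/4) \<le> X * B" using 1 r unfolding r_def[symmetric] r(2)[symmetric] by simp
      moreover have "real N * sqrt (\<eta> / m) \<le> r"
      proof -
        have "real N * (real N * (\<eta> / m)) \<le> real N * real (card P)"
          using cardP m by (intro mult_left_mono) (auto simp: field_simps)
        then have "sqrt ((real N)\<^sup>2 * (\<eta> / m)) \<le> r" unfolding r_def by (intro real_sqrt_le_mono) (simp add: power2_eq_square)
        then show ?thesis unfolding real_sqrt_mult[of "(real N)\<^sup>2"] by simp
      qed
      ultimately have "real N * sqrt (\<eta> / m) * (\<mu>/4) \<le> X * B"
        using \<mu> by (meson mult_right_mono order_trans less_imp_le \<open>\<mu>/4 > 0\<close>)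
      then have "real N * c \<le> X" unfolding c_def using B by (simp add: field_simps)
      then show ?thesis using N1 \<theta>(1) unfolding X_def G_def by blast
    qed
    then show ?thesis by blast
  qed
  with c \<delta>0(1) that show ?thesis by blast
qed

text \<open>Twisted averages of the samples stay large at 0 and converge to some G with
  \<open>G (x + \<delta>) = cis l * G x\<close>. Removing the character with
  \<open>\<xi> * \<delta> = l\<close> leaves a \<delta>-periodic function, whose mean is an integral
  over one mesh width and can be bounded away from 0. The averages are combinations of translates of
  g, so \<xi> is also a frequency of g.\<close>

theorem AP_fourier_nonzero:
  assumes g: "g \<in> AP" and nz: "g x0 \<noteq> (0::complex)"
  shows "\<exists>\<xi>. fourier_coeff g \<xi> \<noteq> 0"
proof -
  obtain B where B: "B > 0" "\<And>x. norm (g x) \<le> B" by (rule AP_bounded[OF g]) blast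
  obtain c \<delta>0 where c: "c > 0" "\<delta>0 > 0"
    "\<And>\<delta>. 0 < \<delta> \<Longrightarrow> \<delta> < \<delta>0 \<Longrightarrow> \<exists>N0. \<forall>N\<ge>N0. N > 0 \<and> (\<exists>\<theta>. \<bar>\<theta>\<bar> \<le> pi \<and> real N * c \<le> norm (\<Sum>a<N. g (real a * \<delta>) * cis (- \<theta> * real a)))"
    by (rule AP_large_sampled_coefficient[OF g nz]) blast
  have "c/8 > 0" using c by simp
  then obtain d where d: "d > 0" "\<And>t s. \<bar>t - s\<bar> < d \<Longrightarrow> near g (c/8) t s"
    by (rule AP_near_close[OF g]) blast
  \<comment> \<open>Below d, so that g and the limit G vary by at most c/8 over one mesh width;
    below \<open>\<delta>0\<close>, so that the coefficient bound c is available.\<close>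
  define \<delta> where "\<delta> = min d \<delta>0 / 2"
  have \<delta>: "\<delta> > 0" "\<delta> < d" "\<delta> < \<delta>0" using d(1) c(2) by (auto simp: \<delta>_def)
  obtain N0 where N0: "\<And>N. N \<ge> N0 \<Longrightarrow> N > 0 \<and> (\<exists>\<theta>. \<bar>\<theta>\<bar> \<le> pi \<and> real N * c \<le> norm (\<Sum>a<N. g (real a * \<delta>) * cis (- \<theta> * real a)))"
    using c(3)[OF \<delta>(1,3)] by blast
  define N where "N n = N0 + Suc n" for n
  have Npos: "N n > 0" for n by (simp add: N_def)
  have "\<exists>\<theta>. \<bar>\<theta>\<bar> \<le> pi \<and> real (N n) * c \<le> norm (\<Sum>a<N n. g (real a * \<delta>) * cis (- \<theta> * real a))" for n
    using N0[of "N n"] by (simp add: N_def del: of_nat_add of_nat_Suc sum.lessThan_Suc)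
  then have "\<forall>n. \<exists>\<theta>. \<bar>\<theta>\<bar> \<le> pi \<and> real (N n) * c \<le> norm (\<Sum>a<N n. g (real a * \<delta>) * cis (- \<theta> * real a))"
    by blast
  from choice[OF this] obtain \<theta> where "\<forall>n. \<bar>\<theta> n\<bar> \<le> pi \<and> real (N n) * c \<le> norm (\<Sum>a<N n. g (real a * \<delta>) * cis (- \<theta> n * real a))" ..
  then have \<theta>: "\<And>n. N n > 0" "\<And>n. \<bar>\<theta> n\<bar> \<le> pi"
    "\<And>n. real (N n) * c \<le> norm (\<Sum>a<N n. g (real a * \<delta>) * cis (- \<theta> n * real a))"
    using Npos by blast+
  define F where "F n x = complex_of_real (1 / real (N n)) * (\<Sum>a<N n. g (x + real a * \<delta>) * cis (- \<theta> n * real a))" for n x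
  have Favg: "norm (complex_of_real (1 / real (N n)) * (\<Sum>a<N n. h a * cis (- \<theta> n * real a))) \<le> K"
    if "\<And>a. norm (h a) \<le> K" for h :: "nat \<Rightarrow> complex" and K n
  proof -
    have "norm (\<Sum>a<N n. h a * cis (- \<theta> n * real a)) \<le> (\<Sum>a<N n. K)"
      by (rule sum_norm_le) (use that in \<open>simp add: norm_mult\<close>)
    then show ?thesis using \<theta>(1)[of n] by (intro norm_average_le) (auto simp: mult.commute)
  qed
  have FAP: "F n \<in> AP" for n
    unfolding F_def by (intro AP_mult AP_const AP_sum AP_shift g)
  have Fbd: "norm (F n x) \<le> B" for n x unfolding F_def by (rule Favg) (rule B(2))
  have Fnear: "norm (F n t - F n s) \<le> e" if "near g e t s" for n t s e
  proof -
    have "F n t - F n s = complex_of_real (1 / real (N n)) * (\<Sum>a<N n. (g (t + real a * \<delta>) - g (s + real a * \<delta>)) * cis (- \<theta> n * real a))"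
      unfolding F_def right_diff_distrib[symmetric] sum_subtractf[symmetric] left_diff_distrib ..
    also have "norm \<dots> \<le> e"
      by (rule Favg) (use that in \<open>auto simp: near_def add.commute\<close>)
    finally show ?thesis .
  qed
  have F0: "norm (F n 0) \<ge> c" for n
    using \<theta>(1,3)[of n] unfolding F_def by (simp add: norm_mult norm_divide field_simps)
  obtain r1 G where r1: "strict_mono (r1 :: nat \<Rightarrow> nat)" "uniform_limit UNIV (\<lambda>n. F (r1 n)) G sequentially" and "dominated g G"
    by (rule AP_compactness[OF g, of F B]) (use Fbd Fnear in blast)+
  have G: "G \<in> AP" by (rule dominated_AP[OF g \<open>dominated g G\<close>])
  have "\<forall>n. \<theta> (r1 n) \<in> {-pi..pi}" using \<theta>(2) by (auto simp: abs_le_iff minus_le_iff)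
  then obtain l r2 where r2: "l \<in> {-pi..pi}" "strict_mono (r2 :: nat \<Rightarrow> nat)" "((\<lambda>n. \<theta> (r1 n)) \<circ> r2) \<longlonglongrightarrow> l"
    by (rule seq_compactE[OF compact_imp_seq_compact[OF compact_Icc]])
  define r where "r n = r1 (r2 n)" for n
  have r: "strict_mono r" using r1(1) r2(2) by (simp add: r_def strict_mono_def)
  have Flim: "uniform_limit UNIV (\<lambda>n. F (r n)) G sequentially"
    unfolding r_def by (rule filterlim_compose[OF r1(2) filterlim_subseq[OF r2(2)]])
  have \<theta>lim: "(\<lambda>n. \<theta> (r n)) \<longlonglongrightarrow> l" using r2(3) by (simp add: r_def o_def)
  have Fpt: "(\<lambda>n. F (r n) x) \<longlonglongrightarrow> G x" for x by (rule tendsto_uniform_limitI[OF Flim]) simp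
  have G0: "norm (G 0) \<ge> c"
    by (rule tendsto_lowerbound[OF tendsto_norm[OF Fpt]]) (use F0 in auto)
  have Gnear: "norm (G t - G s) \<le> e" if "near g e t s" for t s e
    by (rule tendsto_upperbound[OF tendsto_norm[OF tendsto_diff[OF Fpt Fpt]]]) (use Fnear[OF that] in auto)
  \<comment> \<open>The shift by \<delta> moves the summation index by one. The sums telescope up to
    two end terms, which are divided by \<open>N n\<close>.\<close>
  have Gper: "G (x + \<delta>) = cis l * G x" for x
  proof -
    have step: "norm (F n (x + \<delta>) - cis (\<theta> n) * F n x) \<le> 2 * B * (1 / real (N n))" for n
    proof -
      define h where "h a = g (x + real a * \<delta>) * cis (- \<theta> n * (real a - 1))" for a
      have "F n (x + \<delta>) = complex_of_real (1 / real (N n)) * (\<Sum>a<N n. h (Suc a))"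
      proof -
        have "h (Suc a) = g (x + \<delta> + real a * \<delta>) * cis (- \<theta> n * real a)" for a
          unfolding h_def by (simp add: algebra_simps)
        then show ?thesis unfolding F_def by simp
      qed
      moreover have "cis (\<theta> n) * F n x = complex_of_real (1 / real (N n)) * (\<Sum>a<N n. h a)"
      proof -
        have "cis (\<theta> n) * (g (x + real a * \<delta>) * cis (- \<theta> n * real a)) = h a" for a
        proof -
          have "cis (\<theta> n) * cis (- \<theta> n * real a) = cis (- \<theta> n * (real a - 1))"
            unfolding cis_mult by (simp add: algebra_simps)
          then show ?thesis unfolding h_def by (metis mult.left_commute)
        qed
        then show ?thesis unfolding F_def by (simp only: mult.left_commute[of "cis (\<theta> n)"] sum_distrib_left)
      qed
      moreover have "(\<Sum>a<N n. h (Suc a)) - (\<Sum>a<N n. h a) = h (N n) - h 0"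
        unfolding sum_subtractf[symmetric] by (rule sum_lessThan_telescope)
      ultimately have eq: "F n (x + \<delta>) - cis (\<theta> n) * F n x = complex_of_real (1 / real (N n)) * (h (N n) - h 0)"
        by (simp only: right_diff_distrib[symmetric])
      have "norm (h (N n) - h 0) \<le> B + B"
        by (rule order_trans[OF norm_triangle_ineq4 add_mono]) (use B(2) in \<open>auto simp: h_def norm_mult\<close>)
      then show ?thesis unfolding eq by (intro norm_average_le) (use \<theta>(1)[of n] in auto)
    qed
    have "(\<lambda>n. 1 / real (N (r n))) \<longlonglongrightarrow> 0"
    proof (rule Lim_null_comparison[OF _ LIMSEQ_inverse_real_of_nat], rule always_eventually, rule allI)
      fix n
      have "Suc n \<le> N (r n)" using seq_suble[OF r, of n] by (simp add: N_def)
      then have "real (Suc n) \<le> real (N (r n))" by (rule of_nat_mono)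
      then have "inverse (real (N (r n))) \<le> inverse (real (Suc n))" by (intro le_imp_inverse_le) auto
      then show "norm (1 / real (N (r n))) \<le> inverse (real (Suc n))" by (simp add: divide_inverse)
    qed
    from tendsto_mult_right_zero[OF this, of "2 * B"]
    have "(\<lambda>n. F (r n) (x + \<delta>) - cis (\<theta> (r n)) * F (r n) x) \<longlonglongrightarrow> 0"
      by (rule Lim_null_comparison[OF always_eventually, rotated]) (use step in blast)
    moreover have "(\<lambda>n. cis (\<theta> (r n))) \<longlonglongrightarrow> cis l"
      by (intro tendsto_cis \<theta>lim)
    then have "(\<lambda>n. F (r n) (x + \<delta>) - cis (\<theta> (r n)) * F (r n) x) \<longlonglongrightarrow> G (x + \<delta>) - cis l * G x"
      by (intro tendsto_diff tendsto_mult Fpt)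
    ultimately have "G (x + \<delta>) - cis l * G x = 0" using LIMSEQ_unique by blast
    then show ?thesis by simp
  qed
  define \<xi> where "\<xi> = l / \<delta>"
  have \<xi>: "\<xi> * \<delta> = l" using \<delta> by (simp add: \<xi>_def)
  define Q where "Q x = G x * cis (- \<xi> * x)" for x
  have Q: "Q \<in> AP" unfolding Q_def by (rule AP_mult_cis[OF G])
  have Qper: "Q (x + \<delta>) = Q x" for x
  proof -
    have "cis l * cis (- \<xi> * (x + \<delta>)) = cis (- \<xi> * x)"
      unfolding cis_mult using \<xi> by (simp add: algebra_simps)
    then show ?thesis unfolding Q_def Gper by (metis mult.assoc mult.commute)
  qed
  have meanQ: "fourier_coeff G \<xi> = of_real (1 / \<delta>) * integral {0..\<delta>} Q"
    unfolding fourier_coeff_mean Q_def[symmetric] by (rule mean_periodic[OF Q \<delta>(1) Qper])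
  \<comment> \<open>Over one mesh width G is within c/8 of \<open>G 0\<close>, whereas the pure
    character integrates to at least \<open>\<delta> / 3\<close> in modulus; c/8 < c/3 leaves a
    nonzero integral.\<close>
  have "norm (integral {0..\<delta>} Q - G 0 * integral {0..\<delta>} (\<lambda>x. cis (- \<xi> * x))) \<le> c/8 * \<delta>"
  proof -
    have i: "(\<lambda>x. G 0 * cis (- \<xi> * x)) integrable_on {0..\<delta>}"
      by (intro integrable_continuous_interval continuous_intros)
    have "integral {0..\<delta>} Q - G 0 * integral {0..\<delta>} (\<lambda>x. cis (- \<xi> * x)) = integral {0..\<delta>} (\<lambda>x. Q x - G 0 * cis (- \<xi> * x))"
      by (subst integral_diff[OF AP_integrable[OF Q] i]) simp
    also have "norm \<dots> \<le> c/8 * (\<delta> - 0)"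
    proof (rule integral_bound)
      show "continuous_on {0..\<delta>} (\<lambda>x. Q x - G 0 * cis (- \<xi> * x))"
        by (intro continuous_intros continuous_on_subset[OF AP_continuous[OF Q]]) auto
      fix t assume t: "t \<in> {0..\<delta>}"
      have "norm (G t - G 0) \<le> c/8" by (rule Gnear, rule d(2)) (use t \<delta> in auto)
      moreover have "Q t - G 0 * cis (- \<xi> * t) = (G t - G 0) * cis (- \<xi> * t)"
        by (simp add: Q_def algebra_simps)
      ultimately show "norm (Q t - G 0 * cis (- \<xi> * t)) \<le> c/8" by (simp add: norm_mult)
    qed (use \<delta> in auto)
    finally show ?thesis by simp
  qed
  moreover have "norm (G 0 * integral {0..\<delta>} (\<lambda>x. cis (- \<xi> * x))) \<ge> c * (\<delta> / 3)"
    unfolding norm_mult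
    by (intro mult_mono G0 norm_integral_cis_ge) (use \<delta> \<xi> r2(1) c(1) in \<open>auto simp: abs_le_iff\<close>)
  moreover have "c/8 * \<delta> < c * (\<delta>/3)" using c(1) \<delta>(1) by (simp add: field_simps)
  moreover note norm_triangle_ineq2[of "G 0 * integral {0..\<delta>} (\<lambda>x. cis (- \<xi> * x))" "integral {0..\<delta>} Q"]
  ultimately have "norm (integral {0..\<delta>} Q) > 0"
    unfolding norm_minus_commute[of "integral {0..\<delta>} Q"] by linarith
  then have "integral {0..\<delta>} Q \<noteq> 0" by simp
  then have GF: "fourier_coeff G \<xi> \<noteq> 0" unfolding meanQ using \<delta>(1) by simp
  have "fourier_coeff g \<xi> \<noteq> 0"
  proof
    assume 0: "fourier_coeff g \<xi> = 0"
    have "fourier_coeff (F n) \<xi> = 0" for n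
    proof -
      have "fourier_coeff (F n) \<xi> = mean (\<lambda>x. \<Sum>a<N n. (of_real (1 / real (N n)) * cis (- \<theta> n * real a)) * (g (x + real a * \<delta>) * cis (- \<xi> * x)))"
        unfolding fourier_coeff_mean F_def sum_distrib_left sum_distrib_right by (simp add: mult_ac)
      also have "\<dots> = (\<Sum>a<N n. (of_real (1 / real (N n)) * cis (- \<theta> n * real a)) * mean (\<lambda>x. g (x + real a * \<delta>) * cis (- \<xi> * x)))"
        by (subst mean_sum, simp, intro AP_mult AP_const AP_cis AP_shift g,
            intro sum.cong refl mean_cmult AP_mult_cis AP_shift g)
      also have "\<dots> = 0" 
        unfolding fourier_coeff_mean[symmetric] fourier_shift[OF g] 0 by simp
      finally show ?thesis .
    qed
    then have "(\<lambda>n. fourier_coeff (F (r n)) \<xi>) \<longlonglongrightarrow> 0" by simp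
    moreover have "(\<lambda>n. fourier_coeff (F (r n)) \<xi>) \<longlonglongrightarrow> fourier_coeff G \<xi>"
      by (rule fourier_uniform_limit[OF FAP G Flim])
    ultimately show False using GF LIMSEQ_unique by blast
  qed
  then show ?thesis by blast
qed

section \<open>Frequency modules\<close>

text \<open>By \<open>fourier_near\<close>, the characters at frequencies with coefficient at least
  c are equicontinuous for the pseudometric of g, hence relatively compact. Distinct characters
  differ by 2 at some point, so there are only finitely many for each c.\<close>

lemma countable_spectrum:
  assumes g: "g \<in> AP"
  shows "countable {\<xi>. fourier_coeff g \<xi> \<noteq> 0}"
proof -
  have fin: "finite {\<xi>. norm (fourier_coeff g \<xi>) \<ge> c}" if c: "c > 0" for c
  proof (rule ccontr)
    assume "infinite {\<xi>. norm (fourier_coeff g \<xi>) \<ge> c}"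
    then obtain \<mu> :: "nat \<Rightarrow> real" where \<mu>: "inj \<mu>" "range \<mu> \<subseteq> {\<xi>. norm (fourier_coeff g \<xi>) \<ge> c}"
      using infinite_countable_subset by blast
    define F where "F n x = cis (\<mu> n * x)" for n x
    have "\<exists>d>0. \<forall>n t s. near g d t s \<longrightarrow> norm (F n t - F n s) \<le> e" if e: "e > 0" for e
    proof (intro exI[of _ "c * e"] conjI allI impI)
      show "c * e > 0" using c e by simp
      fix n t s assume "near g (c * e) t s"
      from fourier_near[OF g this, of "\<mu> n"]
      have "norm (F n t - F n s) * norm (fourier_coeff g (\<mu> n)) \<le> c * e" by (simp add: F_def)
      moreover have "norm (F n t - F n s) * c \<le> norm (F n t - F n s) * norm (fourier_coeff g (\<mu> n))"
        using \<mu>(2) by (intro mult_left_mono) auto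
      ultimately have "c * norm (F n t - F n s) \<le> c * e" by (simp add: mult.commute)
      then show "norm (F n t - F n s) \<le> e" using c by simp
    qed
    then obtain r G where r: "strict_mono (r :: nat \<Rightarrow> nat)" "uniform_limit UNIV (\<lambda>n. F (r n)) G sequentially"
      by (rule AP_compactness[OF g, of F 1, rotated]) (auto simp: F_def)
    have "\<forall>\<^sub>F n in sequentially. \<forall>x\<in>UNIV. dist (F (r n) x) (G x) < 1"
      using uniform_limitD[OF r(2), of 1] by simp
    then obtain N where N: "\<And>n x. n \<ge> N \<Longrightarrow> dist (F (r n) x) (G x) < 1"
      unfolding eventually_sequentially by blast
    define a b where "a = \<mu> (r N)" and "b = \<mu> (r (Suc N))"
    have "r N < r (Suc N)" using r(1) by (simp add: strict_mono_def)
    then have "r N \<noteq> r (Suc N)" by simp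
    then have ab: "a \<noteq> b" using \<mu>(1) unfolding a_def b_def by (simp add: inj_eq)
    define x where "x = pi / (a - b)"
    have "dist (F (r N) x) (F (r (Suc N)) x) < 2"
      using dist_triangle_half_r[of "G x" "F (r N) x" 2 "F (r (Suc N)) x"] N[of N x] N[of "Suc N" x]
      by (simp add: dist_commute)
    moreover have "cis (a * x) = cis (b * x) * cis pi"
      unfolding cis_mult x_def using ab by (intro arg_cong[of _ _ cis]) (simp add: field_simps)
    then have "F (r N) x - F (r (Suc N)) x = - 2 * cis (b * x)"
      unfolding F_def a_def[symmetric] b_def[symmetric] by simp
    then have "dist (F (r N) x) (F (r (Suc N)) x) = 2" unfolding dist_norm by (simp add: norm_mult)
    ultimately show False by simp
  qed
  have "{\<xi>. fourier_coeff g \<xi> \<noteq> 0} \<subseteq> (\<Union>n::nat. {\<xi>. norm (fourier_coeff g \<xi>) \<ge> inverse (real (Suc n))})"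
  proof
    fix \<xi> assume "\<xi> \<in> {\<xi>. fourier_coeff g \<xi> \<noteq> 0}"
    then have "norm (fourier_coeff g \<xi>) > 0" by simp
    then obtain n where "inverse (real (Suc n)) < norm (fourier_coeff g \<xi>)" by (rule reals_Archimedean[THEN exE])
    then show "\<xi> \<in> (\<Union>n::nat. {\<xi>. norm (fourier_coeff g \<xi>) \<ge> inverse (real (Suc n))})"
      by (auto intro: less_imp_le)
  qed
  moreover have "countable (\<Union>n::nat. {\<xi>. norm (fourier_coeff g \<xi>) \<ge> inverse (real (Suc n))})"
    by (intro countable_UN countableI_type countable_finite fin) simp
  ultimately show ?thesis by (rule countable_subset)
qed

text \<open>Otherwise a limit of shifts would have the Fourier coefficients of \<open>g\<close> and differ from \<open>g\<close>.\<close>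

lemma near_by_characters:
  assumes g: "g \<in> AP" and e: "e > 0"
  obtains F d where "finite F" "F \<subseteq> {\<xi>. fourier_coeff g \<xi> \<noteq> 0}" "d > 0"
    "\<And>t. (\<And>\<mu>. \<mu> \<in> F \<Longrightarrow> norm (cis (\<mu> * t) - 1) \<le> d) \<Longrightarrow> near g e t 0"
proof -
  define S where "S = {\<xi>. fourier_coeff g \<xi> \<noteq> 0}"
  have "\<exists>F d. finite F \<and> F \<subseteq> S \<and> d > 0 \<and> (\<forall>t. (\<forall>\<mu>\<in>F. norm (cis (\<mu> * t) - 1) \<le> d) \<longrightarrow> near g e t 0)"
  proof (cases "S = {}")
    case True
    then have "g x = 0" for x using AP_fourier_nonzero[OF g, of x] by (auto simp: S_def)
    then have "near g e t 0" for t using e by (simp add: near_def)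
    then show ?thesis by (intro exI[of _ "{}"] exI[of _ 1]) auto
  next
    case False
    have "countable S" unfolding S_def by (rule countable_spectrum[OF g])
    then obtain m :: "nat \<Rightarrow> real" where m: "range m = S" using False by (metis range_from_nat_into)
    show ?thesis
    proof (rule ccontr)
      assume neg: "\<not> ?thesis"
      have "\<exists>t. (\<forall>k\<le>n. norm (cis (m k * t) - 1) \<le> inverse (real (Suc n))) \<and> \<not> near g e t 0" for n
      proof (rule ccontr)
        assume "\<not> ?thesis"
        then have "finite (m ` {..n}) \<and> m ` {..n} \<subseteq> S \<and> inverse (real (Suc n)) > 0 \<and>
            (\<forall>t. (\<forall>\<mu>\<in>m ` {..n}. norm (cis (\<mu> * t) - 1) \<le> inverse (real (Suc n))) \<longrightarrow> near g e t 0)"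
          using m by auto
        with neg show False by blast
      qed
      then have "\<forall>n. \<exists>t. (\<forall>k\<le>n. norm (cis (m k * t) - 1) \<le> inverse (real (Suc n))) \<and> \<not> near g e t 0" by blast
      from choice[OF this] obtain t where
        "\<forall>n. (\<forall>k\<le>n. norm (cis (m k * t n) - 1) \<le> inverse (real (Suc n))) \<and> \<not> near g e (t n) 0" ..
      then have t: "norm (cis (m k * t n) - 1) \<le> inverse (real (Suc n))" "\<not> near g e (t n) 0" if "k \<le> n" for k n
        using that by blast+
      obtain r where r: "strict_mono (r :: nat \<Rightarrow> nat)" "uniformly_convergent_on UNIV (\<lambda>n. shift g (t (r n)))"
        using g by (auto simp: AP_def)
      then obtain G where G: "uniform_limit UNIV (\<lambda>n. shift g (t (r n))) G sequentially"
        unfolding uniformly_convergent_on_def by blast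
      have shAP: "shift g a \<in> AP" for a unfolding shift_def by (rule AP_shift[OF g])
      have "norm (G a - G b) \<le> c" if "near g c a b" for a b c
      proof (rule tendsto_upperbound)
        show "(\<lambda>n. norm (shift g (t (r n)) a - shift g (t (r n)) b)) \<longlonglongrightarrow> norm (G a - G b)"
          by (intro tendsto_norm tendsto_diff tendsto_uniform_limitI[OF G]) auto
        show "\<forall>\<^sub>F n in sequentially. norm (shift g (t (r n)) a - shift g (t (r n)) b) \<le> c"
          unfolding shift_def using nearD[OF near_shift[OF that]] by (intro always_eventually) blast
      qed auto
      then have "dominated g G" unfolding dominated_def by blast
      then have GAP: "G \<in> AP" by (rule dominated_AP[OF g])
      \<comment> \<open>At frequencies of g the factor \<open>cis (\<xi> * t (r n))\<close> tends to
        1; at all others the coefficient of g is 0. Either way the coefficients of G and g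
        agree.\<close>
      have "fourier_coeff (\<lambda>x. G x - g x) \<xi> = 0" for \<xi>
      proof -
        have lim: "(\<lambda>n. cis (\<xi> * t (r n)) * fourier_coeff g \<xi>) \<longlonglongrightarrow> fourier_coeff G \<xi>"
          using fourier_uniform_limit[OF shAP GAP G, of \<xi>] by (simp add: shift_def fourier_shift[OF g])
        have "fourier_coeff G \<xi> = fourier_coeff g \<xi>"
        proof (cases "\<xi> \<in> S")
          case True
          then obtain k where k: "\<xi> = m k" using m by auto
          have "(\<lambda>n. cis (\<xi> * t n) - 1) \<longlonglongrightarrow> 0"
          proof (rule Lim_null_comparison[OF _ LIMSEQ_inverse_real_of_nat])
            show "\<forall>\<^sub>F n in sequentially. norm (cis (\<xi> * t n) - 1) \<le> inverse (real (Suc n))"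
              unfolding eventually_sequentially k using t(1) by blast
          qed
          then have "(\<lambda>n. cis (\<xi> * t n)) \<longlonglongrightarrow> 1" by (rule Lim_null[THEN iffD2])
          then have "(\<lambda>n. cis (\<xi> * t (r n))) \<longlonglongrightarrow> 1"
            using LIMSEQ_subseq_LIMSEQ[OF _ r(1), of "\<lambda>n. cis (\<xi> * t n)"] by (simp add: o_def)
          from tendsto_mult[OF this tendsto_const] have "(\<lambda>n. cis (\<xi> * t (r n)) * fourier_coeff g \<xi>) \<longlonglongrightarrow> fourier_coeff g \<xi>" by simp
          then show ?thesis using lim LIMSEQ_unique by blast
        next
          case False
          then show ?thesis using lim by (simp add: S_def LIMSEQ_const_iff)
        qed
        then show ?thesis by (simp add: fourier_diff[OF GAP g])
      qed
      then have "G x - g x = 0" for x using AP_fourier_nonzero[OF AP_minus[OF GAP g], of x] by blast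
      then have "G = g" by auto
      then have "\<forall>\<^sub>F n in sequentially. \<forall>x\<in>UNIV. dist (shift g (t (r n)) x) (g x) < e"
        using uniform_limitD[OF G e] by simp
      then obtain n where "\<And>x. dist (shift g (t (r n)) x) (g x) < e" unfolding eventually_sequentially by blast
      then have "near g e (t (r n)) 0" unfolding near_def shift_def dist_norm by (simp add: less_imp_le)
      then show False using t(2) by blast
    qed
  qed
  then obtain F d where "finite F" "F \<subseteq> S" "d > 0"
    "\<forall>t. (\<forall>\<mu>\<in>F. norm (cis (\<mu> * t) - 1) \<le> d) \<longrightarrow> near g e t 0" by blast
  then show ?thesis by (intro that[of F d]) (auto simp: S_def)
qed

text \<open>A Riesz product. Each factor is the Fejer kernel 1 + cos scaled to have maximum 1, so
  the product lies in [0, 1], equals 1 at 0 and has its frequencies in the group generated by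
  F.\<close>

definition fejer_product :: "real set \<Rightarrow> real \<Rightarrow> real" where
  "fejer_product F x = (\<Prod>\<mu>\<in>F. (1 + cos (\<mu> * x)) / 2)"

lemma half_1_cos_bounds: "0 \<le> (1 + cos x) / 2" "(1 + cos x) / 2 \<le> 1" for x :: real
proof -
  have "0 \<le> (1 + c) / 2 \<and> (1 + c) / 2 \<le> 1" if "- 1 \<le> c" "c \<le> 1" for c :: real
    using that by simp
  from this[OF cos_ge_minus_one cos_le_one] show "0 \<le> (1 + cos x) / 2" "(1 + cos x) / 2 \<le> 1"
    by blast+
qed

lemma fejer_product_bounds: "0 \<le> fejer_product F x" "fejer_product F x \<le> 1"
proof -
  have "0 \<le> (1 + cos (\<mu> * x)) / 2" "(1 + cos (\<mu> * x)) / 2 \<le> 1" for \<mu>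
    by (rule half_1_cos_bounds)+
  then show "0 \<le> fejer_product F x" "fejer_product F x \<le> 1"
    unfolding fejer_product_def by (auto intro: prod_nonneg prod_le_1)
qed

text \<open>One factor shifts frequencies by 0, \<mu> and -\<mu>, under which the group is stable.
  The function k is carried along so that powers of the product can be built by induction.\<close>

lemma fejer_product_AP_spectrum:
  assumes F: "finite F" "F \<subseteq> \<Gamma>" and \<Gamma>: "\<Gamma> = group_closure \<Gamma>"
    and k: "k \<in> AP" "\<And>\<nu>. \<nu> \<notin> \<Gamma> \<Longrightarrow> fourier_coeff k \<nu> = 0"
  shows "(\<lambda>x. k x * complex_of_real (fejer_product F x)) \<in> AP \<and>
    (\<forall>\<nu>. \<nu> \<notin> \<Gamma> \<longrightarrow> fourier_coeff (\<lambda>x. k x * complex_of_real (fejer_product F x)) \<nu> = 0)"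
  using F
proof (induction F rule: finite_induct)
  case (insert \<mu> F)
  define h where "h x = k x * complex_of_real (fejer_product F x)" for x
  have h: "h \<in> AP" "\<And>\<nu>. \<nu> \<notin> \<Gamma> \<Longrightarrow> fourier_coeff h \<nu> = 0"
    using insert unfolding h_def by auto
  have eq: "k x * complex_of_real (fejer_product (insert \<mu> F) x) =
      (1/2) * h x + ((1/4) * (h x * cis (\<mu> * x)) + (1/4) * (h x * cis (- \<mu> * x)))" for x
  proof -
    have "complex_of_real ((1 + cos (\<mu> * x)) / 2) = 1/2 + (1/4 * cis (\<mu> * x) + 1/4 * cis (- \<mu> * x))"
      by (simp add: complex_eq_iff)
    then have "k x * complex_of_real (fejer_product (insert \<mu> F) x) = h x * (1/2 + (1/4 * cis (\<mu> * x) + 1/4 * cis (- \<mu> * x)))"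
      using insert(1,2) by (simp add: fejer_product_def h_def)
    then show ?thesis by (simp only: algebra_simps)
  qed
  have a: "(\<lambda>x. (1/2) * h x) \<in> AP" "(\<lambda>x. (1/4) * (h x * cis (\<mu> * x))) \<in> AP" "(\<lambda>x. (1/4) * (h x * cis (- \<mu> * x))) \<in> AP"
    by (intro AP_mult AP_const AP_cis h)+
  show ?case unfolding eq
  proof (intro conjI allI impI)
    show "(\<lambda>x. (1/2) * h x + ((1/4) * (h x * cis (\<mu> * x)) + (1/4) * (h x * cis (- \<mu> * x)))) \<in> AP"
      by (intro AP_add a)
    fix \<nu> assume \<nu>: "\<nu> \<notin> \<Gamma>"
    have \<mu>: "\<mu> \<in> \<Gamma>" using insert by auto
    have "\<nu> - \<mu> \<notin> \<Gamma>" using \<nu> \<mu> \<Gamma> group_closure_add[of "\<nu> - \<mu>" \<Gamma> \<mu>] by auto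
    moreover have "\<nu> - (- \<mu>) \<notin> \<Gamma>" using \<nu> \<mu> \<Gamma> group_closure.diff[of "\<nu> - (- \<mu>)" \<Gamma> \<mu>] by auto
    ultimately show "fourier_coeff (\<lambda>x. (1/2) * h x + ((1/4) * (h x * cis (\<mu> * x)) + (1/4) * (h x * cis (- \<mu> * x)))) \<nu> = 0"
      using \<nu> h a by (simp only: fourier_add AP_add fourier_cmult AP_mult_cis fourier_mult_cis) simp
  qed
qed (use k in \<open>simp add: fejer_product_def\<close>)

lemma fejer_power_AP_spectrum:
  assumes F: "finite F" "F \<subseteq> \<Gamma>" and \<Gamma>: "\<Gamma> = group_closure \<Gamma>"
  shows "(\<lambda>x. complex_of_real (fejer_product F x ^ n)) \<in> AP \<and>
    (\<forall>\<nu>. \<nu> \<notin> \<Gamma> \<longrightarrow> fourier_coeff (\<lambda>x. complex_of_real (fejer_product F x ^ n)) \<nu> = 0)"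
proof (induction n)
  case 0
  have "0 \<in> \<Gamma>" using \<Gamma> zero_in_group_closure by blast
  then have "\<nu> \<noteq> 0" if "\<nu> \<notin> \<Gamma>" for \<nu> using that by blast
  then show ?case by (simp add: AP_const fourier_one)
next
  case (Suc n)
  then have "(\<lambda>x. complex_of_real (fejer_product F x ^ n)) \<in> AP"
    "\<And>\<nu>. \<nu> \<notin> \<Gamma> \<Longrightarrow> fourier_coeff (\<lambda>x. complex_of_real (fejer_product F x ^ n)) \<nu> = 0" by auto
  from fejer_product_AP_spectrum[OF F \<Gamma> this] show ?case by (simp add: mult.commute)
qed

text \<open>Powers of the product kernel concentrate where all the characters in \<open>F\<close> are close to 1, and they are
  orthogonal to the character \<open>\<xi>\<close> outside the group.\<close>

lemma character_separation:
  assumes F: "finite F" "F \<subseteq> \<Gamma>" and \<Gamma>: "\<Gamma> = group_closure \<Gamma>" and \<xi>: "\<xi> \<notin> \<Gamma>" and d: "d > 0"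
  obtains t where "\<And>\<mu>. \<mu> \<in> F \<Longrightarrow> norm (cis (\<mu> * t) - 1) \<le> d" "norm (cis (\<xi> * t) - 1) > 1/2"
proof -
  have "\<exists>t. (\<forall>\<mu>\<in>F. norm (cis (\<mu> * t) - 1) \<le> d) \<and> norm (cis (\<xi> * t) - 1) > 1/2"
  proof (rule ccontr)
    assume neg: "\<not> ?thesis"
    define K where "K = fejer_product F"
    define Kn where "Kn n x = complex_of_real (K x ^ n)" for n x
    have KnAP: "Kn n \<in> AP" and KnS: "fourier_coeff (Kn n) \<xi> = 0" for n
      using fejer_power_AP_spectrum[OF F \<Gamma>, of n] \<xi> unfolding Kn_def K_def by auto
    have K: "0 \<le> K x" "K x \<le> 1" for x unfolding K_def by (rule fejer_product_bounds)+
    \<comment> \<open>\<open>K t > 1 - \<eta>\<close> gives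
      \<open>cos (\<mu> * t) > 1 - 2 * \<eta>\<close>, hence a squared distance
      \<open>2 - 2 * cos (\<mu> * t)\<close> below \<open>4 * \<eta>\<close>, which is at most
      \<open>d\<^sup>2\<close>. The bound 1/2 keeps both bases \<open>1 - \<eta>\<close> and
      \<open>1 - \<eta>/2\<close> positive.\<close>
    define \<eta> where "\<eta> = min (d\<^sup>2 / 4) (1/2)"
    have \<eta>: "\<eta> > 0" "\<eta> \<le> 1/2" "4 * \<eta> \<le> d\<^sup>2" using d by (auto simp: \<eta>_def)
    have Kgood: "norm (cis (\<xi> * t) - 1) \<le> 1/2" if "K t > 1 - \<eta>" for t
    proof -
      have "norm (cis (\<mu> * t) - 1) \<le> d" if "\<mu> \<in> F" for \<mu>
      proof -
        have "fejer_product F t = (1 + cos (\<mu> * t)) / 2 * fejer_product (F - {\<mu>}) t"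
          unfolding fejer_product_def using F(1) that by (simp add: prod.remove)
        also have "\<dots> \<le> (1 + cos (\<mu> * t)) / 2 * 1"
          by (intro mult_left_mono fejer_product_bounds half_1_cos_bounds)
        finally have "cos (\<mu> * t) > 1 - 2 * \<eta>" using \<open>K t > 1 - \<eta>\<close> unfolding K_def by simp
        moreover have "(norm (cis (\<mu> * t) - 1))\<^sup>2 = 2 - 2 * cos (\<mu> * t)"
        proof -
          have "(norm (cis (\<mu> * t) - 1))\<^sup>2 = (cos (\<mu> * t) - 1)\<^sup>2 + (sin (\<mu> * t))\<^sup>2" by (simp add: cmod_power2)
          also have "\<dots> = 1 + ((cos (\<mu> * t))\<^sup>2 + (sin (\<mu> * t))\<^sup>2) - 2 * cos (\<mu> * t)" by (simp only: power2_diff) simp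
          also have "\<dots> = 2 - 2 * cos (\<mu> * t)" by (simp add: sin_cos_squared_add2)
          finally show ?thesis .
        qed
        ultimately have "(norm (cis (\<mu> * t) - 1))\<^sup>2 \<le> d\<^sup>2" using \<eta> by linarith
        then show ?thesis using d by (simp add: power2_le_iff_abs_le)
      qed
      with neg show ?thesis by (meson not_le)
    qed
    \<comment> \<open>As \<xi> is not a frequency of \<open>Kn n\<close>, the factor
      \<open>1 - cis (- \<xi> * x)\<close> leaves the mean unchanged. Where K exceeds
      \<open>1 - \<eta>\<close> its real part is at most 1/2 by the assumption to be refuted;
      elsewhere it is at most 2 while \<open>K x ^ n\<close> is at most
      \<open>(1 - \<eta>) ^ n\<close>. Half of the mean is then absorbed.\<close>
    have up: "Re (mean (Kn n)) \<le> 4 * (1 - \<eta>) ^ n" for n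
    proof -
      define u where "u x = Kn n x * (1 - cis (- \<xi> * x))" for x
      have u: "u \<in> AP" unfolding u_def by (intro AP_mult AP_minus AP_const AP_cis KnAP)
      have "mean u = mean (Kn n) - fourier_coeff (Kn n) \<xi>"
        unfolding u_def fourier_coeff_mean right_diff_distrib mult_1_right by (rule mean_diff[OF KnAP AP_mult_cis[OF KnAP]])
      then have mu: "mean u = mean (Kn n)" by (simp add: KnS)
      define v where "v x = (1/2) * Kn n x + of_real (2 * (1 - \<eta>) ^ n) - u x" for x
      have hK: "(\<lambda>x. (1/2) * Kn n x) \<in> AP" by (intro AP_mult AP_const KnAP)
      have v: "v \<in> AP" unfolding v_def by (intro AP_minus AP_add AP_const hK u)
      have "Re (v x) \<ge> 0" for x
      proof -
        have Reu: "Re (u x) = K x ^ n * Re (1 - cis (- \<xi> * x))" by (simp add: u_def Kn_def)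
        have kn: "0 \<le> K x ^ n" using K by simp
        show ?thesis
        proof (cases "K x > 1 - \<eta>")
          case True
          have "Re (1 - cis (- \<xi> * x)) \<le> norm (1 - cis (- \<xi> * x))" by (rule complex_Re_le_cmod)
          also have "\<dots> = norm (cnj (1 - cis (- \<xi> * x)))" by (rule complex_mod_cnj[symmetric])
          also have "cnj (1 - cis (- \<xi> * x)) = 1 - cis (\<xi> * x)" by (simp add: cis_cnj)
          also have "norm (1 - cis (\<xi> * x)) \<le> 1/2" using Kgood[OF True] by (simp only: norm_minus_commute)
          finally have "Re (u x) \<le> K x ^ n * (1/2)" unfolding Reu using kn by (intro mult_left_mono)
          moreover have "0 \<le> (1 - \<eta>) ^ n" using \<eta> by simp
          ultimately show ?thesis by (simp add: v_def Kn_def)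
        next
          case False
          then have "K x ^ n \<le> (1 - \<eta>) ^ n" using K by (intro power_mono) auto
          moreover have "Re (1 - cis (- \<xi> * x)) \<le> 2" using half_1_cos_bounds(1)[of "- \<xi> * x"] by simp
          ultimately have "Re (u x) \<le> (1 - \<eta>) ^ n * 2"
            unfolding Reu using kn \<eta> cos_le_one[of "- \<xi> * x"] by (intro mult_mono) auto
          then show ?thesis using kn by (simp add: v_def Kn_def)
        qed
      qed
      then have "Re (mean v) \<ge> 0" by (rule Re_mean_nonneg[OF v])
      moreover have "mean v = (1/2) * mean (Kn n) + of_real (2 * (1 - \<eta>) ^ n) - mean (Kn n)"
        unfolding v_def by (simp only: mean_diff mean_add mean_const mean_cmult mu AP_add AP_const hK u KnAP)
      ultimately have "0 \<le> Re ((1/2) * mean (Kn n) + of_real (2 * (1 - \<eta>) ^ n) - mean (Kn n))" by simp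
      then show ?thesis by (simp del: of_real_mult of_real_power)
    qed
    have K1: "Kn 1 \<in> AP" by (rule KnAP)
    have "\<eta>/2 > 0" using \<eta> by simp
    then obtain T where T: "finite T" "T \<noteq> {}" "\<And>t. \<exists>s\<in>T. near (Kn 1) (\<eta>/2) t s"
      by (rule AP_net[OF K1]) blast
    \<comment> \<open>The value 1 of K at 0 recurs along a finite net of translates: at every x one
      of them is at least \<open>1 - \<eta>/2\<close>. So the mean decays no faster than
      \<open>(1 - \<eta>/2) ^ n\<close>, which the upper bound contradicts for large n.\<close>
    have low: "(1 - \<eta>/2) ^ n \<le> real (card T) * Re (mean (Kn n))" for n
    proof -
      define g where "g x = (\<Sum>s\<in>T. Kn n (x + - s)) - of_real ((1 - \<eta>/2) ^ n)" for x
      have sAP: "(\<lambda>x. \<Sum>s\<in>T. Kn n (x + - s)) \<in> AP" by (intro AP_sum AP_shift KnAP)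
      have gAP: "g \<in> AP" unfolding g_def by (intro AP_minus sAP AP_const)
      have "mean g = of_nat (card T) * mean (Kn n) - of_real ((1 - \<eta>/2) ^ n)"
        unfolding g_def mean_diff[OF sAP AP_const] mean_const
        unfolding mean_sum[OF T(1) AP_shift[OF KnAP]] mean_shift[OF KnAP] by simp
      moreover have "Re (g x) \<ge> 0" for x
      proof -
        obtain s where s: "s \<in> T" "near (Kn 1) (\<eta>/2) x s" using T(3) by blast
        have "norm (Kn 1 (- s + x) - Kn 1 (- s + s)) \<le> \<eta>/2" using s(2) unfolding near_def by blast
        then have "\<bar>K (x + - s) - K 0\<bar> \<le> \<eta>/2" unfolding Kn_def by (simp add: add.commute flip: of_real_diff)
        moreover have "K 0 = 1" by (simp add: K_def fejer_product_def)
        ultimately have "1 - \<eta>/2 \<le> K (x + - s)" by linarith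
        then have "(1 - \<eta>/2) ^ n \<le> K (x + - s) ^ n" using \<eta> by (intro power_mono) auto
        also have "\<dots> \<le> (\<Sum>s\<in>T. K (x + - s) ^ n)" using s(1) T(1) K(1) by (intro member_le_sum) auto
        finally show ?thesis unfolding g_def Kn_def by (simp del: of_real_power)
      qed
      then have "Re (mean g) \<ge> 0" by (rule Re_mean_nonneg[OF gAP])
      ultimately show ?thesis by (simp del: of_real_power)
    qed
    define \<rho> where "\<rho> = (1 - \<eta>) / (1 - \<eta>/2)"
    have \<rho>: "0 \<le> \<rho>" "\<rho> < 1" using \<eta> by (auto simp: \<rho>_def field_simps)
    have "1 \<le> 4 * real (card T) * \<rho> ^ n" for n
    proof -
      have pos: "(1 - \<eta>/2) ^ n > 0" using \<eta> by simp
      have "(1 - \<eta>/2) ^ n \<le> real (card T) * (4 * (1 - \<eta>) ^ n)"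
        using low[of n] mult_left_mono[OF up[of n], of "real (card T)"] by linarith
      then have "1 \<le> real (card T) * (4 * (1 - \<eta>) ^ n) / (1 - \<eta>/2) ^ n" using pos by (simp add: pos_le_divide_eq)
      then show ?thesis unfolding \<rho>_def power_divide by (simp only: mult_ac times_divide_eq_right)
    qed
    moreover have "(\<lambda>n. 4 * real (card T) * \<rho> ^ n) \<longlonglongrightarrow> 0"
      using tendsto_mult_right_zero[OF LIMSEQ_power_zero[of \<rho>]] \<rho> by simp
    ultimately have "(1::real) \<le> 0" by (intro LIMSEQ_le_const[of _ 0 1]) auto
    then show False by simp
  qed
  then obtain t where "\<forall>\<mu>\<in>F. norm (cis (\<mu> * t) - 1) \<le> d" "norm (cis (\<xi> * t) - 1) > 1/2" by blast
  then show ?thesis by (intro that[of t]) auto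
qed

lemma group_closure_idem: "group_closure (group_closure S) = group_closure S"
proof
  show "group_closure (group_closure S) \<subseteq> group_closure S"
  proof
    fix x assume "x \<in> group_closure (group_closure S)"
    then show "x \<in> group_closure S"
      by induction (auto intro: group_closure.diff)
  qed
qed (auto intro: group_closure.base)

lemma group_closure_least:
  assumes "S \<subseteq> \<Gamma>" "\<Gamma> = group_closure \<Gamma>"
  shows "group_closure S \<subseteq> \<Gamma>"
proof
  fix x assume "x \<in> group_closure S"
  then have "x \<in> group_closure \<Gamma>"
    by induction (use assms(1) in \<open>auto intro: group_closure.diff group_closure.base\<close>)
  with assms(2) show "x \<in> \<Gamma>" by simp
qed

theorem dominated_freq_module:
  fixes p q w :: "real \<Rightarrow> real"
  assumes p: "p \<in> AP" and q: "q \<in> AP" and w: "w \<in> AP"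
    and f: "f \<in> AP" "dominated (\<lambda>x. (p x, q x, w x)) f"
  shows "freq_module f \<subseteq> freq_module_v p q w"
proof -
  define \<Gamma> where "\<Gamma> = freq_module_v p q w"
  have \<Gamma>: "\<Gamma> = group_closure \<Gamma>" unfolding \<Gamma>_def freq_module_v_def group_closure_idem ..
  define V where "V x = (p x, q x, w x)" for x
  have of_real_AP: "(\<lambda>x. complex_of_real (h x)) \<in> AP" if "h \<in> AP" for h
    by (rule AP_bounded_linear[OF that bounded_linear_of_real])
  have sub: "{\<xi>. fourier_coeff (\<lambda>x. complex_of_real (h x)) \<xi> \<noteq> 0} \<subseteq> \<Gamma>" if "h \<in> {p, q, w}" for h
  proof -
    have "{\<xi>. fourier_coeff (\<lambda>x. complex_of_real (h x)) \<xi> \<noteq> 0} \<subseteq> freq_module (\<lambda>x. complex_of_real (h x))"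
      unfolding freq_module_def by (auto intro: group_closure.base)
    also have "\<dots> \<subseteq> \<Gamma>" using that unfolding \<Gamma>_def freq_module_v_def by (auto intro: group_closure.base)
    finally show ?thesis .
  qed
  have near_real: "\<exists>F d. finite F \<and> F \<subseteq> \<Gamma> \<and> d > 0 \<and> (\<forall>t. (\<forall>\<mu>\<in>F. norm (cis (\<mu> * t) - 1) \<le> d) \<longrightarrow> near h e t 0)"
    if h: "h \<in> AP" "h \<in> {p, q, w}" and e: "e > 0" for h e
  proof -
    obtain F d where Fd: "finite F" "F \<subseteq> {\<xi>. fourier_coeff (\<lambda>x. complex_of_real (h x)) \<xi> \<noteq> 0}" "d > 0"
      "\<And>t. (\<And>\<mu>. \<mu> \<in> F \<Longrightarrow> norm (cis (\<mu> * t) - 1) \<le> d) \<Longrightarrow> near (\<lambda>x. complex_of_real (h x)) e t 0"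
      by (rule near_by_characters[OF of_real_AP[OF h(1)] e]) blast
    have "near h e t 0" if "\<forall>\<mu>\<in>F. norm (cis (\<mu> * t) - 1) \<le> d" for t
    proof -
      have "near (\<lambda>x. complex_of_real (h x)) e t 0" by (rule Fd(4)) (use that in blast)
      then show ?thesis unfolding near_def by (simp flip: of_real_diff)
    qed
    moreover have "F \<subseteq> \<Gamma>" using Fd(2) sub[OF h(2)] by (rule order_trans)
    ultimately show ?thesis using Fd(1,3) by (intro exI[of _ F] exI[of _ d]) simp
  qed
  have "\<xi> \<in> \<Gamma>" if \<xi>: "fourier_coeff f \<xi> \<noteq> 0" for \<xi>
  proof (rule ccontr)
    assume out: "\<xi> \<notin> \<Gamma>"
    define c where "c = norm (fourier_coeff f \<xi>)"
    have c: "c > 0" using \<xi> by (simp add: c_def)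
    \<comment> \<open>The tolerance c/2 is matched to the separation 1/2: moving \<xi> by more than
      1/2 changes the coefficient at \<xi> by more than c/2.\<close>
    then have "c/2 > 0" by simp
    then obtain e where e: "e > 0" "\<And>t s. near V e t s \<Longrightarrow> near f (c/2) t s"
      by (rule dominatedD[OF f(2)[folded V_def]]) blast
    have e3: "e/3 > 0" using e(1) by simp
    obtain F1 d1 where 1: "finite F1" "F1 \<subseteq> \<Gamma>" "d1 > 0" "\<And>t. (\<forall>\<mu>\<in>F1. norm (cis (\<mu> * t) - 1) \<le> d1) \<Longrightarrow> near p (e/3) t 0"
      using near_real[OF p _ e3] by auto
    obtain F2 d2 where 2: "finite F2" "F2 \<subseteq> \<Gamma>" "d2 > 0" "\<And>t. (\<forall>\<mu>\<in>F2. norm (cis (\<mu> * t) - 1) \<le> d2) \<Longrightarrow> near q (e/3) t 0"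
      using near_real[OF q _ e3] by auto
    obtain F3 d3 where 3: "finite F3" "F3 \<subseteq> \<Gamma>" "d3 > 0" "\<And>t. (\<forall>\<mu>\<in>F3. norm (cis (\<mu> * t) - 1) \<le> d3) \<Longrightarrow> near w (e/3) t 0"
      using near_real[OF w _ e3] by auto
    define d where "d = min d1 (min d2 d3)"
    have d: "d > 0" using 1 2 3 by (simp add: d_def)
    have F: "finite (F1 \<union> F2 \<union> F3)" "F1 \<union> F2 \<union> F3 \<subseteq> \<Gamma>" using 1 2 3 by auto
    obtain t where t: "\<And>\<mu>. \<mu> \<in> F1 \<union> F2 \<union> F3 \<Longrightarrow> norm (cis (\<mu> * t) - 1) \<le> d" "norm (cis (\<xi> * t) - 1) > 1/2"
      by (rule character_separation[OF F \<Gamma> out d]) blast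
    have "near p (e/3) t 0" by (rule 1(4)) (use t(1) in \<open>auto simp: d_def\<close>)
    moreover have "near q (e/3) t 0" by (rule 2(4)) (use t(1) in \<open>auto simp: d_def\<close>)
    moreover have "near w (e/3) t 0" by (rule 3(4)) (use t(1) in \<open>auto simp: d_def\<close>)
    ultimately have "near V e t 0"
      unfolding near_def
    proof (intro allI)
      fix x
      assume n: "\<forall>x. norm (p (x + t) - p (x + 0)) \<le> e/3" "\<forall>x. norm (q (x + t) - q (x + 0)) \<le> e/3" "\<forall>x. norm (w (x + t) - w (x + 0)) \<le> e/3"
      have "norm (V (x + t) - V (x + 0)) \<le> norm (p (x + t) - p (x + 0)) + (norm (q (x + t) - q (x + 0)) + norm (w (x + t) - w (x + 0)))"
        unfolding V_def diff_Pair by (intro order_trans[OF norm_Pair_le] add_left_mono norm_Pair_le)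
      also have "\<dots> \<le> e/3 + (e/3 + e/3)" using n by (intro add_mono) auto
      finally show "norm (V (x + t) - V (x + 0)) \<le> e" by simp
    qed
    from fourier_near[OF f(1) e(2)[OF this], of \<xi>] have "norm (cis (\<xi> * t) - 1) * c \<le> c/2" by (simp add: c_def)
    moreover have "1/2 * c < norm (cis (\<xi> * t) - 1) * c" using t(2) c by (intro mult_strict_right_mono) auto
    ultimately show False by simp
  qed
  then show ?thesis unfolding freq_module_def \<Gamma>_def[symmetric] by (intro group_closure_least \<Gamma>) auto
qed

section \<open>The Sturm-Liouville system\<close>

lemma has_real_derivative_norm_square:
  fixes f :: "real \<Rightarrow> complex"
  assumes "(f has_vector_derivative f') (at x)"
  shows "((\<lambda>x. (norm (f x))\<^sup>2) has_real_derivative 2 * Re (cnj (f x) * f')) (at x)"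
proof -
  have d: "((\<lambda>x. Re (f x)) has_real_derivative Re f') (at x)" "((\<lambda>x. Im (f x)) has_real_derivative Im f') (at x)"
    using bounded_linear.has_vector_derivative[OF bounded_linear_Re assms] bounded_linear.has_vector_derivative[OF bounded_linear_Im assms]
    by (simp_all add: has_real_derivative_iff_has_vector_derivative)
  show ?thesis unfolding cmod_power2
    using DERIV_add[OF DERIV_power[OF d(1), of 2] DERIV_power[OF d(2), of 2]] by (simp add: algebra_simps)
qed

text \<open>Gronwall in both directions: \<open>N s * exp (- L * s)\<close> is nonincreasing and
  \<open>N s * exp (L * s)\<close> is nondecreasing.\<close>

lemma exp_growth_bound:
  fixes N :: "real \<Rightarrow> real"
  assumes der: "\<And>s. s \<in> {c..d} \<Longrightarrow> (N has_real_derivative N' s) (at s)"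
    and bd: "\<And>s. s \<in> {c..d} \<Longrightarrow> \<bar>N' s\<bar> \<le> L * N s" and xy: "x \<in> {c..d}" "y \<in> {c..d}"
  shows "N y \<le> exp (L * \<bar>y - x\<bar>) * N x"
proof -
  have fw: "N y \<le> exp (L * (y - x)) * N x" if "x \<le> y" "x \<in> {c..d}" "y \<in> {c..d}" for x y
  proof -
    have "N y * exp (- L * y) \<le> N x * exp (- L * x)"
    proof (rule DERIV_nonpos_imp_nonincreasing[OF that(1)])
      fix s assume "x \<le> s" "s \<le> y"
      then have s: "s \<in> {c..d}" using that by auto
      have "((\<lambda>s. N s * exp (- L * s)) has_real_derivative (N' s - L * N s) * exp (- L * s)) (at s)"
        by (auto intro!: derivative_eq_intros der[OF s] simp: algebra_simps)
      moreover have "(N' s - L * N s) * exp (- L * s) \<le> 0"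
        using bd[OF s] by (intro mult_nonpos_nonneg) auto
      ultimately show "\<exists>y. ((\<lambda>s. N s * exp (- L * s)) has_real_derivative y) (at s) \<and> y \<le> 0" by blast
    qed
    then have "N y * exp (- L * y) * exp (L * y) \<le> N x * exp (- L * x) * exp (L * y)"
      by (rule mult_right_mono) simp
    then show ?thesis by (simp add: mult.assoc exp_add[symmetric] algebra_simps)
  qed
  have bw: "N x \<le> exp (L * (y - x)) * N y" if "x \<le> y" "x \<in> {c..d}" "y \<in> {c..d}" for x y
  proof -
    have "N x * exp (L * x) \<le> N y * exp (L * y)"
    proof (rule DERIV_nonneg_imp_nondecreasing[OF that(1)])
      fix s assume "x \<le> s" "s \<le> y"
      then have s: "s \<in> {c..d}" using that by auto
      have "((\<lambda>s. N s * exp (L * s)) has_real_derivative (N' s + L * N s) * exp (L * s)) (at s)"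
        by (auto intro!: derivative_eq_intros der[OF s] simp: algebra_simps)
      moreover have "(N' s + L * N s) * exp (L * s) \<ge> 0"
        using bd[OF s] by (intro mult_nonneg_nonneg) auto
      ultimately show "\<exists>y. ((\<lambda>s. N s * exp (L * s)) has_real_derivative y) (at s) \<and> y \<ge> 0" by blast
    qed
    then have "N x * exp (L * x) * exp (- L * x) \<le> N y * exp (L * y) * exp (- L * x)"
      by (rule mult_right_mono) simp
    then show ?thesis by (simp add: mult.assoc exp_add[symmetric] algebra_simps)
  qed
  show ?thesis
  proof (cases "x \<le> y")
    case True
    then show ?thesis using fw[OF True xy] by simp
  next
    case False
    then show ?thesis using bw[of y x] xy by simp
  qed
qed

section \<open>Square integrability of continuous functions near infinity\<close>

lemma integrable_cont: "continuous_on UNIV f \<Longrightarrow> f integrable_on {a..b}"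
  for f :: "real \<Rightarrow> 'a::banach"
  by (rule integrable_continuous_interval) (metis continuous_on_subset subset_UNIV)

lemma integral_split:
  fixes f :: "real \<Rightarrow> 'a::banach"
  assumes "continuous_on UNIV f" "a \<le> c" "c \<le> b"
  shows "integral {a..b} f = integral {a..c} f + integral {c..b} f"
  using Henstock_Kurzweil_Integration.integral_combine[OF assms(2,3) integrable_cont[OF assms(1)]] by simp

lemma integral_mono_upper:
  fixes f :: "real \<Rightarrow> real"
  assumes "continuous_on UNIV f" "\<And>x. f x \<ge> 0" "c \<le> a" "b \<le> d"
  shows "integral {a..b} f \<le> integral {c..d} f"
  by (rule integral_subset_le) (use assms integrable_cont in auto)

text \<open>Stated by bounded integrals over compact intervals, which suits continuous functions;
  for b < 0 the interval is empty and the integral is 0. \<open>L2_right_iff\<close> identifies it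
  with membership in the weighted space on the half-line.\<close>

definition L2_right :: "(real \<Rightarrow> complex) \<Rightarrow> bool" where
  "L2_right f \<longleftrightarrow> (\<exists>B. \<forall>b. integral {0..b} (\<lambda>x. (norm (f x))\<^sup>2) \<le> B)"

definition L2_left :: "(real \<Rightarrow> complex) \<Rightarrow> bool" where
  "L2_left f \<longleftrightarrow> L2_right (\<lambda>x. f (- x))"

lemma cont_norm_square: "continuous_on UNIV f \<Longrightarrow> continuous_on UNIV (\<lambda>x. (norm (f x))\<^sup>2)"
  by (intro continuous_intros)

lemma L2_right_le:
  assumes f: "continuous_on UNIV f" and g: "continuous_on UNIV g" and L2: "L2_right g"
    and le: "\<And>x. x \<ge> c \<Longrightarrow> norm (f x) \<le> k * norm (g x)"
  shows "L2_right f"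
proof -
  obtain B where B: "\<And>b. integral {0..b} (\<lambda>x. (norm (g x))\<^sup>2) \<le> B" using L2 unfolding L2_right_def by blast
  define d where "d = max c 0"
  note cf = cont_norm_square[OF f] and cg = cont_norm_square[OF g]
  have B0: "B \<ge> 0" using B[of 0] by simp
  have "integral {0..b} (\<lambda>x. (norm (f x))\<^sup>2) \<le> integral {0..d} (\<lambda>x. (norm (f x))\<^sup>2) + k\<^sup>2 * B" for b
  proof (cases "b \<le> d")
    case True
    then have "integral {0..b} (\<lambda>x. (norm (f x))\<^sup>2) \<le> integral {0..d} (\<lambda>x. (norm (f x))\<^sup>2)"
      by (intro integral_mono_upper cf) auto
    then show ?thesis using B0 by (smt (verit) mult_nonneg_nonneg zero_le_power2)
  next
    case False
    have "integral {d..b} (\<lambda>x. (norm (f x))\<^sup>2) \<le> integral {d..b} (\<lambda>x. k\<^sup>2 * (norm (g x))\<^sup>2)"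
    proof (rule integral_le)
      fix x assume "x \<in> {d..b}"
      then have "norm (f x) \<le> k * norm (g x)" using le by (simp add: d_def)
      then have "(norm (f x))\<^sup>2 \<le> (k * norm (g x))\<^sup>2" by (intro power_mono) auto
      then show "(norm (f x))\<^sup>2 \<le> k\<^sup>2 * (norm (g x))\<^sup>2" by (simp add: power_mult_distrib)
    qed (intro integrable_cont continuous_on_mult continuous_on_const cf cg)+
    also have "\<dots> = k\<^sup>2 * integral {d..b} (\<lambda>x. (norm (g x))\<^sup>2)" by simp
    also have "\<dots> \<le> k\<^sup>2 * B"
      by (intro mult_left_mono order_trans[OF integral_mono_upper[OF cg] B]) (auto simp: d_def)
    finally have "integral {d..b} (\<lambda>x. (norm (f x))\<^sup>2) \<le> k\<^sup>2 * B" .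
    moreover have "integral {0..b} (\<lambda>x. (norm (f x))\<^sup>2) = integral {0..d} (\<lambda>x. (norm (f x))\<^sup>2) + integral {d..b} (\<lambda>x. (norm (f x))\<^sup>2)"
      by (rule integral_split[OF cf]) (use False in \<open>auto simp: d_def\<close>)
    ultimately show ?thesis by simp
  qed
  then show ?thesis unfolding L2_right_def by blast
qed

text \<open>A beta integral, and the origin of the constants 30 below.\<close>

lemma has_integral_square_bump:
  "((\<lambda>s. ((s - x) * (x + 1 - s))\<^sup>2) has_integral (1/30)) {x..x + 1}" for x :: real
proof -
  define F where "F s = (s - x)^3/3 - (s - x)^4/2 + (s - x)^5/5" for s
  have "((\<lambda>s. ((s - x) * (x + 1 - s))\<^sup>2) has_integral (F (x + 1) - F x)) {x..x + 1}"
  proof (rule fundamental_theorem_of_calculus)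
    fix s assume "s \<in> {x..x + 1}"
    have "(F has_real_derivative ((s - x) * (x + 1 - s))\<^sup>2) (at s)"
      unfolding F_def by (auto intro!: derivative_eq_intros simp: eval_nat_numeral field_simps)
    then show "(F has_vector_derivative ((s - x) * (x + 1 - s))\<^sup>2) (at s within {x..x + 1})"
      using has_real_derivative_iff_has_vector_derivative has_vector_derivative_at_within by blast
  qed simp
  then show ?thesis by (simp add: F_def)
qed

text \<open>Here a stands for 1 / p and Q for q - z w. The spectral parameter is absorbed into the
  potential, which is therefore complex, and one bound K serves for both coefficients.\<close>

locale sl_coeff =
  fixes a :: "real \<Rightarrow> real" and Q :: "real \<Rightarrow> complex" and a0 K :: real
  assumes a_cont: "continuous_on UNIV a" and Q_cont: "continuous_on UNIV Q"
    and a0: "a0 > 0" and a_ge: "\<And>x. a0 \<le> a x" and a_le: "\<And>x. a x \<le> K" and Q_le: "\<And>x. norm (Q x) \<le> K"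
begin

text \<open>The system for \<open>f\<close> and the quasi-derivative \<open>h = p f'\<close>, where \<open>a = 1 / p\<close>.\<close>

definition inhom :: "(real \<Rightarrow> complex) \<Rightarrow> (real \<Rightarrow> complex) \<Rightarrow> (real \<Rightarrow> complex) \<Rightarrow> bool" where
  "inhom r f h \<longleftrightarrow> (\<forall>x. (f has_vector_derivative of_real (a x) * h x) (at x)) \<and>
     (\<forall>x. (h has_vector_derivative Q x * f x - r x) (at x))"

abbreviation "sol \<equiv> inhom (\<lambda>x. 0)"

lemma K: "K > 0" using a0 a_ge[of 0] a_le[of 0] by linarith

lemma inhomD:
  assumes "inhom r f h"
  shows "(f has_vector_derivative of_real (a x) * h x) (at x)"
    "(h has_vector_derivative Q x * f x - r x) (at x)"
  using assms unfolding inhom_def by auto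

lemma inhom_cont:
  assumes "inhom r f h"
  shows "continuous_on UNIV f" "continuous_on UNIV h"
  by (intro continuous_at_imp_continuous_on ballI, rule has_vector_derivative_continuous, rule inhomD[OF assms])+

lemma inhom_diff:
  assumes "inhom r f h" "inhom r' f' h'"
  shows "inhom (\<lambda>x. r x - c * r' x) (\<lambda>x. f x - c * f' x) (\<lambda>x. h x - c * h' x)"
  unfolding inhom_def
proof (intro conjI allI)
  fix x
  show "((\<lambda>x. f x - c * f' x) has_vector_derivative of_real (a x) * (h x - c * h' x)) (at x)"
    using has_vector_derivative_diff[OF inhomD(1)[OF assms(1), of x] has_vector_derivative_mult_right[OF inhomD(1)[OF assms(2), of x], where a = c]]
    by (simp add: algebra_simps)
  show "((\<lambda>x. h x - c * h' x) has_vector_derivative Q x * (f x - c * f' x) - (r x - c * r' x)) (at x)"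
    using has_vector_derivative_diff[OF inhomD(2)[OF assms(1), of x] has_vector_derivative_mult_right[OF inhomD(2)[OF assms(2), of x], where a = c]]
    by (simp add: algebra_simps)
qed

lemma sol_diff: "sol f h \<Longrightarrow> sol f' h' \<Longrightarrow> sol (\<lambda>x. f x - c * f' x) (\<lambda>x. h x - c * h' x)"
  using inhom_diff[of "\<lambda>x. 0" f h "\<lambda>x. 0" f' h' c] by simp

definition data :: "(real \<Rightarrow> complex) \<Rightarrow> (real \<Rightarrow> complex) \<Rightarrow> real \<Rightarrow> real" where
  "data f h x = (norm (f x))\<^sup>2 + (norm (h x))\<^sup>2"

lemma data_nonneg: "data f h x \<ge> 0" by (simp add: data_def)

lemma data_cont: "continuous_on UNIV f \<Longrightarrow> continuous_on UNIV h \<Longrightarrow> continuous_on UNIV (data f h)"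
  unfolding data_def by (intro continuous_intros)

text \<open>The derivative is at most \<open>4 * K * norm (f s) * norm (h s)\<close>, hence at most
  2 K times the data. The source has to vanish only on the given interval, so that the bound applies
  outside its support.\<close>

lemma data_gronwall_on:
  assumes inh: "inhom r f h" and r: "\<And>s. s \<in> {c..d} \<Longrightarrow> r s = 0" and xy: "x \<in> {c..d}" "y \<in> {c..d}"
  shows "data f h y \<le> exp (2 * K * \<bar>y - x\<bar>) * data f h x"
proof (rule exp_growth_bound[OF _ _ xy])
  fix s assume s: "s \<in> {c..d}"
  show "(data f h has_real_derivative 2 * Re (cnj (f s) * (of_real (a s) * h s)) + 2 * Re (cnj (h s) * (Q s * f s))) (at s)"
    unfolding data_def using inhomD[OF inh, of s] r[OF s]
    by (intro DERIV_add has_real_derivative_norm_square) auto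
  have "norm (cnj (f s) * (of_real (a s) * h s)) \<le> K * (norm (f s) * norm (h s))"
    using a_ge[of s] mult_right_mono[OF a_le[of s], of "norm (f s) * norm (h s)"] a0 by (simp add: norm_mult mult_ac)
  then have 1: "\<bar>Re (cnj (f s) * (of_real (a s) * h s))\<bar> \<le> K * (norm (f s) * norm (h s))"
    using abs_Re_le_cmod order_trans by blast
  have "norm (cnj (h s) * (Q s * f s)) \<le> K * (norm (f s) * norm (h s))"
    using mult_right_mono[OF Q_le[of s], of "norm (f s) * norm (h s)"] by (simp add: norm_mult mult_ac)
  then have 2: "\<bar>Re (cnj (h s) * (Q s * f s))\<bar> \<le> K * (norm (f s) * norm (h s))"
    using abs_Re_le_cmod order_trans by blast
  have "2 * (norm (f s) * norm (h s)) \<le> data f h s"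
    unfolding data_def using sum_squares_bound[of "norm (f s)" "norm (h s)"] by simp
  then have "K * (2 * (norm (f s) * norm (h s))) \<le> K * data f h s" using K by (intro mult_left_mono) auto
  then show "\<bar>2 * Re (cnj (f s) * (of_real (a s) * h s)) + 2 * Re (cnj (h s) * (Q s * f s))\<bar> \<le> 2 * K * data f h s"
    using 1 2 by linarith
qed

lemma data_gronwall: "sol f h \<Longrightarrow> data f h y \<le> exp (2 * K * \<bar>y - x\<bar>) * data f h x"
  by (rule data_gronwall_on[of "\<lambda>x. 0" f h "min x y" "max x y"]) auto

lemma data_pos:
  assumes "sol f h" "data f h x0 \<noteq> 0"
  shows "data f h x > 0"
proof (rule ccontr)
  assume "\<not> ?thesis"
  then have "data f h x = 0" using data_nonneg[of f h x] by linarith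
  with data_gronwall[OF assms(1), of x0 x] data_nonneg[of f h x0] assms(2) show False by simp
qed

lemma data_eq_0: "data f h x = 0 \<longleftrightarrow> f x = 0 \<and> h x = 0"
  unfolding data_def by (simp add: add_nonneg_eq_0_iff)

lemma inhom_unique_on:
  assumes "inhom r f h" "inhom r' f' h'" and r: "\<And>s. s \<in> {c..d} \<Longrightarrow> r s = r' s"
    and x: "x \<in> {c..d}" "f x = f' x" "h x = h' x" and y: "y \<in> {c..d}"
  shows "f y = f' y" "h y = h' y"
proof -
  have "data (\<lambda>x. f x - 1 * f' x) (\<lambda>x. h x - 1 * h' x) y \<le> exp (2 * K * \<bar>y - x\<bar>) * data (\<lambda>x. f x - 1 * f' x) (\<lambda>x. h x - 1 * h' x) x"
    by (rule data_gronwall_on[OF inhom_diff[OF assms(1,2)] _ x(1) y]) (simp add: r)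
  moreover have "data (\<lambda>x. f x - 1 * f' x) (\<lambda>x. h x - 1 * h' x) x = 0" unfolding data_eq_0 using x by simp
  ultimately have "data (\<lambda>x. f x - 1 * f' x) (\<lambda>x. h x - 1 * h' x) y = 0"
    using data_nonneg[of "\<lambda>x. f x - 1 * f' x" "\<lambda>x. h x - 1 * h' x" y] by simp
  then show "f y = f' y" "h y = h' y" unfolding data_eq_0 by auto
qed

definition wr :: "(real \<Rightarrow> complex) \<Rightarrow> (real \<Rightarrow> complex) \<Rightarrow> (real \<Rightarrow> complex) \<Rightarrow> (real \<Rightarrow> complex) \<Rightarrow> real \<Rightarrow> complex" where
  "wr f h f' h' x = f x * h' x - h x * f' x"

text \<open>Lagrange's identity, with a source in the second equation.\<close>

lemma wr_deriv:
  assumes "sol f h" "inhom r f' h'"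
  shows "(wr f h f' h' has_vector_derivative - f x * r x) (at x)"
  unfolding wr_def
  using has_vector_derivative_diff[OF has_vector_derivative_mult[OF inhomD(1)[OF assms(1), of x] inhomD(2)[OF assms(2), of x]]
      has_vector_derivative_mult[OF inhomD(2)[OF assms(1), of x] inhomD(1)[OF assms(2), of x]]]
  by (simp add: algebra_simps)

lemma wr_const:
  assumes "sol f h" "sol f' h'"
  shows "wr f h f' h' x = wr f h f' h' y"
proof -
  have "(wr f h f' h' has_vector_derivative 0) (at x within UNIV)" for x
    using wr_deriv[OF assms, of x] by simp
  then obtain c where "\<And>x. x \<in> UNIV \<Longrightarrow> wr f h f' h' x = c"
    using has_vector_derivative_zero_constant[of UNIV "wr f h f' h'"] by auto
  then show ?thesis by simp
qed

text \<open>The two pairs are taken at different points because the bound is also applied to one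
  solution against its own translate.\<close>

lemma norm_wr_le: "norm (f x * h' y - h x * f' y) \<le> data f h x + data f' h' y"
proof -
  have "norm (f x * h' y - h x * f' y) \<le> norm (f x) * norm (h' y) + norm (h x) * norm (f' y)"
    by (rule order_trans[OF norm_triangle_ineq4]) (simp add: norm_mult)
  moreover have "2 * (norm (f x) * norm (h' y)) \<le> (norm (f x))\<^sup>2 + (norm (h' y))\<^sup>2"
    using sum_squares_bound[of "norm (f x)" "norm (h' y)"] by simp
  moreover have "2 * (norm (h x) * norm (f' y)) \<le> (norm (h x))\<^sup>2 + (norm (f' y))\<^sup>2"
    using sum_squares_bound[of "norm (h x)" "norm (f' y)"] by simp
  moreover have "0 \<le> data f h x" "0 \<le> data f' h' y" by (rule data_nonneg)+
  ultimately show ?thesis unfolding data_def by linarith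
qed

text \<open>Caccioppoli's inequality: test the equation with \<open>\<eta>\<^sup>2 f\<close>, where \<open>\<eta>\<close> vanishes at
  both ends of the interval.\<close>

lemma data_le_integral:
  obtains C where "C > 0" "\<And>f h x. sol f h \<Longrightarrow> data f h x \<le> C * integral {x..x + 1} (\<lambda>s. (norm (f s))\<^sup>2)"
proof -
  define C1 where "C1 = 2 / a0 + K"
  define C2 where "C2 = 1 + 2 * C1 / a0"
  have C1: "C1 > 0" using a0 K by (simp add: C1_def add_pos_pos)
  have C2: "C2 > 0" using C1 a0 by (simp add: C2_def add_pos_pos)
  have "data f h x \<le> 30 * exp (2 * K) * C2 * integral {x..x + 1} (\<lambda>s. (norm (f s))\<^sup>2)" if s: "sol f h" for f h x
  proof -
    define \<eta> where "\<eta> s = (s - x) * (x + 1 - s)" for s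
    define E where "E s = (\<eta> s)\<^sup>2 * Re (cnj (f s) * h s)" for s
    define E' where "E' s = 2 * \<eta> s * (1 - 2 * (s - x)) * Re (cnj (f s) * h s) + (\<eta> s)\<^sup>2 * (a s * (norm (h s))\<^sup>2 + Re (Q s) * (norm (f s))\<^sup>2)" for s
    note cf = inhom_cont(1)[OF s] and ch = inhom_cont(2)[OF s]
    have "(E has_vector_derivative E' t) (at t within S)" for t S
    proof -
      have "((\<lambda>s. cnj (f s)) has_vector_derivative cnj (of_real (a t) * h t)) (at t)"
        by (rule bounded_linear.has_vector_derivative[OF bounded_linear_cnj inhomD(1)[OF s]])
      then have "((\<lambda>s. cnj (f s) * h s) has_vector_derivative cnj (f t) * (Q t * f t) + cnj (of_real (a t) * h t) * h t) (at t)"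
        using has_vector_derivative_mult[OF _ inhomD(2)[OF s, of t]] by simp
      from bounded_linear.has_vector_derivative[OF bounded_linear_Re this]
      have 1: "((\<lambda>s. Re (cnj (f s) * h s)) has_real_derivative Re (cnj (f t) * (Q t * f t) + cnj (of_real (a t) * h t) * h t)) (at t)"
        by (simp add: has_real_derivative_iff_has_vector_derivative)
      have "Re (cnj (f t) * (Q t * f t) + cnj (of_real (a t) * h t) * h t) = a t * (norm (h t))\<^sup>2 + Re (Q t) * (norm (f t))\<^sup>2"
        unfolding cmod_power2 by (simp add: algebra_simps power2_eq_square)
      with 1 have 2: "((\<lambda>s. Re (cnj (f s) * h s)) has_real_derivative a t * (norm (h t))\<^sup>2 + Re (Q t) * (norm (f t))\<^sup>2) (at t)" by simp
      have 3: "((\<lambda>s. (\<eta> s)\<^sup>2) has_real_derivative 2 * \<eta> t * (1 - 2 * (t - x))) (at t)"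
        unfolding \<eta>_def by (auto intro!: derivative_eq_intros simp: algebra_simps)
      have "(E has_real_derivative E' t) (at t)"
        unfolding E_def E'_def using DERIV_mult[OF 3 2] by (simp add: algebra_simps)
      then show ?thesis using has_real_derivative_iff_has_vector_derivative has_vector_derivative_at_within by blast
    qed
    then have "(E' has_integral (E (x + 1) - E x)) {x..x + 1}"
      by (intro fundamental_theorem_of_calculus) auto
    then have E'int: "(E' has_integral 0) {x..x + 1}" by (simp add: E_def \<eta>_def)
    have \<eta>int: "((\<lambda>s. (\<eta> s)\<^sup>2) has_integral (1/30)) {x..x + 1}"
      unfolding \<eta>_def by (rule has_integral_square_bump)
    \<comment> \<open>By Gronwall the data at x are at most \<open>exp (2 * K)\<close> times the
      data at s, so integration against the squared cutoff recovers a pointwise value. The term with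
      \<open>E'\<close> integrates to 0.\<close>
    have pw: "exp (- (2 * K)) * data f h x * (\<eta> s)\<^sup>2 \<le> 2 / a0 * E' s + C2 * (norm (f s))\<^sup>2" if sx: "s \<in> {x..x + 1}" for s
    proof -
      have \<eta>01: "0 \<le> \<eta> s" "\<eta> s \<le> 1" "\<bar>1 - 2 * (s - x)\<bar> \<le> 1"
        using sx unfolding \<eta>_def by (auto intro!: mult_nonneg_nonneg mult_le_one)
      then have \<eta>sq: "(\<eta> s)\<^sup>2 \<le> 1" by (simp add: power_le_one)
      define F H where "F = norm (f s)" and "H = norm (h s)"
      have FH: "F \<ge> 0" "H \<ge> 0" by (simp_all add: F_def H_def)
      have "data f h x \<le> exp (2 * K * \<bar>x - s\<bar>) * data f h s" by (rule data_gronwall[OF \<open>sol f h\<close>])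
      also have "\<dots> \<le> exp (2 * K) * data f h s"
      proof (rule mult_right_mono[OF _ data_nonneg])
        have "2 * K * \<bar>x - s\<bar> \<le> 2 * K * 1" using sx K by (intro mult_left_mono) auto
        then show "exp (2 * K * \<bar>x - s\<bar>) \<le> exp (2 * K)" by simp
      qed
      finally have "exp (- (2 * K)) * data f h x \<le> exp (- (2 * K)) * (exp (2 * K) * data f h s)"
        by (rule mult_left_mono) simp
      then have "exp (- (2 * K)) * data f h x \<le> data f h s" by (simp add: mult.assoc[symmetric] exp_add[symmetric])
      then have "exp (- (2 * K)) * data f h x * (\<eta> s)\<^sup>2 \<le> data f h s * (\<eta> s)\<^sup>2" by (rule mult_right_mono) simp
      also have "\<dots> = (\<eta> s)\<^sup>2 * F\<^sup>2 + (\<eta> s)\<^sup>2 * H\<^sup>2" by (simp add: data_def F_def H_def algebra_simps)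
      also have "\<dots> \<le> 1 * F\<^sup>2 + (\<eta> s)\<^sup>2 * H\<^sup>2" by (intro add_right_mono mult_right_mono \<eta>sq) simp
      finally have A: "exp (- (2 * K)) * data f h x * (\<eta> s)\<^sup>2 \<le> F\<^sup>2 + (\<eta> s)\<^sup>2 * H\<^sup>2" by simp
      have "\<bar>Re (cnj (f s) * h s)\<bar> \<le> F * H"
        using abs_Re_le_cmod[of "cnj (f s) * h s"] by (simp add: norm_mult F_def H_def)
      then have "\<bar>(2 * \<eta> s) * (1 - 2 * (s - x)) * Re (cnj (f s) * h s)\<bar> \<le> (2 * \<eta> s) * 1 * (F * H)"
        unfolding abs_mult using \<eta>01 FH by (intro mult_mono) auto
      then have "2 * \<eta> s * (1 - 2 * (s - x)) * Re (cnj (f s) * h s) \<ge> - (2 * F * (\<eta> s * H))" by (simp add: algebra_simps abs_le_iff)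
      \<comment> \<open>Young's inequality, weighted so that the mixed term uses up only half of the
        positive term with \<open>a0\<close>; what multiplies \<open>F\<^sup>2\<close> is collected
        in C1.\<close>
      moreover have "2 * F * (\<eta> s * H) \<le> 2 / a0 * F\<^sup>2 + a0 / 2 * (\<eta> s * H)\<^sup>2"
      proof -
        have "0 \<le> (2 * F - a0 * (\<eta> s * H))\<^sup>2 / (2 * a0)" using a0 by simp
        also have "\<dots> = 2 / a0 * F\<^sup>2 + a0 / 2 * (\<eta> s * H)\<^sup>2 - 2 * F * (\<eta> s * H)"
          using a0 by (simp add: power2_eq_square field_simps)
        finally show ?thesis by simp
      qed
      moreover have "(\<eta> s)\<^sup>2 * (a s * H\<^sup>2 + Re (Q s) * F\<^sup>2) \<ge> a0 * (\<eta> s * H)\<^sup>2 - K * F\<^sup>2"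
      proof -
        have "\<bar>Re (Q s)\<bar> \<le> K" using abs_Re_le_cmod Q_le order_trans by blast
        then have "- K \<le> Re (Q s)" by simp
        then have "- K * F\<^sup>2 \<le> Re (Q s) * F\<^sup>2" by (intro mult_right_mono) simp_all
        then have "(\<eta> s)\<^sup>2 * (- K * F\<^sup>2) \<le> (\<eta> s)\<^sup>2 * (Re (Q s) * F\<^sup>2)" by (intro mult_left_mono) simp_all
        moreover have "(\<eta> s)\<^sup>2 * (K * F\<^sup>2) \<le> 1 * (K * F\<^sup>2)" using \<eta>sq K by (intro mult_right_mono) auto
        moreover have "(\<eta> s)\<^sup>2 * (a0 * H\<^sup>2) \<le> (\<eta> s)\<^sup>2 * (a s * H\<^sup>2)" using a_ge by (intro mult_left_mono mult_right_mono) auto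
        ultimately show ?thesis by (simp add: algebra_simps power_mult_distrib)
      qed
      ultimately have "E' s \<ge> a0 / 2 * ((\<eta> s)\<^sup>2 * H\<^sup>2) - C1 * F\<^sup>2"
        unfolding E'_def F_def[symmetric] H_def[symmetric] C1_def power_mult_distrib by (simp add: algebra_simps)
      then have "2 / a0 * E' s \<ge> 2 / a0 * (a0 / 2 * ((\<eta> s)\<^sup>2 * H\<^sup>2) - C1 * F\<^sup>2)" using a0 by (intro mult_left_mono) auto
      also have "2 / a0 * (a0 / 2 * ((\<eta> s)\<^sup>2 * H\<^sup>2) - C1 * F\<^sup>2) = (\<eta> s)\<^sup>2 * H\<^sup>2 - 2 * C1 / a0 * F\<^sup>2"
        using a0 by (simp add: field_simps)
      finally show ?thesis using A unfolding C2_def F_def[symmetric] by (simp add: algebra_simps)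
    qed
    have fint: "((\<lambda>s. (norm (f s))\<^sup>2) has_integral integral {x..x + 1} (\<lambda>s. (norm (f s))\<^sup>2)) {x..x + 1}"
      by (intro integrable_integral integrable_cont cont_norm_square cf)
    have "exp (- (2 * K)) * data f h x * (1/30) \<le> 2 / a0 * 0 + C2 * integral {x..x + 1} (\<lambda>s. (norm (f s))\<^sup>2)"
      by (rule has_integral_le[OF has_integral_mult_right[OF \<eta>int] has_integral_add[OF has_integral_mult_right[OF E'int] has_integral_mult_right[OF fint]] pw])
    then have "30 * exp (2 * K) * (exp (- (2 * K)) * data f h x * (1/30)) \<le> 30 * exp (2 * K) * (C2 * integral {x..x + 1} (\<lambda>s. (norm (f s))\<^sup>2))"
      by (intro mult_left_mono) auto
    moreover have "30 * exp (2 * K) * (exp (- (2 * K)) * data f h x * (1/30)) = data f h x"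
      by (simp add: exp_minus)
    ultimately show ?thesis by linarith
  qed
  then show ?thesis using that[of "30 * exp (2 * K) * C2"] C2 by auto
qed

lemma integral_data_unit:
  assumes "sol f h"
  shows "integral {x..x + 1} (data f h) \<le> exp (2 * K) * data f h x"
proof -
  have "integral {x..x + 1} (data f h) \<le> integral {x..x + 1} (\<lambda>s. exp (2 * K) * data f h x)"
  proof (rule integral_le)
    show "data f h integrable_on {x..x + 1}" by (intro integrable_cont data_cont inhom_cont[OF assms])
    fix s assume s: "s \<in> {x..x + 1}"
    have "data f h s \<le> exp (2 * K * \<bar>s - x\<bar>) * data f h x" by (rule data_gronwall[OF assms])
    also have "\<dots> \<le> exp (2 * K) * data f h x"
    proof (rule mult_right_mono[OF _ data_nonneg])
      have "2 * K * \<bar>s - x\<bar> \<le> 2 * K * 1" using s K by (intro mult_left_mono) auto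
      then show "exp (2 * K * \<bar>s - x\<bar>) \<le> exp (2 * K)" by simp
    qed
    finally show "data f h s \<le> exp (2 * K) * data f h x" .
  qed (rule integrable_const_ivl)
  then show ?thesis by simp
qed

lemma integral_data_le:
  obtains C where "C > 0" "\<And>f h x n. sol f h \<Longrightarrow>
    integral {x..x + real n} (data f h) \<le> C * integral {x..x + real n} (\<lambda>s. (norm (f s))\<^sup>2)"
proof -
  obtain C where C: "C > 0" "\<And>f h x. sol f h \<Longrightarrow> data f h x \<le> C * integral {x..x + 1} (\<lambda>s. (norm (f s))\<^sup>2)"
    by (rule data_le_integral) blast
  have "integral {x..x + real n} (data f h) \<le> exp (2 * K) * C * integral {x..x + real n} (\<lambda>s. (norm (f s))\<^sup>2)"
    if s: "sol f h" for f h x n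
  proof (induction n)
    case (Suc n)
    define y where "y = x + real n"
    have y: "x + real (Suc n) = y + 1" "x \<le> y" "y \<le> y + 1" by (auto simp: y_def)
    have "integral {y..y + 1} (data f h) \<le> exp (2 * K) * data f h y" by (rule integral_data_unit[OF s])
    also have "\<dots> \<le> exp (2 * K) * (C * integral {y..y + 1} (\<lambda>s. (norm (f s))\<^sup>2))"
      by (intro mult_left_mono C(2)[OF s]) simp
    finally have "integral {y..y + 1} (data f h) \<le> exp (2 * K) * C * integral {y..y + 1} (\<lambda>s. (norm (f s))\<^sup>2)" by simp
    with Suc show ?case
      unfolding y(1) integral_split[OF data_cont[OF inhom_cont[OF s]] y(2,3)]
        integral_split[OF cont_norm_square[OF inhom_cont(1)[OF s]] y(2,3)] y_def[symmetric]
      by (simp add: distrib_left)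
  qed simp
  then show ?thesis using that[of "exp (2 * K) * C"] C(1) by auto
qed

lemma L2_right_data:
  assumes s: "sol f h" and L2: "L2_right f"
  obtains B where "\<And>x y. c \<le> x \<Longrightarrow> integral {x..y} (data f h) \<le> B"
proof -
  obtain B where B: "\<And>b. integral {0..b} (\<lambda>x. (norm (f x))\<^sup>2) \<le> B" using L2 unfolding L2_right_def by blast
  obtain C where C: "C > 0" "\<And>f h x n. sol f h \<Longrightarrow>
    integral {x..x + real n} (data f h) \<le> C * integral {x..x + real n} (\<lambda>s. (norm (f s))\<^sup>2)"
    by (rule integral_data_le) blast
  note cd = data_cont[OF inhom_cont[OF s]]
  have pos: "integral {0..y} (data f h) \<le> C * B" for y
  proof -
    obtain n where n: "y \<le> real n" using real_arch_simple by blast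
    have "integral {0..y} (data f h) \<le> integral {0..0 + real n} (data f h)"
      by (rule integral_mono_upper[OF cd data_nonneg]) (use n in auto)
    also have "\<dots> \<le> C * integral {0..0 + real n} (\<lambda>s. (norm (f s))\<^sup>2)" by (rule C(2)[OF s])
    also have "\<dots> \<le> C * B" by (rule mult_left_mono[OF B]) (use C in simp)
    finally show ?thesis .
  qed
  define c' where "c' = min c 0"
  have "integral {x..y} (data f h) \<le> integral {c'..0} (data f h) + C * B" if "c \<le> x" for x y
  proof -
    have "integral {x..y} (data f h) \<le> integral {c'..max y 0} (data f h)"
      by (rule integral_mono_upper[OF cd data_nonneg]) (use that in \<open>auto simp: c'_def\<close>)
    also have "\<dots> = integral {c'..0} (data f h) + integral {0..max y 0} (data f h)"
      by (rule integral_split[OF cd]) (auto simp: c'_def)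
    finally show ?thesis using pos[of "max y 0"] by linarith
  qed
  then show ?thesis using that by blast
qed

text \<open>A bound with bounded integrals gives smallness at some point rather than in the limit,
  and one point is enough for Wronskian arguments.\<close>

lemma eventually_small_of_L2:
  fixes V :: "real \<Rightarrow> complex" and u :: "real \<Rightarrow> real"
  assumes V: "continuous_on UNIV V" and le: "\<And>x. x \<ge> 0 \<Longrightarrow> norm (V x) \<le> u x"
    and u: "continuous_on UNIV u" "\<And>y. integral {0..y} u \<le> B" and e: "e > 0"
  obtains y where "y \<ge> 0" "norm (V y) < e"
proof (rule ccontr)
  assume "\<not> thesis"
  then have big: "\<And>y. y \<ge> 0 \<Longrightarrow> e \<le> norm (V y)" using that by (meson not_le)
  have "e * y \<le> B" if "y \<ge> 0" for y
  proof -
    have "integral {0..y} (\<lambda>x. e) \<le> integral {0..y} u"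
      by (rule integral_le) (use big le in \<open>auto intro!: integrable_cont u(1) intro: order_trans\<close>)
    then show ?thesis using u(2)[of y] that by (simp add: mult.commute)
  qed
  moreover have "e * (\<bar>B\<bar> / e + 1) = \<bar>B\<bar> + e" "\<bar>B\<bar> / e + 1 \<ge> 0" using e by (auto simp: field_simps)
  ultimately have "\<bar>B\<bar> + e \<le> B" by metis
  with e show False by linarith
qed

text \<open>The limit point property at +infinity: the Wronskian is constant, yet dominated by the
  data of two square integrable solutions, whose integrals stay bounded.\<close>

lemma wr_zero_of_L2_right:
  assumes "sol f h" "L2_right f" "sol f' h'" "L2_right f'"
  shows "wr f h f' h' x = 0"
proof (rule ccontr)
  assume nz: "wr f h f' h' x \<noteq> 0"
  obtain B where B: "\<And>x y. 0 \<le> x \<Longrightarrow> integral {x..y} (data f h) \<le> B"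
    by (rule L2_right_data[OF assms(1,2)]) blast
  obtain B' where B': "\<And>x y. 0 \<le> x \<Longrightarrow> integral {x..y} (data f' h') \<le> B'"
    by (rule L2_right_data[OF assms(3,4)]) blast
  note c1 = data_cont[OF inhom_cont[OF assms(1)]] and c2 = data_cont[OF inhom_cont[OF assms(3)]]
  obtain y where "y \<ge> 0" "norm (wr f h f' h' x) < norm (wr f h f' h' x)"
  proof (rule eventually_small_of_L2[of "\<lambda>_. wr f h f' h' x" "\<lambda>s. data f h s + data f' h' s" "B + B'" "norm (wr f h f' h' x)"])
    show "norm (wr f h f' h' x) \<le> data f h s + data f' h' s" for s
      unfolding wr_const[OF assms(1,3), of x s] unfolding wr_def by (rule norm_wr_le)
    show "integral {0..y} (\<lambda>s. data f h s + data f' h' s) \<le> B + B'" for y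
      using B[of 0 y] B'[of 0 y] by (simp add: integral_add integrable_cont c1 c2)
  qed (use nz c1 c2 in \<open>auto intro!: continuous_intros\<close>)
  then show False by simp
qed

end

text \<open>The oriented integral from x0; the case distinction is there because
  \<open>integral {x0..x} F\<close> is 0 for x < x0.\<close>

definition primitive :: "real \<Rightarrow> (real \<Rightarrow> 'a::banach) \<Rightarrow> real \<Rightarrow> 'a" where
  "primitive x0 F x = (if x0 \<le> x then integral {x0..x} F else - integral {x..x0} F)"

lemma primitive_eq_diff:
  assumes "continuous_on UNIV F" "c \<le> x0" "c \<le> x"
  shows "primitive x0 F x = integral {c..x} F - integral {c..x0} F"
  using assms integral_split[of F c x0 x] integral_split[of F c x x0]
  by (auto simp: primitive_def)

lemma primitive_has_derivative:
  assumes F: "continuous_on UNIV F"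
  shows "(primitive x0 F has_vector_derivative F x) (at x)"
proof -
  define c d where "c = min x0 x - 1" and "d = x + 1"
  have cd: "c < x" "x < d" by (auto simp: c_def d_def)
  have "((\<lambda>u. integral {c..u} F) has_vector_derivative F x) (at x within {c..d})"
    by (rule integral_has_vector_derivative[OF continuous_on_subset[OF F]]) (use cd in auto)
  then have "((\<lambda>u. integral {c..u} F) has_vector_derivative F x) (at x)"
    unfolding at_within_Icc_at[OF cd] .
  then have "((\<lambda>u. integral {c..u} F - integral {c..x0} F) has_vector_derivative F x) (at x)"
    using has_vector_derivative_diff[OF _ has_vector_derivative_const] by fastforce
  then show ?thesis
    by (rule has_vector_derivative_transform_within_open[of _ _ _ "{c<..<d}"])
      (use cd primitive_eq_diff[OF F, of c x0] in \<open>auto simp: c_def\<close>)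
qed

lemma primitive_continuous: "continuous_on UNIV F \<Longrightarrow> continuous_on UNIV (primitive x0 F)"
  by (intro continuous_at_imp_continuous_on ballI, rule has_vector_derivative_continuous, rule primitive_has_derivative)

lemma primitive_diff:
  assumes "continuous_on UNIV F" "continuous_on UNIV G"
  shows "primitive x0 (\<lambda>s. F s - G s) x = primitive x0 F x - primitive x0 G x"
  using assms by (simp add: primitive_def integral_diff integrable_cont)

text \<open>Integration reproduces the exponential weight and gains a factor 1 / L. This gain makes
  the Picard operator contract.\<close>

lemma norm_primitive_le_exp:
  fixes F :: "real \<Rightarrow> 'a::banach"
  assumes F: "continuous_on UNIV F" and L: "L > 0" and bd: "\<And>s. norm (F s) \<le> M * exp (L * \<bar>s - x0\<bar>)"
  shows "norm (primitive x0 F x) \<le> M / L * exp (L * \<bar>x - x0\<bar>)"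
proof -
  have M: "M \<ge> 0" using order_trans[OF norm_ge_zero bd[of x0]] by simp
  show ?thesis
  proof (cases "x0 \<le> x")
    case True
    have hi: "((\<lambda>s. M * exp (L * (s - x0))) has_integral (M / L * exp (L * (x - x0)) - M / L * exp (L * (x0 - x0)))) {x0..x}"
    proof (rule fundamental_theorem_of_calculus[OF True])
      fix s
      have "((\<lambda>s. M / L * exp (L * (s - x0))) has_real_derivative M * exp (L * (s - x0))) (at s)"
        using L by (auto intro!: derivative_eq_intros)
      then show "((\<lambda>s. M / L * exp (L * (s - x0))) has_vector_derivative M * exp (L * (s - x0))) (at s within {x0..x})"
        using has_real_derivative_iff_has_vector_derivative has_vector_derivative_at_within by blast
    qed
    have "norm (integral {x0..x} F) \<le> integral {x0..x} (\<lambda>s. M * exp (L * (s - x0)))"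
    proof (rule Henstock_Kurzweil_Integration.integral_norm_bound_integral)
      show "norm (F s) \<le> M * exp (L * (s - x0))" if "s \<in> {x0..x}" for s using bd[of s] that by simp
    qed (use hi integrable_cont[OF F] in auto)
    also have "\<dots> \<le> M / L * exp (L * \<bar>x - x0\<bar>)"
      unfolding integral_unique[OF hi] using M L True by simp
    finally show ?thesis using True by (simp add: primitive_def)
  next
    case False
    then have le: "x \<le> x0" by simp
    have hi: "((\<lambda>s. M * exp (L * (x0 - s))) has_integral (- (M / L) * exp (L * (x0 - x0)) - (- (M / L) * exp (L * (x0 - x))))) {x..x0}"
    proof (rule fundamental_theorem_of_calculus[OF le])
      fix s
      have "((\<lambda>s. - (M / L) * exp (L * (x0 - s))) has_real_derivative M * exp (L * (x0 - s))) (at s)"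
        using L by (auto intro!: derivative_eq_intros)
      then show "((\<lambda>s. - (M / L) * exp (L * (x0 - s))) has_vector_derivative M * exp (L * (x0 - s))) (at s within {x..x0})"
        using has_real_derivative_iff_has_vector_derivative has_vector_derivative_at_within by blast
    qed
    have "norm (integral {x..x0} F) \<le> integral {x..x0} (\<lambda>s. M * exp (L * (x0 - s)))"
    proof (rule Henstock_Kurzweil_Integration.integral_norm_bound_integral)
      show "norm (F s) \<le> M * exp (L * (x0 - s))" if "s \<in> {x..x0}" for s using bd[of s] that by simp
    qed (use hi integrable_cont[OF F] in auto)
    also have "\<dots> \<le> M / L * exp (L * \<bar>x - x0\<bar>)"
      unfolding integral_unique[OF hi] using M L False by simp
    finally show ?thesis using False by (simp add: primitive_def)
  qed
qed

context sl_coeff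
begin

text \<open>The Picard operator is a contraction for the supremum norm weighted by
  \<open>exp (- L \<bar>x - x0\<bar>)\<close>; the fixed point is global.\<close>

lemma sol_exists:
  obtains f h where "sol f h" "f x0 = c" "h x0 = d"
proof -
  \<comment> \<open>The coefficient map \<open>A s\<close> has norm at most 2 K, so the contraction
    factor is 2 K / L = 1/2.\<close>
  define L where "L = 4 * K"
  have L: "L > 0" using K by (simp add: L_def)
  define y0 where "y0 = (c, d)"
  define A where "A s Y = (complex_of_real (a s) * snd Y, Q s * fst Y)" for s and Y :: "complex \<times> complex"
  define e where "e s = exp (L * \<bar>s - x0\<bar>)" for s
  \<comment> \<open>The unknown b is the solution divided by the weight e. It is multiplied by e
    before A acts, and T divides by e again, so that T acts on bounded functions.\<close>
  define G where "G b s = e s *\<^sub>R A s (apply_bcontfun b s)" for b :: "real \<Rightarrow>\<^sub>C (complex \<times> complex)" and s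
  define T where "T b x = (1 / e x) *\<^sub>R (y0 + primitive x0 (G b) x)" for b x
  have e: "e s \<ge> 1" "e s > 0" for s using L by (auto simp: e_def)
  have econt: "continuous_on UNIV e" unfolding e_def by (intro continuous_intros)
  have Anorm: "norm (A s Y) \<le> 2 * K * norm Y" for s Y
  proof -
    have "norm (A s Y) \<le> norm (complex_of_real (a s) * snd Y) + norm (Q s * fst Y)"
      unfolding A_def by (rule norm_Pair_le)
    also have "\<dots> \<le> K * norm Y + K * norm Y"
      unfolding norm_mult using a_ge[of s] a_le[of s] a0 Q_le[of s] norm_snd_le[of "snd Y" "fst Y"] norm_fst_le[of "fst Y" "snd Y"] K
      by (intro add_mono mult_mono) auto
    finally show ?thesis by simp
  qed
  have Gcont: "continuous_on UNIV (G b)" for b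
    unfolding G_def A_def using econt a_cont Q_cont by (intro continuous_intros) auto
  have Gdiff: "norm (G b s - G b' s) \<le> 2 * K * norm (b - b') * exp (L * \<bar>s - x0\<bar>)" for b b' s
  proof -
    have "G b s - G b' s = e s *\<^sub>R A s (apply_bcontfun (b - b') s)"
      unfolding G_def A_def by (simp add: prod_eq_iff scaleR_conv_of_real algebra_simps)
    then have "norm (G b s - G b' s) = e s * norm (A s (apply_bcontfun (b - b') s))"
      using e(2)[of s] by simp
    also have "\<dots> \<le> e s * (2 * K * norm (b - b'))"
      using Anorm[of s "apply_bcontfun (b - b') s"] norm_bounded[of "b - b'" s] K e(2)[of s]
      by (intro mult_left_mono) (auto intro: order_trans mult_left_mono)
    finally show ?thesis by (simp add: e_def mult_ac)
  qed
  have G0: "norm (G b s) \<le> 2 * K * norm b * exp (L * \<bar>s - x0\<bar>)" for b s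
  proof -
    have "G 0 s = 0" unfolding G_def A_def by (simp add: zero_prod_def)
    then show ?thesis using Gdiff[of b s 0] by simp
  qed
  have half: "2 * K * n / L = n / 2" for n using K by (simp add: L_def)
  have Pdiff: "norm (primitive x0 (G b) x - primitive x0 (G b') x) \<le> norm (b - b') / 2 * e x" for b b' x
    using norm_primitive_le_exp[OF continuous_on_diff[OF Gcont Gcont] L Gdiff, of b b' x]
    unfolding primitive_diff[OF Gcont Gcont] half e_def .
  have P0: "norm (primitive x0 (G b) x) \<le> norm b / 2 * e x" for b x
    using norm_primitive_le_exp[OF Gcont L G0, of b x] unfolding half e_def .
  have Tb: "T b \<in> bcontfun" for b
  proof (rule bcontfun_normI)
    show "continuous_on UNIV (T b)"
      unfolding T_def using econt e(2) primitive_continuous[OF Gcont]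
      by (intro continuous_intros) (auto simp: less_imp_neq[symmetric])
    fix x
    have "norm (T b x) = 1 / e x * norm (y0 + primitive x0 (G b) x)" using e(2)[of x] by (simp add: T_def)
    also have "\<dots> \<le> 1 / e x * (norm y0 * e x + norm b / 2 * e x)"
    proof (intro mult_left_mono order_trans[OF norm_triangle_ineq] add_mono P0)
      show "norm y0 \<le> norm y0 * e x" using e(1)[of x] mult_left_mono[of 1 "e x" "norm y0"] by simp
    qed (use e(2)[of x] in simp)
    also have "\<dots> = norm y0 + norm b / 2" using e(2)[of x] by (simp add: field_simps)
    finally show "norm (T b x) \<le> norm y0 + norm b / 2" .
  qed
  define TT where "TT b = Bcontfun (T b)" for b
  have TT: "apply_bcontfun (TT b) = T b" for b unfolding TT_def using Tb by (rule Bcontfun_inverse)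
  have "\<forall>b b'. dist (TT b) (TT b') \<le> 1/2 * dist b b'"
  proof (intro allI)
    fix b b'
    have "norm (TT b - TT b') \<le> norm (b - b') / 2"
    proof (rule norm_bound)
      fix x
      have "apply_bcontfun (TT b - TT b') x = (1 / e x) *\<^sub>R (primitive x0 (G b) x - primitive x0 (G b') x)"
        by (simp add: TT T_def algebra_simps)
      then have "norm (apply_bcontfun (TT b - TT b') x) = 1 / e x * norm (primitive x0 (G b) x - primitive x0 (G b') x)"
        using e(2)[of x] by simp
      also have "\<dots> \<le> 1 / e x * (norm (b - b') / 2 * e x)"
        using e(2)[of x] by (intro mult_left_mono Pdiff) simp
      also have "\<dots> = norm (b - b') / 2" using e(2)[of x] by simp
      finally show "norm (apply_bcontfun (TT b - TT b') x) \<le> norm (b - b') / 2" .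
    qed
    then show "dist (TT b) (TT b') \<le> 1/2 * dist b b'" by (simp add: dist_norm)
  qed
  then have "\<exists>!b. TT b = b" by (intro banach_fix_type[of "1/2"]) auto
  then obtain b where b: "TT b = b" by blast
  define Y where "Y x = y0 + primitive x0 (G b) x" for x
  have Yb: "Y x = e x *\<^sub>R apply_bcontfun b x" for x
  proof -
    have "apply_bcontfun b x = (1 / e x) *\<^sub>R Y x" using TT[of b] b by (simp add: T_def Y_def)
    then show ?thesis using e(2)[of x] by simp
  qed
  have GA: "G b x = A x (Y x)" for x unfolding G_def Yb A_def by (simp add: scaleR_conv_of_real)
  have Yd: "(Y has_vector_derivative A x (Y x)) (at x)" for x
  proof -
    have "Y = (\<lambda>x. y0 + primitive x0 (G b) x)" by (simp add: fun_eq_iff Y_def)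
    then have "(Y has_vector_derivative 0 + G b x) (at x)"
      using has_vector_derivative_add[OF has_vector_derivative_const primitive_has_derivative[OF Gcont]] by metis
    then show ?thesis unfolding GA[of x] by simp
  qed
  have "sol (\<lambda>x. fst (Y x)) (\<lambda>x. snd (Y x))"
    unfolding inhom_def
    using bounded_linear.has_vector_derivative[OF bounded_linear_fst Yd]
      bounded_linear.has_vector_derivative[OF bounded_linear_snd Yd]
    by (simp add: A_def)
  moreover have "Y x0 = (c, d)" by (simp add: Y_def y0_def primitive_def)
  ultimately show ?thesis using that by simp
qed

end

section \<open>Reflection of the line, exchanging the two ends\<close>

lemma has_vector_derivative_reflect:
  assumes "(f has_vector_derivative f') (at (- x))"
  shows "((\<lambda>x. f (- x)) has_vector_derivative - f') (at x)"
proof -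
  have "(uminus has_vector_derivative (-1::real)) (at x)"
    by (auto intro!: derivative_eq_intros)
  from vector_diff_chain_at[OF this assms] show ?thesis by (simp add: o_def)
qed

lemma continuous_on_reflect: "continuous_on UNIV f \<Longrightarrow> continuous_on UNIV (\<lambda>x::real. f (- x))"
  by (rule continuous_on_compose2[of UNIV f]) (auto intro: continuous_intros)

lemma (in sl_coeff) sl_coeff_reflect: "sl_coeff (\<lambda>x. a (- x)) (\<lambda>x. Q (- x)) a0 K"
  by unfold_locales (use a_cont Q_cont a0 a_ge a_le Q_le in \<open>auto intro: continuous_on_reflect\<close>)

text \<open>The first derivative changes sign and with it the quasi-derivative; the equation is of
  second order, so the source keeps its sign.\<close>

lemma (in sl_coeff) inhom_reflect:
  assumes "inhom r f h"
  shows "sl_coeff.inhom (\<lambda>x. a (- x)) (\<lambda>x. Q (- x)) (\<lambda>x. r (- x)) (\<lambda>x. f (- x)) (\<lambda>x. - h (- x))"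
proof -
  interpret R: sl_coeff "\<lambda>x. a (- x)" "\<lambda>x. Q (- x)" a0 K by (rule sl_coeff_reflect)
  show ?thesis
    unfolding R.inhom_def
    using has_vector_derivative_reflect[OF inhomD(1)[OF assms]]
      has_vector_derivative_minus[OF has_vector_derivative_reflect[OF inhomD(2)[OF assms]]]
    by simp
qed

context sl_coeff
begin

lemma wr_zero_of_L2_left:
  assumes "sol f h" "L2_left f" "sol f' h'" "L2_left f'"
  shows "wr f h f' h' x = 0"
proof -
  interpret R: sl_coeff "\<lambda>x. a (- x)" "\<lambda>x. Q (- x)" a0 K by (rule sl_coeff_reflect)
  have "R.wr (\<lambda>x. f (- x)) (\<lambda>x. - h (- x)) (\<lambda>x. f' (- x)) (\<lambda>x. - h' (- x)) (- x) = 0"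
    by (rule R.wr_zero_of_L2_right) (use assms inhom_reflect[OF assms(1)] inhom_reflect[OF assms(3)] in \<open>auto simp: L2_left_def\<close>)
  then show ?thesis by (simp add: R.wr_def wr_def)
qed

text \<open>Beyond the support of the source, the homogeneous solution with the same data at c is
  the same function.\<close>

lemma L2_right_of_inhom:
  assumes inh: "inhom r F H" and r: "\<And>x. x \<ge> c \<Longrightarrow> r x = 0" and L2: "L2_right F"
    and s: "sol f h" "f c = F c" "h c = H c"
  shows "L2_right f"
proof (rule L2_right_le[OF inhom_cont(1)[OF s(1)] inhom_cont(1)[OF inh] L2, of c 1])
  fix x assume x: "c \<le> x"
  have "f x = F x"
    by (rule inhom_unique_on(1)[OF s(1) inh, of c x c]) (use r x s in auto)
  then show "norm (f x) \<le> 1 * norm (F x)" by simp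
qed

end

lemma (in sl_coeff) L2_left_of_inhom:
  assumes inh: "inhom r F H" and r: "\<And>x. x \<le> c \<Longrightarrow> r x = 0" and L2: "L2_left F"
    and s: "sol f h" "f c = F c" "h c = H c"
  shows "L2_left f"
proof -
  interpret R: sl_coeff "\<lambda>x. a (- x)" "\<lambda>x. Q (- x)" a0 K by (rule sl_coeff_reflect)
  have "L2_right (\<lambda>x. f (- x))"
    by (rule R.L2_right_of_inhom[OF inhom_reflect[OF inh], of "- c" _ "\<lambda>x. - h (- x)"])
      (use r L2 s inhom_reflect[OF s(1)] in \<open>auto simp: L2_left_def\<close>)
  then show ?thesis by (simp add: L2_left_def)
qed

text \<open>What the estimates take from the bounded resolvent: solvability and an a priori bound
  for continuous sources supported in a unit interval. The constant C is independent of the position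
  x0 of that interval and of the interval from c to d.\<close>

locale sl_resolvent = sl_coeff +
  fixes C :: real
  assumes solvable: "\<And>r x0. continuous_on UNIV r \<Longrightarrow> (\<And>x. x \<notin> {x0..x0 + 1} \<Longrightarrow> r x = 0) \<Longrightarrow>
      \<exists>f h. inhom r f h \<and> L2_right f \<and> L2_left f"
    and apriori: "\<And>r x0 f h c d. continuous_on UNIV r \<Longrightarrow> (\<And>x. x \<notin> {x0..x0 + 1} \<Longrightarrow> r x = 0) \<Longrightarrow>
      inhom r f h \<Longrightarrow> L2_right f \<Longrightarrow> L2_left f \<Longrightarrow>
      integral {c..d} (\<lambda>x. (norm (f x))\<^sup>2) \<le> C * integral {x0..x0 + 1} (\<lambda>x. (norm (r x))\<^sup>2)"
begin

lemma sl_resolvent_reflect: "sl_resolvent (\<lambda>x. a (- x)) (\<lambda>x. Q (- x)) a0 K C"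
proof -
  interpret R: sl_coeff "\<lambda>x. a (- x)" "\<lambda>x. Q (- x)" a0 K by (rule sl_coeff_reflect)
  interpret RR: sl_coeff "\<lambda>x. a (- (- x))" "\<lambda>x. Q (- (- x))" a0 K by (rule R.sl_coeff_reflect)
  have RR: "sl_coeff.inhom (\<lambda>x. a (- (- x))) (\<lambda>x. Q (- (- x))) = inhom" by simp
  show ?thesis
  proof unfold_locales
    fix r :: "real \<Rightarrow> complex" and x0 :: real
    assume r: "continuous_on UNIV r" and supp: "\<And>x. x \<notin> {x0..x0 + 1} \<Longrightarrow> r x = 0"
    have r': "continuous_on UNIV (\<lambda>x. r (- x))" by (rule continuous_on_reflect[OF r])
    have supp': "r (- x) = 0" if "x \<notin> {- x0 - 1..- x0 - 1 + 1}" for x using supp[of "- x"] that by auto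
    from solvable[OF r' supp'] obtain f h where "inhom (\<lambda>x. r (- x)) f h" "L2_right f" "L2_left f" by blast
    then have "R.inhom r (\<lambda>x. f (- x)) (\<lambda>x. - h (- x)) \<and> L2_right (\<lambda>x. f (- x)) \<and> L2_left (\<lambda>x. f (- x))"
      using inhom_reflect[of "\<lambda>x. r (- x)" f h] by (simp add: L2_left_def)
    then show "\<exists>f h. R.inhom r f h \<and> L2_right f \<and> L2_left f" by blast
    fix f h c d
    assume inh: "R.inhom r f h" and L2: "L2_right f" "L2_left f"
    have inh': "inhom (\<lambda>x. r (- x)) (\<lambda>x. f (- x)) (\<lambda>x. - h (- x))"
      using R.inhom_reflect[OF inh] unfolding RR .
    have L2': "L2_right (\<lambda>x. f (- x))" "L2_left (\<lambda>x. f (- x))" using L2 by (simp_all add: L2_left_def)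
    have "integral {- d..- c} (\<lambda>x. (norm (f (- x)))\<^sup>2) \<le> C * integral {- x0 - 1..- x0 - 1 + 1} (\<lambda>x. (norm (r (- x)))\<^sup>2)"
      by (rule apriori[OF r' supp' inh' L2'])
    moreover have "integral {- (x0 + 1)..- x0} (\<lambda>x. (norm (r (- x)))\<^sup>2) = integral {x0..x0 + 1} (\<lambda>x. (norm (r x))\<^sup>2)"
      using Henstock_Kurzweil_Integration.integral_reflect_real[of "x0 + 1" x0 "\<lambda>x. (norm (r x))\<^sup>2"] .
    moreover have "integral {- d..- c} (\<lambda>x. (norm (f (- x)))\<^sup>2) = integral {c..d} (\<lambda>x. (norm (f x))\<^sup>2)"
      using Henstock_Kurzweil_Integration.integral_reflect_real[of d c "\<lambda>x. (norm (f x))\<^sup>2"] .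
    ultimately show "integral {c..d} (\<lambda>x. (norm (f x))\<^sup>2) \<le> C * integral {x0..x0 + 1} (\<lambda>x. (norm (r x))\<^sup>2)"
      by simp
  qed
qed

text \<open>Solve with the right-hand side \<open>cnj \<psi>\<close> cut off to \<open>[0, 1]\<close>. If the solution vanishes to the
  right of the support, the Lagrange identity shows that it does not vanish on the left and that its Wronskian
  with \<open>\<psi>\<close> is positive.\<close>

lemma left_solution_if_no_right:
  assumes no: "\<And>f h. sol f h \<Longrightarrow> L2_right f \<Longrightarrow> data f h 0 = 0"
    and \<psi>: "sol \<psi> \<eta>" "data \<psi> \<eta> 0 \<noteq> 0"
  obtains f h where "sol f h" "L2_left f" "wr \<psi> \<eta> f h 0 \<noteq> 0"
proof -
  note c\<psi> = inhom_cont(1)[OF \<psi>(1)]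
  define bump where "bump x = max 0 (x * (1 - x))" for x :: real
  define r where "r x = cnj (\<psi> x) * of_real (bump x)" for x
  have bcont: "continuous_on UNIV bump" unfolding bump_def by (intro continuous_intros)
  have r: "continuous_on UNIV r" unfolding r_def using c\<psi> bcont by (intro continuous_intros)
  have b0: "bump x = 0" if "x \<notin> {0<..<1}" for x
    using that unfolding bump_def by (auto simp: max_def mult_le_0_iff not_le zero_le_mult_iff)
  have supp: "r x = 0" if "x \<notin> {0..0 + 1}" for x using b0[of x] that by (auto simp: r_def)
  from solvable[OF r supp] obtain F H where FH: "inhom r F H" "L2_right F" "L2_left F" by blast
  \<comment> \<open>The homogeneous continuation of F to the right is square integrable there, hence
    trivial by assumption; thus F and H vanish at 1.\<close>
  obtain f1 h1 where 1: "sol f1 h1" "f1 1 = F 1" "h1 1 = H 1" by (rule sol_exists)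
  have "L2_right f1" by (rule L2_right_of_inhom[OF FH(1) _ FH(2) 1]) (use b0 in \<open>auto simp: r_def\<close>)
  then have "data f1 h1 0 = 0" using no 1(1) by blast
  then have "data f1 h1 1 = 0" using data_gronwall[OF 1(1), of 1 0] data_nonneg[of f1 h1 1] by simp
  then have FH1: "F 1 = 0" "H 1 = 0" unfolding data_eq_0 using 1 by auto
  have "((\<lambda>x. - \<psi> x * r x) has_integral (wr \<psi> \<eta> F H 1 - wr \<psi> \<eta> F H 0)) {0..1}"
    by (rule fundamental_theorem_of_calculus, simp, rule has_vector_derivative_at_within, rule wr_deriv[OF \<psi>(1) FH(1)])
  moreover have "wr \<psi> \<eta> F H 1 = 0" by (simp add: wr_def FH1)
  moreover have "- \<psi> x * r x = - complex_of_real ((norm (\<psi> x))\<^sup>2 * bump x)" for x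
    unfolding r_def of_real_mult complex_norm_square by (simp add: mult_ac)
  ultimately have W: "((\<lambda>x. complex_of_real ((norm (\<psi> x))\<^sup>2 * bump x)) has_integral wr \<psi> \<eta> F H 0) {0..1}"
    using has_integral_neg[of "\<lambda>x. - \<psi> x * r x" "- wr \<psi> \<eta> F H 0" "{0..1}"] by simp
  define g where "g x = (norm (\<psi> x))\<^sup>2 * bump x" for x
  have gcont: "continuous_on UNIV g" unfolding g_def using c\<psi> bcont by (intro continuous_intros)
  \<comment> \<open>A vanishing integral of the continuous nonnegative g would make \<psi> zero on
    (0, 1), and then \<open>data_le_integral\<close> would make its data at 0 vanish.\<close>
  have wr_nz: "wr \<psi> \<eta> F H 0 \<noteq> 0"
  proof
    assume "wr \<psi> \<eta> F H 0 = 0"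
    then have "(g has_integral Re 0) {0..1}"
      using has_integral_linear[OF W bounded_linear_Re] unfolding g_def by (simp add: o_def)
    then have gi: "(g has_integral 0) (cbox 0 1)" by simp
    have g0: "g x = 0" if "x \<in> {0..1}" for x
      using has_integral_0_cbox_imp_0[of 0 1 g x] continuous_on_subset[OF gcont] gi that
      by (auto simp: g_def bump_def)
    have "\<psi> x = 0" if "x \<in> {0<..<1}" for x
    proof -
      have "bump x > 0" using that by (simp add: bump_def)
      then show ?thesis using g0[of x] that by (simp add: g_def)
    qed
    then have "((\<lambda>s. (norm (\<psi> s))\<^sup>2) has_integral 0) {0..1}"
      by (intro has_integral_spike_finite[of "{0, 1}" "{0..1}" "\<lambda>s. (norm (\<psi> s))\<^sup>2" "\<lambda>_. 0" 0]) (auto simp: has_integral_0)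
    then have "integral {0..1} (\<lambda>s. (norm (\<psi> s))\<^sup>2) = 0" by (rule integral_unique)
    moreover obtain C' where "C' > 0" "\<And>f h x. sol f h \<Longrightarrow> data f h x \<le> C' * integral {x..x + 1} (\<lambda>s. (norm (f s))\<^sup>2)"
      by (rule data_le_integral) blast
    then have "data \<psi> \<eta> 0 \<le> C' * integral {0..0 + 1} (\<lambda>s. (norm (\<psi> s))\<^sup>2)" using \<psi>(1) by blast
    ultimately show False using \<psi>(2) data_nonneg[of \<psi> \<eta> 0] by simp
  qed
  obtain f h where 2: "sol f h" "f 0 = F 0" "h 0 = H 0" by (rule sol_exists)
  have "L2_left f" by (rule L2_left_of_inhom[OF FH(1) _ FH(3) 2]) (use b0 in \<open>auto simp: r_def\<close>)
  moreover have "wr \<psi> \<eta> f h 0 \<noteq> 0" using wr_nz 2 by (simp add: wr_def)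
  ultimately show ?thesis using that 2(1) by blast
qed

text \<open>If nothing nontrivial were square integrable at +infinity, the preceding lemma would
  give a solution square integrable at -infinity, and a second one independent of it when the first
  is used as \<psi>. The limit point property at -infinity excludes this.\<close>

lemma right_solution_exists:
  obtains f h where "sol f h" "L2_right f" "data f h 0 \<noteq> 0"
proof -
  have "\<exists>f h. sol f h \<and> L2_right f \<and> data f h 0 \<noteq> 0"
  proof (rule ccontr)
    assume "\<not> ?thesis"
    then have no: "\<And>f h. sol f h \<Longrightarrow> L2_right f \<Longrightarrow> data f h 0 = 0" by blast
    obtain \<psi> \<eta> where \<psi>: "sol \<psi> \<eta>" "\<psi> 0 = 1" "\<eta> 0 = 0" by (rule sol_exists)
    then have "data \<psi> \<eta> 0 \<noteq> 0" by (simp add: data_eq_0)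
    with no \<psi>(1) obtain f1 h1 where 1: "sol f1 h1" "L2_left f1" "wr \<psi> \<eta> f1 h1 0 \<noteq> 0"
      by (rule left_solution_if_no_right) blast+
    have "data f1 h1 0 \<noteq> 0" using 1(3) by (auto simp: data_eq_0 wr_def)
    with no 1(1) obtain f2 h2 where 2: "sol f2 h2" "L2_left f2" "wr f1 h1 f2 h2 0 \<noteq> 0"
      by (rule left_solution_if_no_right) blast+
    show False using wr_zero_of_L2_left[OF 1(1,2) 2(1,2)] 2(3) by blast
  qed
  then show ?thesis using that by blast
qed

lemma left_solution_exists:
  obtains f h where "sol f h" "L2_left f" "data f h 0 \<noteq> 0"
proof -
  interpret R: sl_resolvent "\<lambda>x. a (- x)" "\<lambda>x. Q (- x)" a0 K C by (rule sl_resolvent_reflect)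
  obtain f h where fh: "R.sol f h" "L2_right f" "R.data f h 0 \<noteq> 0" by (rule R.right_solution_exists)
  have "sol (\<lambda>x. f (- x)) (\<lambda>x. - h (- x))" using R.inhom_reflect[OF fh(1)] by simp
  moreover have "L2_left (\<lambda>x. f (- x))" using fh(2) by (simp add: L2_left_def)
  moreover have "data (\<lambda>x. f (- x)) (\<lambda>x. - h (- x)) 0 \<noteq> 0" using fh(3) by (simp add: data_def R.data_def)
  ultimately show ?thesis using that by blast
qed

end

section \<open>Decay and perturbation of the Weyl solutions\<close>

text \<open>Squaring the positive part makes the profile of the cutoff differentiable also at the
  ends of its support.\<close>

lemma has_real_derivative_pos_square:
  "((\<lambda>u. (max 0 u)\<^sup>2) has_real_derivative 2 * max 0 u) (at (u::real))"
proof (cases u "0::real" rule: linorder_cases)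
  case less
  have "((\<lambda>u. 0) has_real_derivative 2 * max 0 u) (at u)" using less by (simp add: max_def)
  then show ?thesis
    by (rule has_field_derivative_transform_within_open[of _ _ _ "{..<0}"]) (use less in auto)
next
  case greater
  have "((\<lambda>u. u\<^sup>2) has_real_derivative 2 * max 0 u) (at u)"
    using greater by (auto intro!: derivative_eq_intros simp: max_def)
  then show ?thesis
    by (rule has_field_derivative_transform_within_open[of _ _ _ "{0<..}"]) (use greater in auto)
next
  case equal
  have "((\<lambda>h::real. ((max 0 h)\<^sup>2 - (max 0 0)\<^sup>2) / (h - 0)) \<longlongrightarrow> 0) (at 0)"
  proof (rule Lim_null_comparison)
    show "\<forall>\<^sub>F h in at 0. norm (((max 0 h)\<^sup>2 - (max 0 0)\<^sup>2) / (h - 0)) \<le> \<bar>h\<bar>" for h :: real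
      by (intro always_eventually allI) (auto simp: max_def power2_eq_square abs_mult)
    show "((\<lambda>h::real. \<bar>h\<bar>) \<longlongrightarrow> 0) (at 0)" by (intro tendsto_eq_intros refl) auto
  qed
  then show ?thesis unfolding equal has_field_derivative_iff by simp
qed

lemma has_vector_derivative_shift:
  assumes "(f has_vector_derivative f') (at (t + s))"
  shows "((\<lambda>s. f (t + s)) has_vector_derivative f') (at s)"
proof -
  have "((+) t has_vector_derivative (1::real)) (at s)"
    by (auto intro!: derivative_eq_intros)
  from vector_diff_chain_at[OF this assms] show ?thesis by (simp add: o_def)
qed

lemma continuous_on_shift: "continuous_on UNIV f \<Longrightarrow> continuous_on UNIV (\<lambda>x::real. f (t + x))"
  by (rule continuous_on_compose2[of UNIV f]) (auto intro: continuous_intros)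

lemma primitive_zero_left:
  assumes "\<And>s. s \<le> x0 \<Longrightarrow> F s = 0" "x \<le> x0"
  shows "primitive x0 F x = 0"
proof -
  have "integral {x..x0} F = integral {x..x0} (\<lambda>_. 0)"
    by (rule Henstock_Kurzweil_Integration.integral_cong) (use assms in auto)
  then show ?thesis using assms(2) by (simp add: primitive_def)
qed

lemma primitive_const_right:
  assumes F: "continuous_on UNIV F" and z: "\<And>s. s \<ge> x1 \<Longrightarrow> F s = 0" and x: "x0 \<le> x1" "x1 \<le> x"
  shows "primitive x0 F x = primitive x0 F x1"
proof -
  have "integral {x1..x} F = integral {x1..x} (\<lambda>_. 0)"
    by (rule Henstock_Kurzweil_Integration.integral_cong) (use z in auto)
  then show ?thesis using x integral_split[OF F x] by (simp add: primitive_def)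
qed

context sl_resolvent
begin

text \<open>The solution \<open>f1\<close> on the right is glued to a multiple of \<open>f2\<close> on the left; the
  defect is supported in a unit interval and is controlled by \<open>f1 - c f2\<close>. The cutoff
  has derivative \<open>a \<theta>\<close>, so that its quasi-derivative \<open>\<theta>\<close> is differentiable.\<close>

lemma glued_estimate:
  assumes 1: "sol f1 h1" "L2_right f1" and 2: "sol f2 h2" "L2_left f2"
  shows "(a0 / 30)\<^sup>2 * integral {x0 + 1..y} (\<lambda>s. (norm (f1 s))\<^sup>2)
    \<le> max C 0 * (1 + 4 * K\<^sup>2) * exp (2 * K) * data (\<lambda>s. f1 s - c * f2 s) (\<lambda>s. h1 s - c * h2 s) x0"
proof -
  define d where "d s = f1 s - c * f2 s" for s
  define e where "e s = h1 s - c * h2 s" for s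
  have de: "sol d e" unfolding d_def e_def by (rule sol_diff[OF 1(1) 2(1)])
  note cde = inhom_cont[OF de]
  define \<beta> where "\<beta> x = (x - x0) * (x0 + 1 - x)" for x
  define \<theta> where "\<theta> x = (max 0 (\<beta> x))\<^sup>2" for x
  define \<theta>' where "\<theta>' x = 2 * max 0 (\<beta> x) * (1 - 2 * (x - x0))" for x
  have \<beta>cont: "continuous_on UNIV \<beta>" unfolding \<beta>_def by (intro continuous_intros)
  have \<theta>cont: "continuous_on UNIV \<theta>" "continuous_on UNIV \<theta>'"
    unfolding \<theta>_def \<theta>'_def using \<beta>cont by (auto intro!: continuous_intros)
  have \<theta>d: "(\<theta> has_real_derivative \<theta>' x) (at x)" for x
  proof -
    have "(\<beta> has_real_derivative 1 - 2 * (x - x0)) (at x)"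
      unfolding \<beta>_def by (auto intro!: derivative_eq_intros simp: algebra_simps)
    from DERIV_chain2[OF has_real_derivative_pos_square this] show ?thesis
      unfolding \<theta>_def \<theta>'_def by simp
  qed
  have \<beta>0: "\<beta> x \<le> 0" if "x \<le> x0 \<or> x \<ge> x0 + 1" for x
    using that unfolding \<beta>_def by (auto intro: mult_nonpos_nonneg mult_nonneg_nonpos)
  have out: "\<theta> x = 0" "\<theta>' x = 0" if "x \<le> x0 \<or> x \<ge> x0 + 1" for x
    using \<beta>0[OF that] unfolding \<theta>_def \<theta>'_def by simp_all
  have \<beta>le: "\<beta> x \<le> 1/4" for x
  proof -
    have "0 \<le> (x - x0 - 1/2)\<^sup>2" by simp
    also have "\<dots> = 1/4 - \<beta> x" by (simp add: \<beta>_def power2_eq_square algebra_simps)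
    finally show ?thesis by simp
  qed
  have \<theta>1: "\<bar>\<theta> x\<bar> \<le> 1" for x
    using \<beta>le[of x] unfolding \<theta>_def by (auto simp: power_le_one max_def)
  have \<theta>'1: "\<bar>\<theta>' x\<bar> \<le> 1" for x
  proof (cases "x \<le> x0 \<or> x \<ge> x0 + 1")
    case False
    have "\<bar>2 * max 0 (\<beta> x)\<bar> * \<bar>1 - 2 * (x - x0)\<bar> \<le> 1 * 1"
      using \<beta>le[of x] False by (intro mult_mono) auto
    then show ?thesis unfolding \<theta>'_def abs_mult by simp
  qed (use out in simp)
  \<comment> \<open>The cutoff rises from 0 to m. It is not normalised to 1: the constant m is
    carried along and bounded below by a0 / 30.\<close>
  define X where "X = primitive x0 (\<lambda>s. complex_of_real (a s * \<theta> s))"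
  have aXc: "continuous_on UNIV (\<lambda>s. complex_of_real (a s * \<theta> s))" using a_cont \<theta>cont by (intro continuous_intros)
  have Xd: "(X has_vector_derivative of_real (a x * \<theta> x)) (at x)" for x
    unfolding X_def by (rule primitive_has_derivative[OF aXc])
  have X0: "X x = 0" if "x \<le> x0" for x unfolding X_def by (rule primitive_zero_left) (use out that in auto)
  define m where "m = X (x0 + 1)"
  have Xm: "X x = m" if "x \<ge> x0 + 1" for x unfolding X_def m_def by (rule primitive_const_right[OF aXc]) (use out that in auto)
  have m: "a0 / 30 \<le> norm m"
  proof -
    have "((\<lambda>s. a0 * ((s - x0) * (x0 + 1 - s))\<^sup>2) has_integral a0 * (1/30)) {x0..x0 + 1}"
      by (rule has_integral_mult_right[OF has_integral_square_bump])
    moreover have ri: "((\<lambda>s. a s * \<theta> s) has_integral integral {x0..x0 + 1} (\<lambda>s. a s * \<theta> s)) {x0..x0 + 1}"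
      by (intro integrable_integral integrable_cont continuous_on_mult a_cont \<theta>cont)
    ultimately have "a0 * (1/30) \<le> integral {x0..x0 + 1} (\<lambda>s. a s * \<theta> s)"
    proof (rule has_integral_le)
      fix s assume "s \<in> {x0..x0 + 1}"
      then have "0 \<le> \<beta> s" unfolding \<beta>_def by auto
      then have "\<theta> s = ((s - x0) * (x0 + 1 - s))\<^sup>2" by (simp add: \<theta>_def \<beta>_def max_def)
      then show "a0 * ((s - x0) * (x0 + 1 - s))\<^sup>2 \<le> a s * \<theta> s" using a_ge[of s] by (simp add: mult_right_mono)
    qed
    moreover have "m = complex_of_real (integral {x0..x0 + 1} (\<lambda>s. a s * \<theta> s))"
      unfolding m_def X_def primitive_def
      using integral_unique[OF has_integral_of_real[OF ri]] by simp
    ultimately show ?thesis using a0 by simp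
  qed
  \<comment> \<open>U is \<open>m * c * f2\<close> to the left of x0 and \<open>m * f1\<close> to
    the right of x0 + 1. The term \<open>\<theta> * d\<close> in H comes from the derivative of X,
    and r is what remains when H is differentiated.\<close>
  define U where "U x = m * c * f2 x + X x * d x" for x
  define H where "H x = m * c * h2 x + X x * e x + of_real (\<theta> x) * d x" for x
  define r where "r x = - (of_real (\<theta>' x) * d x + 2 * of_real (a x * \<theta> x) * e x)" for x
  have "inhom r U H"
    unfolding inhom_def
  proof (intro conjI allI)
    fix x
    have "(U has_vector_derivative m * c * (of_real (a x) * h2 x) + (X x * (of_real (a x) * e x) + of_real (a x * \<theta> x) * d x)) (at x)"
      unfolding U_def
      by (intro has_vector_derivative_add has_vector_derivative_mult_right has_vector_derivative_mult Xd inhomD(1)[OF de] inhomD(1)[OF 2(1)])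
    moreover have "m * c * (of_real (a x) * h2 x) + (X x * (of_real (a x) * e x) + of_real (a x * \<theta> x) * d x) = of_real (a x) * H x"
      by (simp add: H_def algebra_simps)
    ultimately show "(U has_vector_derivative of_real (a x) * H x) (at x)" by simp
    have \<theta>vd: "((\<lambda>x. complex_of_real (\<theta> x)) has_vector_derivative of_real (\<theta>' x)) (at x)"
      using has_vector_derivative_of_real[OF \<theta>d[of x]] .
    have "(H has_vector_derivative m * c * (Q x * f2 x - 0) + (X x * (Q x * d x - 0) + of_real (a x * \<theta> x) * e x) + (of_real (\<theta> x) * (of_real (a x) * d' x) + of_real (\<theta>' x) * d x)) (at x)"
      if "d' = e" for d'
      unfolding H_def that
      by (intro has_vector_derivative_add has_vector_derivative_mult_right has_vector_derivative_mult Xd \<theta>vd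
          inhomD(1)[OF de] inhomD(2)[OF de] inhomD(2)[OF 2(1)])
    from this[OF refl] have "(H has_vector_derivative m * c * (Q x * f2 x - 0) + (X x * (Q x * d x - 0) + of_real (a x * \<theta> x) * e x) + (of_real (\<theta> x) * (of_real (a x) * e x) + of_real (\<theta>' x) * d x)) (at x)" .
    moreover have "m * c * (Q x * f2 x - 0) + (X x * (Q x * d x - 0) + of_real (a x * \<theta> x) * e x) + (of_real (\<theta> x) * (of_real (a x) * e x) + of_real (\<theta>' x) * d x) = Q x * U x - r x"
      by (simp add: U_def r_def algebra_simps)
    ultimately show "(H has_vector_derivative Q x * U x - r x) (at x)" by simp
  qed
  note UH = this
  note cU = inhom_cont(1)[OF UH]
  have Ul: "U x = m * c * f2 x" if "x \<le> x0" for x using X0[OF that] by (simp add: U_def)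
  have Ur: "U x = m * f1 x" if "x \<ge> x0 + 1" for x using Xm[OF that] by (simp add: U_def d_def algebra_simps)
  have L2r: "L2_right U"
    by (rule L2_right_le[OF cU inhom_cont(1)[OF 1(1)] 1(2), of "x0 + 1" "norm m"]) (simp add: Ur norm_mult)
  have L2l: "L2_left U"
    unfolding L2_left_def
    by (rule L2_right_le[OF continuous_on_reflect[OF cU] continuous_on_reflect[OF inhom_cont(1)[OF 2(1)]] 2(2)[unfolded L2_left_def], of "- x0" "norm (m * c)"])
      (simp add: Ul norm_mult)
  have rcont: "continuous_on UNIV r" unfolding r_def using \<theta>cont a_cont cde by (intro continuous_intros)
  have supp: "r x = 0" if "x \<notin> {x0..x0 + 1}" for x using out[of x] that by (auto simp: r_def)
  have "integral {x0 + 1..y} (\<lambda>x. (norm (U x))\<^sup>2) \<le> C * integral {x0..x0 + 1} (\<lambda>x. (norm (r x))\<^sup>2)"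
    by (rule apriori[OF rcont supp UH L2r L2l])
  also have "\<dots> \<le> max C 0 * integral {x0..x0 + 1} (\<lambda>x. (norm (r x))\<^sup>2)"
    by (intro mult_right_mono integral_nonneg integrable_cont cont_norm_square rcont) auto
  also have "\<dots> \<le> max C 0 * ((1 + 4 * K\<^sup>2) * (exp (2 * K) * data d e x0))"
  proof (rule mult_left_mono)
    have "integral {x0..x0 + 1} (\<lambda>x. (norm (r x))\<^sup>2) \<le> integral {x0..x0 + 1} (\<lambda>x. (1 + 4 * K\<^sup>2) * data d e x)"
    proof (rule integral_le)
      fix x
      have 1: "norm (complex_of_real (\<theta>' x) * d x) \<le> norm (d x)"
        using mult_right_mono[OF \<theta>'1[of x], of "norm (d x)"] by (simp add: norm_mult)
      have "\<bar>a x\<bar> * \<bar>\<theta> x\<bar> \<le> K * 1" using \<theta>1[of x] a_ge[of x] a_le[of x] a0 K by (intro mult_mono) auto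
      then have 2: "norm (2 * complex_of_real (a x * \<theta> x) * e x) \<le> 2 * K * norm (e x)"
        using mult_right_mono[of "\<bar>a x\<bar> * \<bar>\<theta> x\<bar>" K "norm (e x)"] by (simp add: norm_mult abs_mult)
      have "norm (r x) \<le> norm (complex_of_real (\<theta>' x) * d x) + norm (2 * complex_of_real (a x * \<theta> x) * e x)"
        unfolding r_def norm_minus_cancel by (rule norm_triangle_ineq)
      then have "norm (r x) \<le> norm (d x) + 2 * K * norm (e x)" using 1 2 by linarith
      then have "(norm (r x))\<^sup>2 \<le> (norm (d x) + 2 * K * norm (e x))\<^sup>2" by (intro power_mono) auto
      \<comment> \<open>Adding this square proves Cauchy-Schwarz for the vectors (1, 2 K) and (norm
        d, norm e).\<close>
      also have "\<dots> \<le> (norm (d x) + 2 * K * norm (e x))\<^sup>2 + (norm (e x) - 2 * K * norm (d x))\<^sup>2" by simp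
      also have "\<dots> = (1 + 4 * K\<^sup>2) * data d e x" by (simp add: data_def power2_eq_square algebra_simps)
      finally show "(norm (r x))\<^sup>2 \<le> (1 + 4 * K\<^sup>2) * data d e x" .
    qed (intro integrable_cont cont_norm_square rcont continuous_on_mult continuous_on_const data_cont cde)+
    also have "\<dots> = (1 + 4 * K\<^sup>2) * integral {x0..x0 + 1} (data d e)" by simp
    also have "\<dots> \<le> (1 + 4 * K\<^sup>2) * (exp (2 * K) * data d e x0)"
      by (intro mult_left_mono integral_data_unit[OF de]) simp
    finally show "integral {x0..x0 + 1} (\<lambda>x. (norm (r x))\<^sup>2) \<le> (1 + 4 * K\<^sup>2) * (exp (2 * K) * data d e x0)" .
  qed simp
  finally have A: "integral {x0 + 1..y} (\<lambda>x. (norm (U x))\<^sup>2) \<le> max C 0 * (1 + 4 * K\<^sup>2) * exp (2 * K) * data d e x0"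
    by (simp add: mult.assoc)
  have "integral {x0 + 1..y} (\<lambda>x. (norm (U x))\<^sup>2) = integral {x0 + 1..y} (\<lambda>x. (norm m)\<^sup>2 * (norm (f1 x))\<^sup>2)"
    by (rule Henstock_Kurzweil_Integration.integral_cong) (simp add: Ur norm_mult power_mult_distrib)
  also have "\<dots> = (norm m)\<^sup>2 * integral {x0 + 1..y} (\<lambda>x. (norm (f1 x))\<^sup>2)" by simp
  also have "\<dots> \<ge> (a0 / 30)\<^sup>2 * integral {x0 + 1..y} (\<lambda>x. (norm (f1 x))\<^sup>2)"
    using m a0 by (intro mult_right_mono power_mono integral_nonneg integrable_cont cont_norm_square inhom_cont(1)[OF 1(1)]) auto
  finally show ?thesis using A unfolding d_def[abs_def] e_def[abs_def] by linarith
qed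

text \<open>\<open>glued_estimate\<close> controls f1 only from x + 1 on. Caccioppoli on the next
  unit interval and Gronwall back over one unit recover the data at x, and with them the missing
  interval from x to x + 1.\<close>

lemma right_decay_gap:
  obtains C' where "C' > 0" "\<And>f1 h1 f2 h2 c x y. sol f1 h1 \<Longrightarrow> L2_right f1 \<Longrightarrow> sol f2 h2 \<Longrightarrow> L2_left f2 \<Longrightarrow>
    integral {x..y} (data f1 h1) \<le> C' * data (\<lambda>s. f1 s - c * f2 s) (\<lambda>s. h1 s - c * h2 s) x"
proof -
  obtain Cg where Cg: "Cg > 0" "\<And>f h x. sol f h \<Longrightarrow> data f h x \<le> Cg * integral {x..x + 1} (\<lambda>s. (norm (f s))\<^sup>2)"
    by (rule data_le_integral) blast
  obtain Ci where Ci: "Ci > 0" "\<And>f h x n. sol f h \<Longrightarrow>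
      integral {x..x + real n} (data f h) \<le> Ci * integral {x..x + real n} (\<lambda>s. (norm (f s))\<^sup>2)"
    by (rule integral_data_le) blast
  define A where "A = max C 0 * (1 + 4 * K\<^sup>2) * exp (2 * K) / (a0 / 30)\<^sup>2"
  have A: "A \<ge> 0" unfolding A_def by simp
  define B where "B = exp (2 * K) * (exp (2 * K) * (Cg * A)) + Ci * A + 1"
  have B: "B > 0" using A Cg Ci unfolding B_def by (simp add: add_nonneg_pos)
  have "integral {x..y} (data f1 h1) \<le> B * data (\<lambda>s. f1 s - c * f2 s) (\<lambda>s. h1 s - c * h2 s) x"
    if 1: "sol f1 h1" "L2_right f1" and 2: "sol f2 h2" "L2_left f2" for f1 h1 f2 h2 c x y
  proof -
    define D where "D = data (\<lambda>s. f1 s - c * f2 s) (\<lambda>s. h1 s - c * h2 s) x"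
    have D: "D \<ge> 0" unfolding D_def by (rule data_nonneg)
    have est: "integral {x + 1..y} (\<lambda>s. (norm (f1 s))\<^sup>2) \<le> A * D" for y
      using glued_estimate[OF 1 2, of x y c] a0 unfolding A_def D_def
      by (simp add: field_simps)
    note cN = data_cont[OF inhom_cont[OF 1(1)]]
    have "data f1 h1 x \<le> exp (2 * K * \<bar>x - (x + 1)\<bar>) * data f1 h1 (x + 1)" by (rule data_gronwall[OF 1(1)])
    also have "\<dots> \<le> exp (2 * K) * (Cg * integral {x + 1..x + 1 + 1} (\<lambda>s. (norm (f1 s))\<^sup>2))"
      using Cg(2)[OF 1(1), of "x + 1"] by simp
    also have "\<dots> \<le> exp (2 * K) * (Cg * (A * D))"
      using Cg(1) by (intro mult_left_mono est) auto
    finally have N: "data f1 h1 x \<le> exp (2 * K) * (Cg * (A * D))" .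
    obtain n where n: "y \<le> real n + x + 1" using real_arch_simple[of "y - x - 1"] by (auto simp: algebra_simps)
    have "integral {x..y} (data f1 h1) \<le> integral {x..x + 1 + real n} (data f1 h1)"
      by (rule integral_mono_upper[OF cN data_nonneg]) (use n in auto)
    also have "\<dots> = integral {x..x + 1} (data f1 h1) + integral {x + 1..x + 1 + real n} (data f1 h1)"
      by (rule integral_split[OF cN]) auto
    also have "\<dots> \<le> exp (2 * K) * data f1 h1 x + Ci * integral {x + 1..x + 1 + real n} (\<lambda>s. (norm (f1 s))\<^sup>2)"
      by (intro add_mono integral_data_unit Ci(2) 1)
    also have "\<dots> \<le> exp (2 * K) * (exp (2 * K) * (Cg * (A * D))) + Ci * (A * D)"
      using Ci(1) by (intro add_mono mult_left_mono N est) auto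
    also have "\<dots> \<le> B * D" using D unfolding B_def by (simp add: algebra_simps)
    finally show ?thesis unfolding D_def .
  qed
  with B that show ?thesis by blast
qed

text \<open>Choosing \<open>c\<close> by orthogonal projection, the gap becomes a multiple of the Wronskian.\<close>

lemma right_decay:
  obtains C' where "C' > 0" "\<And>f1 h1 f2 h2 x y. sol f1 h1 \<Longrightarrow> L2_right f1 \<Longrightarrow> sol f2 h2 \<Longrightarrow> L2_left f2 \<Longrightarrow>
    data f2 h2 x * integral {x..y} (data f1 h1) \<le> C' * (norm (wr f1 h1 f2 h2 x))\<^sup>2"
proof -
  obtain C' where C': "C' > 0" "\<And>f1 h1 f2 h2 c x y. sol f1 h1 \<Longrightarrow> L2_right f1 \<Longrightarrow> sol f2 h2 \<Longrightarrow> L2_left f2 \<Longrightarrow>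
    integral {x..y} (data f1 h1) \<le> C' * data (\<lambda>s. f1 s - c * f2 s) (\<lambda>s. h1 s - c * h2 s) x"
    by (rule right_decay_gap) blast
  have "data f2 h2 x * integral {x..y} (data f1 h1) \<le> C' * (norm (wr f1 h1 f2 h2 x))\<^sup>2"
    if s: "sol f1 h1" "L2_right f1" "sol f2 h2" "L2_left f2" for f1 h1 f2 h2 x y
  proof (cases "data f2 h2 x = 0")
    case False
    define n where "n = data f2 h2 x"
    have n: "n > 0" using False data_nonneg[of f2 h2 x] by (simp add: n_def)
    have nc: "complex_of_real n = f2 x * cnj (f2 x) + h2 x * cnj (h2 x)"
      unfolding n_def data_def of_real_add complex_norm_square ..
    have nc0: "complex_of_real n \<noteq> 0" using n by simp
    \<comment> \<open>In two dimensions the remainder of the projection is W / n times the vector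
      (cnj h2, - cnj f2), so the gap is known exactly.\<close>
    define c where "c = (f1 x * cnj (f2 x) + h1 x * cnj (h2 x)) / of_real n"
    define W where "W = wr f1 h1 f2 h2 x"
    have cn: "c * of_real n = f1 x * cnj (f2 x) + h1 x * cnj (h2 x)" using nc0 by (simp add: c_def)
    have "(f1 x - c * f2 x) * of_real n = f1 x * of_real n - (c * of_real n) * f2 x" by (simp add: algebra_simps)
    also have "\<dots> = cnj (h2 x) * W" unfolding cn unfolding nc W_def wr_def by (simp add: algebra_simps)
    finally have 1: "norm (f1 x - c * f2 x) * n = norm (h2 x) * norm W"
      using n by (metis abs_of_pos complex_mod_cnj norm_mult norm_of_real)
    have "(h1 x - c * h2 x) * of_real n = h1 x * of_real n - (c * of_real n) * h2 x" by (simp add: algebra_simps)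
    also have "\<dots> = - (cnj (f2 x) * W)" unfolding cn unfolding nc W_def wr_def by (simp add: algebra_simps)
    finally have 2: "norm (h1 x - c * h2 x) * n = norm (f2 x) * norm W"
      using n by (metis abs_of_pos complex_mod_cnj norm_minus_cancel norm_mult norm_of_real)
    have "data (\<lambda>s. f1 s - c * f2 s) (\<lambda>s. h1 s - c * h2 s) x * n * n = (norm (f1 x - c * f2 x) * n)\<^sup>2 + (norm (h1 x - c * h2 x) * n)\<^sup>2"
      by (simp add: data_def power_mult_distrib power2_eq_square algebra_simps)
    also have "\<dots> = (norm W)\<^sup>2 * n"
      unfolding 1 2 by (simp add: n_def data_def power_mult_distrib algebra_simps)
    finally have gap: "data (\<lambda>s. f1 s - c * f2 s) (\<lambda>s. h1 s - c * h2 s) x * n = (norm W)\<^sup>2" using n by simp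
    have "n * integral {x..y} (data f1 h1) \<le> n * (C' * data (\<lambda>s. f1 s - c * f2 s) (\<lambda>s. h1 s - c * h2 s) x)"
      using n by (intro mult_left_mono C'(2) s) simp
    also have "\<dots> = C' * (norm W)\<^sup>2" unfolding gap[symmetric] by (simp add: mult_ac)
    finally show ?thesis unfolding n_def W_def .
  qed (use C'(1) in simp)
  with C'(1) that show ?thesis by blast
qed

text \<open>Proportional solutions would be an eigenfunction. The decay bound excludes it: with W =
  0 its right-hand side is 0, while \<open>data_le_integral\<close> keeps the left-hand side
  positive.\<close>

lemma wr_nonzero:
  assumes "sol f1 h1" "L2_right f1" "sol f2 h2" "L2_left f2" and nz: "data f1 h1 x \<noteq> 0" "data f2 h2 x \<noteq> 0"
  shows "wr f1 h1 f2 h2 x \<noteq> 0"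
proof
  assume W: "wr f1 h1 f2 h2 x = 0"
  obtain C' where C': "C' > 0" "\<And>f1 h1 f2 h2 x y. sol f1 h1 \<Longrightarrow> L2_right f1 \<Longrightarrow> sol f2 h2 \<Longrightarrow> L2_left f2 \<Longrightarrow>
    data f2 h2 x * integral {x..y} (data f1 h1) \<le> C' * (norm (wr f1 h1 f2 h2 x))\<^sup>2"
    by (rule right_decay) blast
  obtain Cg where Cg: "Cg > 0" "\<And>f h x. sol f h \<Longrightarrow> data f h x \<le> Cg * integral {x..x + 1} (\<lambda>s. (norm (f s))\<^sup>2)"
    by (rule data_le_integral) blast
  have "integral {x..x + 1} (\<lambda>s. (norm (f1 s))\<^sup>2) \<le> integral {x..x + 1} (data f1 h1)"
    by (intro integral_le integrable_cont cont_norm_square data_cont inhom_cont[OF assms(1)]) (simp add: data_def)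
  then have "Cg * integral {x..x + 1} (\<lambda>s. (norm (f1 s))\<^sup>2) \<le> Cg * integral {x..x + 1} (data f1 h1)"
    using Cg(1) by (intro mult_left_mono) auto
  then have "data f1 h1 x \<le> Cg * integral {x..x + 1} (data f1 h1)" using Cg(2)[OF assms(1), of x] by linarith
  then have "data f2 h2 x * data f1 h1 x \<le> data f2 h2 x * (Cg * integral {x..x + 1} (data f1 h1))"
    by (intro mult_left_mono data_nonneg)
  also have "\<dots> = Cg * (data f2 h2 x * integral {x..x + 1} (data f1 h1))" by simp
  also have "\<dots> \<le> Cg * (C' * (norm (wr f1 h1 f2 h2 x))\<^sup>2)" using Cg(1) by (intro mult_left_mono C'(2) assms) auto
  also have "\<dots> = 0" by (simp add: W)
  finally have "data f2 h2 x * data f1 h1 x \<le> 0" .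
  moreover have "0 < data f2 h2 x * data f1 h1 x"
    using nz data_nonneg[of f1 h1 x] data_nonneg[of f2 h2 x] by simp
  ultimately show False by simp
qed

text \<open>On the left stands V 0, where V s is the Wronskian of the translates of f1 by t and by
  t'. These solve slightly different equations, so V has a derivative of order \<delta> and is small
  at suitable far points; V 0 is thus bounded by an integral of products of the two
  translates.\<close>

lemma right_perturbation:
  obtains C' where "C' > 0" "\<And>f1 h1 f2 h2 t t' \<delta>. sol f1 h1 \<Longrightarrow> L2_right f1 \<Longrightarrow> sol f2 h2 \<Longrightarrow> L2_left f2 \<Longrightarrow>
    (\<And>s. \<bar>a (t + s) - a (t' + s)\<bar> \<le> \<delta>) \<Longrightarrow> (\<And>s. norm (Q (t + s) - Q (t' + s)) \<le> \<delta>) \<Longrightarrow>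
    sqrt (data f2 h2 t) * sqrt (data f2 h2 t') * norm (f1 t * h1 t' - h1 t * f1 t') \<le> \<delta> * (C' * (norm (wr f1 h1 f2 h2 0))\<^sup>2)"
proof -
  obtain C' where C': "C' > 0" "\<And>f1 h1 f2 h2 x y. sol f1 h1 \<Longrightarrow> L2_right f1 \<Longrightarrow> sol f2 h2 \<Longrightarrow> L2_left f2 \<Longrightarrow>
    data f2 h2 x * integral {x..y} (data f1 h1) \<le> C' * (norm (wr f1 h1 f2 h2 x))\<^sup>2"
    by (rule right_decay) blast
  have "sqrt (data f2 h2 t) * sqrt (data f2 h2 t') * norm (f1 t * h1 t' - h1 t * f1 t') \<le> \<delta> * (C' * (norm (wr f1 h1 f2 h2 0))\<^sup>2)"
    if 1: "sol f1 h1" "L2_right f1" and 2: "sol f2 h2" "L2_left f2"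
      and da: "\<And>s. \<bar>a (t + s) - a (t' + s)\<bar> \<le> \<delta>" and dQ: "\<And>s. norm (Q (t + s) - Q (t' + s)) \<le> \<delta>"
    for f1 h1 f2 h2 t t' \<delta>
  proof -
    define u v where "u = sqrt (data f2 h2 t)" and "v = sqrt (data f2 h2 t')"
    have uv: "u \<ge> 0" "v \<ge> 0" "u\<^sup>2 = data f2 h2 t" "v\<^sup>2 = data f2 h2 t'"
      using data_nonneg by (auto simp: u_def v_def)
    define W where "W = (norm (wr f1 h1 f2 h2 0))\<^sup>2"
    define V where "V s = f1 (t + s) * h1 (t' + s) - h1 (t + s) * f1 (t' + s)" for s
    define V' where "V' s = of_real (a (t + s) - a (t' + s)) * (h1 (t + s) * h1 (t' + s)) + (Q (t' + s) - Q (t + s)) * (f1 (t + s) * f1 (t' + s))" for s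
    have \<delta>: "\<delta> \<ge> 0" using da[of 0] by linarith
    note cf = inhom_cont(1)[OF 1(1)] and ch = inhom_cont(2)[OF 1(1)]
    note sh = continuous_on_shift
    have fd: "((\<lambda>s. f1 (x + s)) has_vector_derivative of_real (a (x + s)) * h1 (x + s)) (at s)" for x s
      by (rule has_vector_derivative_shift[OF inhomD(1)[OF 1(1)]])
    have hd: "((\<lambda>s. h1 (x + s)) has_vector_derivative Q (x + s) * f1 (x + s) - 0) (at s)" for x s
      by (rule has_vector_derivative_shift[OF inhomD(2)[OF 1(1)]])
    have Vd: "(V has_vector_derivative V' s) (at s)" for s
      unfolding V_def V'_def
      using has_vector_derivative_diff[OF has_vector_derivative_mult[OF fd[of t s] hd[of t' s]] has_vector_derivative_mult[OF hd[of t s] fd[of t' s]]]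
      by (simp add: algebra_simps)
    have Vc: "continuous_on UNIV V" unfolding V_def by (intro continuous_intros sh cf ch)
    have V'c: "continuous_on UNIV V'" unfolding V'_def
      by (intro continuous_intros sh cf ch a_cont Q_cont)
    define N where "N x s = data f1 h1 (x + s)" for x s
    have Nc: "continuous_on UNIV (N x)" for x unfolding N_def by (intro sh data_cont cf ch)
    have Nint: "integral {0..y} (N x) = integral {x..x + y} (data f1 h1)" for x y
      unfolding N_def using integral_shift_0[OF data_cont[OF cf ch], of x y] by (simp add: add.commute)
    have Nle: "data f2 h2 x * integral {0..y} (N x) \<le> C' * W" for x y
      using C'(2)[OF 1 2, of x "x + y"] unfolding Nint W_def wr_const[OF 1(1) 2(1), of x 0] .
    have pw: "u * v * norm (V' s) \<le> \<delta> / 2 * (u\<^sup>2 * N t s + v\<^sup>2 * N t' s)" for s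
    proof -
      define F F' H H' where "F = norm (f1 (t + s))" "F' = norm (f1 (t' + s))" "H = norm (h1 (t + s))" "H' = norm (h1 (t' + s))"
      have "norm (V' s) \<le> \<delta> * (H * H') + \<delta> * (F * F')"
        unfolding V'_def
      proof (rule order_trans[OF norm_triangle_ineq add_mono])
        show "norm (complex_of_real (a (t + s) - a (t' + s)) * (h1 (t + s) * h1 (t' + s))) \<le> \<delta> * (H * H')"
          using mult_right_mono[OF da[of s], of "H * H'"] by (simp add: norm_mult F_F'_H_H'_def del: of_real_diff)
        show "norm ((Q (t' + s) - Q (t + s)) * (f1 (t + s) * f1 (t' + s))) \<le> \<delta> * (F * F')"
          using mult_right_mono[OF dQ[of s], of "F * F'"] by (simp add: norm_mult F_F'_H_H'_def norm_minus_commute)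
      qed
      then have "u * v * norm (V' s) \<le> u * v * (\<delta> * (H * H') + \<delta> * (F * F'))" using uv by (intro mult_left_mono) auto
      also have "\<dots> = \<delta> / 2 * (2 * (u * H) * (v * H') + 2 * (u * F) * (v * F'))" by (simp add: algebra_simps)
      \<comment> \<open>The arithmetic-geometric mean separates the two translates, each with the
        weight under which \<open>right_decay\<close> bounds its integral.\<close>
      also have "\<dots> \<le> \<delta> / 2 * (((u * H)\<^sup>2 + (v * H')\<^sup>2) + ((u * F)\<^sup>2 + (v * F')\<^sup>2))"
        using \<delta> by (intro mult_left_mono add_mono sum_squares_bound) auto
      also have "\<dots> = \<delta> / 2 * (u\<^sup>2 * N t s + v\<^sup>2 * N t' s)"
        by (simp add: N_def data_def F_F'_H_H'_def power_mult_distrib algebra_simps)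
      finally show ?thesis .
    qed
    have step: "u * v * norm (V 0) \<le> u * v * norm (V y) + \<delta> * (C' * W)" if "y \<ge> 0" for y
    proof -
      have "(V' has_integral (V y - V 0)) {0..y}"
        by (rule fundamental_theorem_of_calculus[OF that]) (rule has_vector_derivative_at_within[OF Vd])
      then have VV: "V y - V 0 = integral {0..y} V'" by (simp add: integral_unique)
      have gint: "integral {0..y} (\<lambda>s. \<delta> / 2 * (u\<^sup>2 * N t s + v\<^sup>2 * N t' s)) = \<delta> / 2 * (u\<^sup>2 * integral {0..y} (N t) + v\<^sup>2 * integral {0..y} (N t'))"
        using Nc by (simp add: integral_add integrable_cont continuous_on_mult continuous_on_const)
      have "norm (integral {0..y} (\<lambda>s. of_real (u * v) * V' s)) \<le> integral {0..y} (\<lambda>s. \<delta> / 2 * (u\<^sup>2 * N t s + v\<^sup>2 * N t' s))"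
      proof (rule Henstock_Kurzweil_Integration.integral_norm_bound_integral)
        show "(\<lambda>s. complex_of_real (u * v) * V' s) integrable_on {0..y}"
          by (intro integrable_cont continuous_on_mult continuous_on_const V'c)
        show "(\<lambda>s. \<delta> / 2 * (u\<^sup>2 * N t s + v\<^sup>2 * N t' s)) integrable_on {0..y}"
          by (intro integrable_cont continuous_on_mult continuous_on_add continuous_on_const Nc)
        show "norm (complex_of_real (u * v) * V' s) \<le> \<delta> / 2 * (u\<^sup>2 * N t s + v\<^sup>2 * N t' s)" for s
          using pw[of s] uv by (simp add: norm_mult)
      qed
      then have "u * v * norm (V y - V 0) \<le> \<delta> / 2 * (u\<^sup>2 * integral {0..y} (N t) + v\<^sup>2 * integral {0..y} (N t'))"
        unfolding gint VV using uv by (simp add: norm_mult)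
      also have "\<dots> \<le> \<delta> / 2 * (C' * W + C' * W)"
        unfolding uv(3,4) using \<delta> by (intro mult_left_mono add_mono Nle) auto
      finally have "u * v * norm (V y - V 0) \<le> \<delta> * (C' * W)" by simp
      moreover have "norm (V 0) \<le> norm (V y) + norm (V y - V 0)"
        using norm_triangle_ineq4[of "V y" "V y - V 0"] by simp
      then have "u * v * norm (V 0) \<le> u * v * (norm (V y) + norm (V y - V 0))" using uv by (intro mult_left_mono) auto
      ultimately show ?thesis by (simp add: algebra_simps)
    qed
    have "u * v * norm (V 0) \<le> \<delta> * (C' * W)"
    proof (rule field_le_epsilon)
      fix e :: real assume e: "e > 0"
      define e' where "e' = e / (u * v + 1)"
      have e': "e' > 0" using e uv by (simp add: e'_def add_nonneg_pos)
      obtain B where B: "\<And>x y. min t t' \<le> x \<Longrightarrow> integral {x..y} (data f1 h1) \<le> B"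
        by (rule L2_right_data[OF 1]) blast
      \<comment> \<open>The inequality \<open>step\<close> holds for each y \<ge> 0, so one point at
        which V is below e' closes the estimate.\<close>
      obtain y where y: "y \<ge> 0" "norm (V y) < e'"
      proof (rule eventually_small_of_L2[OF Vc _ _ _ e', of "\<lambda>s. N t s + N t' s" "B + B"])
        show "norm (V x) \<le> N t x + N t' x" for x unfolding V_def N_def by (rule norm_wr_le)
        show "continuous_on UNIV (\<lambda>s. N t s + N t' s)" by (intro continuous_on_add Nc)
        show "integral {0..y} (\<lambda>s. N t s + N t' s) \<le> B + B" for y
          using B[of t "t + y"] B[of t' "t' + y"] by (simp add: integral_add integrable_cont Nc Nint)
      qed blast
      have "u * v * norm (V y) \<le> u * v * e'" using uv y by (intro mult_left_mono) auto
      also have "\<dots> \<le> (u * v + 1) * e'" using e' by (intro mult_right_mono) auto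
      also have "\<dots> = e" using uv by (simp add: e'_def add_nonneg_eq_0_iff)
      finally show "u * v * norm (V 0) \<le> \<delta> * (C' * W) + e" using step[OF y(1)] by linarith
    qed
    then show ?thesis by (simp add: u_def v_def V_def W_def)
  qed
  with C'(1) that show ?thesis by blast
qed

text \<open>Reflection exchanges the roles of the two solutions. The sign from the reversed
  quasi-derivatives and the sign from the exchange cancel in the Wronskian.\<close>

lemma left_perturbation:
  obtains C' where "C' > 0" "\<And>f1 h1 f2 h2 t t' \<delta>. sol f1 h1 \<Longrightarrow> L2_right f1 \<Longrightarrow> sol f2 h2 \<Longrightarrow> L2_left f2 \<Longrightarrow>
    (\<And>s. \<bar>a (t + s) - a (t' + s)\<bar> \<le> \<delta>) \<Longrightarrow> (\<And>s. norm (Q (t + s) - Q (t' + s)) \<le> \<delta>) \<Longrightarrow>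
    sqrt (data f1 h1 t) * sqrt (data f1 h1 t') * norm (f2 t * h2 t' - h2 t * f2 t') \<le> \<delta> * (C' * (norm (wr f1 h1 f2 h2 0))\<^sup>2)"
proof -
  interpret R: sl_resolvent "\<lambda>x. a (- x)" "\<lambda>x. Q (- x)" a0 K C by (rule sl_resolvent_reflect)
  obtain C' where C': "C' > 0" "\<And>f1 h1 f2 h2 t t' \<delta>. R.sol f1 h1 \<Longrightarrow> L2_right f1 \<Longrightarrow> R.sol f2 h2 \<Longrightarrow> L2_left f2 \<Longrightarrow>
    (\<And>s. \<bar>a (- (t + s)) - a (- (t' + s))\<bar> \<le> \<delta>) \<Longrightarrow> (\<And>s. norm (Q (- (t + s)) - Q (- (t' + s))) \<le> \<delta>) \<Longrightarrow>
    sqrt (R.data f2 h2 t) * sqrt (R.data f2 h2 t') * norm (f1 t * h1 t' - h1 t * f1 t') \<le> \<delta> * (C' * (norm (R.wr f1 h1 f2 h2 0))\<^sup>2)"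
    by (rule R.right_perturbation) blast
  have "sqrt (data f1 h1 t) * sqrt (data f1 h1 t') * norm (f2 t * h2 t' - h2 t * f2 t') \<le> \<delta> * (C' * (norm (wr f1 h1 f2 h2 0))\<^sup>2)"
    if s: "sol f1 h1" "L2_right f1" "sol f2 h2" "L2_left f2"
      and da: "\<And>s. \<bar>a (t + s) - a (t' + s)\<bar> \<le> \<delta>" and dQ: "\<And>s. norm (Q (t + s) - Q (t' + s)) \<le> \<delta>"
    for f1 h1 f2 h2 t t' \<delta>
  proof -
    have da': "\<bar>a (- (- t + s)) - a (- (- t' + s))\<bar> \<le> \<delta>" for s using da[of "- s"] by simp
    have dQ': "norm (Q (- (- t + s)) - Q (- (- t' + s))) \<le> \<delta>" for s using dQ[of "- s"] by simp
    have "sqrt (R.data (\<lambda>x. f1 (- x)) (\<lambda>x. - h1 (- x)) (- t)) * sqrt (R.data (\<lambda>x. f1 (- x)) (\<lambda>x. - h1 (- x)) (- t')) *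
      norm (f2 (- (- t)) * - h2 (- (- t')) - - h2 (- (- t)) * f2 (- (- t'))) \<le>
      \<delta> * (C' * (norm (R.wr (\<lambda>x. f2 (- x)) (\<lambda>x. - h2 (- x)) (\<lambda>x. f1 (- x)) (\<lambda>x. - h1 (- x)) 0))\<^sup>2)"
      by (rule C'(2)[OF _ _ _ _ da' dQ'])
        (use s inhom_reflect[OF s(1)] inhom_reflect[OF s(3)] in \<open>auto simp: L2_left_def\<close>)
    moreover have "norm (f2 (- (- t)) * - h2 (- (- t')) - - h2 (- (- t)) * f2 (- (- t'))) = norm (f2 t * h2 t' - h2 t * f2 t')"
      using norm_minus_cancel[of "f2 t * h2 t' - h2 t * f2 t'"] by (simp add: algebra_simps)
    moreover have "R.wr (\<lambda>x. f2 (- x)) (\<lambda>x. - h2 (- x)) (\<lambda>x. f1 (- x)) (\<lambda>x. - h1 (- x)) 0 = wr f1 h1 f2 h2 0"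
      by (simp add: R.wr_def wr_def algebra_simps)
    ultimately show ?thesis by (simp add: R.data_def data_def)
  qed
  with C'(1) that show ?thesis by blast
qed

text \<open>Multiply the difference by the Wronskian, written at t' in one term and at t in the
  other. What remains is a combination of the two quantities bounded in the perturbation lemmas,
  with coefficients controlled by their weights. The squared Wronskian there pays for both
  divisions, so L does not depend on how the solutions are normalised.\<close>

theorem diagonal_green_lipschitz:
  assumes 1: "sol f1 h1" "L2_right f1" and 2: "sol f2 h2" "L2_left f2" and W: "wr f1 h1 f2 h2 0 \<noteq> 0"
  obtains L where "L > 0"
    "\<And>t t' \<delta>. (\<And>s. \<bar>a (t + s) - a (t' + s)\<bar> \<le> \<delta>) \<Longrightarrow> (\<And>s. norm (Q (t + s) - Q (t' + s)) \<le> \<delta>) \<Longrightarrow>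
      norm (f1 t * f2 t / wr f1 h1 f2 h2 0 - f1 t' * f2 t' / wr f1 h1 f2 h2 0) \<le> L * \<delta>"
    "\<And>t t' \<delta>. (\<And>s. \<bar>a (t + s) - a (t' + s)\<bar> \<le> \<delta>) \<Longrightarrow> (\<And>s. norm (Q (t + s) - Q (t' + s)) \<le> \<delta>) \<Longrightarrow>
      norm ((f1 t * h2 t + h1 t * f2 t) / wr f1 h1 f2 h2 0 - (f1 t' * h2 t' + h1 t' * f2 t') / wr f1 h1 f2 h2 0) \<le> L * \<delta>"
proof -
  obtain C1 where C1: "C1 > 0" "\<And>f1 h1 f2 h2 t t' \<delta>. sol f1 h1 \<Longrightarrow> L2_right f1 \<Longrightarrow> sol f2 h2 \<Longrightarrow> L2_left f2 \<Longrightarrow>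
    (\<And>s. \<bar>a (t + s) - a (t' + s)\<bar> \<le> \<delta>) \<Longrightarrow> (\<And>s. norm (Q (t + s) - Q (t' + s)) \<le> \<delta>) \<Longrightarrow>
    sqrt (data f2 h2 t) * sqrt (data f2 h2 t') * norm (f1 t * h1 t' - h1 t * f1 t') \<le> \<delta> * (C1 * (norm (wr f1 h1 f2 h2 0))\<^sup>2)"
    by (rule right_perturbation) blast
  obtain C2 where C2: "C2 > 0" "\<And>f1 h1 f2 h2 t t' \<delta>. sol f1 h1 \<Longrightarrow> L2_right f1 \<Longrightarrow> sol f2 h2 \<Longrightarrow> L2_left f2 \<Longrightarrow>
    (\<And>s. \<bar>a (t + s) - a (t' + s)\<bar> \<le> \<delta>) \<Longrightarrow> (\<And>s. norm (Q (t + s) - Q (t' + s)) \<le> \<delta>) \<Longrightarrow>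
    sqrt (data f1 h1 t) * sqrt (data f1 h1 t') * norm (f2 t * h2 t' - h2 t * f2 t') \<le> \<delta> * (C2 * (norm (wr f1 h1 f2 h2 0))\<^sup>2)"
    by (rule left_perturbation) blast
  define w where "w = wr f1 h1 f2 h2 0"
  have wt: "f1 t * h2 t - h1 t * f2 t = w" for t
    using wr_const[OF 1(1) 2(1), of t 0] unfolding w_def wr_def .
  have comp: "norm (f x) \<le> sqrt (data f h x)" "norm (h x) \<le> sqrt (data f h x)" for f h x
    unfolding data_def by (rule real_le_rsqrt; simp)+
  have prod: "norm (p * q) \<le> A * B" if "norm p \<le> A" "norm q \<le> B" for p q :: complex and A B
    unfolding norm_mult using that by (intro mult_mono) (auto intro: order_trans[OF norm_ge_zero])
  define L where "L = 2 * (C1 + C2)"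
  have main: "norm (f1 t * f2 t / w - f1 t' * f2 t' / w) \<le> L * \<delta> \<and>
      norm ((f1 t * h2 t + h1 t * f2 t) / w - (f1 t' * h2 t' + h1 t' * f2 t') / w) \<le> L * \<delta>"
    if da: "\<And>s. \<bar>a (t + s) - a (t' + s)\<bar> \<le> \<delta>" and dQ: "\<And>s. norm (Q (t + s) - Q (t' + s)) \<le> \<delta>" for t t' \<delta>
  proof -
    define V1 where "V1 = f1 t * h1 t' - h1 t * f1 t'"
    define V2 where "V2 = f2 t * h2 t' - h2 t * f2 t'"
    define S1 where "S1 = sqrt (data f1 h1 t) * sqrt (data f1 h1 t')"
    define S2 where "S2 = sqrt (data f2 h2 t) * sqrt (data f2 h2 t')"
    define n where "n = norm w"
    have n: "n > 0" using W by (simp add: n_def w_def)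
    have \<delta>: "\<delta> \<ge> 0" using da[of 0] by linarith
    have B1: "S2 * norm V1 \<le> \<delta> * (C1 * n\<^sup>2)" and B2: "S1 * norm V2 \<le> \<delta> * (C2 * n\<^sup>2)"
      unfolding S1_def S2_def V1_def V2_def n_def w_def by (rule C1(2)[OF 1 2 da dQ], rule C2(2)[OF 1 2 da dQ])
    \<comment> \<open>Common to both claims; the factor 2 allows for the coefficients of the second
      claim, which are sums of two products.\<close>
    have fin: "norm (x / w - y / w) \<le> L * \<delta>"
      if eq: "w * (x - y) = - (P * V1) + R * V2" and PR: "norm P \<le> 2 * S2" "norm R \<le> 2 * S1" for x y P R
    proof -
      have "n * norm (x - y) = norm (- (P * V1) + R * V2)" unfolding n_def norm_mult[symmetric] eq ..
      also have "\<dots> \<le> norm P * norm V1 + norm R * norm V2"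
        by (rule order_trans[OF norm_triangle_ineq]) (simp add: norm_mult)
      also have "\<dots> \<le> 2 * S2 * norm V1 + 2 * S1 * norm V2" by (intro add_mono mult_right_mono PR) auto
      also have "\<dots> \<le> 2 * (\<delta> * (C1 * n\<^sup>2)) + 2 * (\<delta> * (C2 * n\<^sup>2))" using B1 B2 by linarith
      also have "\<dots> = n * (n * (L * \<delta>))" by (simp add: L_def power2_eq_square algebra_simps)
      finally have "norm (x - y) \<le> n * (L * \<delta>)" using n by simp
      then show ?thesis unfolding diff_divide_distrib[symmetric] norm_divide n_def[symmetric]
        using n by (simp add: pos_divide_le_eq mult.commute)
    qed
    have S0: "S1 \<ge> 0" "S2 \<ge> 0" using data_nonneg by (auto simp: S1_def S2_def)
    have P2: "norm (x * y) \<le> S2" if "x \<in> {f2 t, h2 t}" "y \<in> {f2 t', h2 t'}" for x y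
      unfolding S2_def using that comp by (intro prod) auto
    have P1: "norm (x * y) \<le> S1" if "x \<in> {f1 t, h1 t}" "y \<in> {f1 t', h1 t'}" for x y
      unfolding S1_def using that comp by (intro prod) auto
    have "norm (f1 t * f2 t / w - f1 t' * f2 t' / w) \<le> L * \<delta>"
    proof (rule fin)
      have "w * (f1 t * f2 t - f1 t' * f2 t') = (f1 t' * h2 t' - h1 t' * f2 t') * (f1 t * f2 t) - (f1 t * h2 t - h1 t * f2 t) * (f1 t' * f2 t')"
        unfolding wt by (simp add: algebra_simps)
      also have "\<dots> = - ((f2 t * f2 t') * V1) + (f1 t * f1 t') * V2"
        unfolding V1_def V2_def by (simp add: algebra_simps)
      finally show "w * (f1 t * f2 t - f1 t' * f2 t') = - ((f2 t * f2 t') * V1) + (f1 t * f1 t') * V2" .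
      show "norm (f2 t * f2 t') \<le> 2 * S2" using P2[of "f2 t" "f2 t'"] S0 by simp
      show "norm (f1 t * f1 t') \<le> 2 * S1" using P1[of "f1 t" "f1 t'"] S0 by simp
    qed
    moreover have "norm ((f1 t * h2 t + h1 t * f2 t) / w - (f1 t' * h2 t' + h1 t' * f2 t') / w) \<le> L * \<delta>"
    proof (rule fin)
      have "w * ((f1 t * h2 t + h1 t * f2 t) - (f1 t' * h2 t' + h1 t' * f2 t')) =
          (f1 t' * h2 t' - h1 t' * f2 t') * (f1 t * h2 t + h1 t * f2 t) - (f1 t * h2 t - h1 t * f2 t) * (f1 t' * h2 t' + h1 t' * f2 t')"
        unfolding wt by (simp add: algebra_simps)
      also have "\<dots> = - ((f2 t * h2 t' + h2 t * f2 t') * V1) + (f1 t * h1 t' + h1 t * f1 t') * V2"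
        unfolding V1_def V2_def by (simp add: algebra_simps)
      finally show "w * ((f1 t * h2 t + h1 t * f2 t) - (f1 t' * h2 t' + h1 t' * f2 t')) =
          - ((f2 t * h2 t' + h2 t * f2 t') * V1) + (f1 t * h1 t' + h1 t * f1 t') * V2" .
      show "norm (f2 t * h2 t' + h2 t * f2 t') \<le> 2 * S2"
        using norm_triangle_ineq[of "f2 t * h2 t'" "h2 t * f2 t'"] P2[of "f2 t" "h2 t'"] P2[of "h2 t" "f2 t'"] by simp
      show "norm (f1 t * h1 t' + h1 t * f1 t') \<le> 2 * S1"
        using norm_triangle_ineq[of "f1 t * h1 t'" "h1 t * f1 t'"] P1[of "f1 t" "h1 t'"] P1[of "h1 t" "f1 t'"] by simp
    qed
    ultimately show ?thesis by blast
  qed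
  have "L > 0" using C1 C2 by (simp add: L_def)
  then show ?thesis using that[of L] main unfolding w_def by blast
qed

end

section \<open>Absolutely continuous functions\<close>

lemma loc_abs_contD:
  assumes "loc_abs_cont f" "e > 0"
  obtains d where "d > 0" "\<And>(n::nat) s t. (\<forall>i<n. a \<le> s i \<and> s i \<le> t i \<and> t i \<le> b) \<Longrightarrow>
     disjoint_family_on (\<lambda>i. {s i<..<t i}) {..<n} \<Longrightarrow> (\<Sum>i<n. t i - s i) < d \<Longrightarrow>
     (\<Sum>i<n. norm (f (t i) - f (s i))) < e"
proof -
  obtain d where d: "d > 0" "\<forall>(n::nat) s t. (\<forall>i<n. a \<le> s i \<and> s i \<le> t i \<and> t i \<le> b) \<longrightarrow>
     disjoint_family_on (\<lambda>i. {s i<..<t i}) {..<n} \<longrightarrow> (\<Sum>i<n. t i - s i) < d \<longrightarrow>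
     (\<Sum>i<n. norm (f (t i) - f (s i))) < e"
    using assms(1)[unfolded loc_abs_cont_def, THEN spec[of _ a], THEN spec[of _ b], THEN spec[of _ e], THEN mp, OF assms(2)]
    by (elim exE conjE)
  show ?thesis by (rule that[OF d(1)], rule d(2)[rule_format]) auto
qed

lemma loc_abs_cont_continuous:
  assumes "loc_abs_cont f"
  shows "continuous_on UNIV f"
  unfolding continuous_on_iff
proof (intro ballI allI impI)
  fix x e :: real assume "e > 0"
  then obtain d where d: "d > 0" "\<And>(n::nat) s t. (\<forall>i<n. x - 1 \<le> s i \<and> s i \<le> t i \<and> t i \<le> x + 1) \<Longrightarrow>
     disjoint_family_on (\<lambda>i. {s i<..<t i}) {..<n} \<Longrightarrow> (\<Sum>i<n. t i - s i) < d \<Longrightarrow>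
     (\<Sum>i<n. norm (f (t i) - f (s i))) < e"
    by (rule loc_abs_contD[OF assms, where a = "x - 1" and b = "x + 1"]) blast
  have "dist (f y) (f x) < e" if "dist y x < min d 1" for y
  proof -
    have "(\<Sum>i<Suc 0. norm (f (max x y) - f (min x y))) < e"
      by (rule d(2)) (use that in \<open>auto simp: dist_real_def disjoint_family_on_def\<close>)
    then have "norm (f (max x y) - f (min x y)) < e" by simp
    then show ?thesis by (cases "x \<le> y") (auto simp: dist_norm norm_minus_commute max_def min_def)
  qed
  then show "\<exists>d>0. \<forall>y\<in>UNIV. dist y x < d \<longrightarrow> dist (f y) (f x) < e"
    using d(1) by (intro exI[of _ "min d 1"]) auto
qed

lemma loc_abs_cont_diff:
  assumes f: "loc_abs_cont f" and g: "loc_abs_cont g"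
  shows "loc_abs_cont (\<lambda>x. f x - g x)"
  unfolding loc_abs_cont_def
proof (intro allI impI)
  fix a b e :: real assume "e > 0"
  then have e2: "e/2 > 0" by simp
  obtain d1 where d1: "d1 > 0" "\<And>(n::nat) s t. (\<forall>i<n. a \<le> s i \<and> s i \<le> t i \<and> t i \<le> b) \<Longrightarrow>
     disjoint_family_on (\<lambda>i. {s i<..<t i}) {..<n} \<Longrightarrow> (\<Sum>i<n. t i - s i) < d1 \<Longrightarrow>
     (\<Sum>i<n. norm (f (t i) - f (s i))) < e/2"
    by (rule loc_abs_contD[OF f e2, where a = a and b = b]) blast
  obtain d2 where d2: "d2 > 0" "\<And>(n::nat) s t. (\<forall>i<n. a \<le> s i \<and> s i \<le> t i \<and> t i \<le> b) \<Longrightarrow>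
     disjoint_family_on (\<lambda>i. {s i<..<t i}) {..<n} \<Longrightarrow> (\<Sum>i<n. t i - s i) < d2 \<Longrightarrow>
     (\<Sum>i<n. norm (g (t i) - g (s i))) < e/2"
    by (rule loc_abs_contD[OF g e2, where a = a and b = b]) blast
  show "\<exists>\<delta>>0. \<forall>(n::nat) s t. (\<forall>i<n. a \<le> s i \<and> s i \<le> t i \<and> t i \<le> b) \<longrightarrow>
     disjoint_family_on (\<lambda>i. {s i<..<t i}) {..<n} \<longrightarrow> (\<Sum>i<n. t i - s i) < \<delta> \<longrightarrow>
     (\<Sum>i<n. norm (f (t i) - g (t i) - (f (s i) - g (s i)))) < e"
  proof (intro exI[of _ "min d1 d2"] conjI allI impI)
    show "min d1 d2 > 0" using d1(1) d2(1) by simp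
    fix n :: nat and s t
    assume h: "\<forall>i<n. a \<le> s i \<and> s i \<le> t i \<and> t i \<le> b" "disjoint_family_on (\<lambda>i. {s i<..<t i}) {..<n}"
      and h3: "(\<Sum>i<n. t i - s i) < min d1 d2"
    have "(\<Sum>i<n. norm (f (t i) - g (t i) - (f (s i) - g (s i)))) \<le> (\<Sum>i<n. norm (f (t i) - f (s i)) + norm (g (t i) - g (s i)))"
    proof (rule sum_mono)
      fix i
      show "norm (f (t i) - g (t i) - (f (s i) - g (s i))) \<le> norm (f (t i) - f (s i)) + norm (g (t i) - g (s i))"
        using norm_triangle_ineq4[of "f (t i) - f (s i)" "g (t i) - g (s i)"] by (simp add: algebra_simps)
    qed
    also have "\<dots> = (\<Sum>i<n. norm (f (t i) - f (s i))) + (\<Sum>i<n. norm (g (t i) - g (s i)))" by (rule sum.distrib)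
    also have "\<dots> < e" using d1(2)[OF h] d2(2)[OF h] h3 by simp
    finally show "(\<Sum>i<n. norm (f (t i) - g (t i) - (f (s i) - g (s i)))) < e" .
  qed
qed

lemma loc_abs_cont_C1:
  assumes der: "\<And>x. (f has_vector_derivative f' x) (at x)" and cont: "continuous_on UNIV f'"
  shows "loc_abs_cont f"
  unfolding loc_abs_cont_def
proof (intro allI impI)
  fix a b e :: real assume e: "e > 0"
  have "bounded (f' ` {a..b})"
    by (intro compact_imp_bounded compact_continuous_image continuous_on_subset[OF cont]) auto
  then obtain B where B: "B > 0" "\<And>x. x \<in> {a..b} \<Longrightarrow> norm (f' x) \<le> B"
    unfolding bounded_pos by auto
  have lip: "norm (f v - f u) \<le> B * (v - u)" if "a \<le> u" "u \<le> v" "v \<le> b" for u v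
  proof -
    have "(f' has_integral (f v - f u)) {u..v}"
      by (rule fundamental_theorem_of_calculus[OF that(2)]) (rule has_vector_derivative_at_within[OF der])
    then have "f v - f u = integral {u..v} f'" by (simp add: integral_unique)
    also have "norm \<dots> \<le> B * (v - u)"
      by (rule integral_bound[OF that(2) continuous_on_subset[OF cont]]) (use that B in auto)
    finally show ?thesis .
  qed
  show "\<exists>\<delta>>0. \<forall>(n::nat) s t. (\<forall>i<n. a \<le> s i \<and> s i \<le> t i \<and> t i \<le> b) \<longrightarrow>
     disjoint_family_on (\<lambda>i. {s i<..<t i}) {..<n} \<longrightarrow> (\<Sum>i<n. t i - s i) < \<delta> \<longrightarrow>
     (\<Sum>i<n. norm (f (t i) - f (s i))) < e"
  proof (intro exI[of _ "e / B"] conjI allI impI)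
    show "e / B > 0" using e B by simp
    fix n :: nat and s t
    assume h: "\<forall>i<n. a \<le> s i \<and> s i \<le> t i \<and> t i \<le> b" "(\<Sum>i<n. t i - s i) < e / B"
    have "(\<Sum>i<n. norm (f (t i) - f (s i))) \<le> (\<Sum>i<n. B * (t i - s i))"
      by (intro sum_mono lip) (use h in auto)
    also have "\<dots> = B * (\<Sum>i<n. t i - s i)" by (simp add: sum_distrib_left)
    also have "\<dots> < B * (e / B)" using h(2) B by (intro mult_strict_left_mono) auto
    finally show "(\<Sum>i<n. norm (f (t i) - f (s i))) < e" using B by simp
  qed
qed

text \<open>Cousin's lemma: the tagged intervals with tag in the exceptional null set lie in an open
  set of small measure and are handled by absolute continuity.\<close>

lemma loc_abs_cont_zero_derivative:
  assumes lac: "loc_abs_cont f" and ae: "AE x in lebesgue. (f has_vector_derivative 0) (at x)" and ab: "a \<le> b"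
  shows "f b = f a"
proof -
  define N where "N = {x. \<not> (f has_vector_derivative 0) (at x)}"
  have "\<exists>N'\<in>null_sets lebesgue. N \<subseteq> N'"
    using ae unfolding eventually_ae_filter N_def by auto
  then have Nneg: "negligible N" using negligible_iff_null_sets negligible_subset by blast
  then have Nm: "N \<in> lmeasurable" "measure lebesgue N = 0"
    by (simp_all add: negligible_imp_measurable negligible_imp_measure0)
  have small: "norm (f b - f a) \<le> e * (b - a) + e" if e: "e > 0" for e
  proof -
    obtain d where d: "d > 0" "\<And>(n::nat) s t. (\<forall>i<n. a \<le> s i \<and> s i \<le> t i \<and> t i \<le> b) \<Longrightarrow>
       disjoint_family_on (\<lambda>i. {s i<..<t i}) {..<n} \<Longrightarrow> (\<Sum>i<n. t i - s i) < d \<Longrightarrow>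
       (\<Sum>i<n. norm (f (t i) - f (s i))) < e"
      by (rule loc_abs_contD[OF lac e, where a = a and b = b]) blast
    obtain U where U0: "open U" "N \<subseteq> U" "U - N \<in> lmeasurable" "emeasure lebesgue (U - N) < ennreal d"
      by (rule sets_lebesgue_outer_open[OF fmeasurableD[OF Nm(1)] d(1)])
    have UN: "(U - N) \<union> N = U" using U0(2) by blast
    have "measure lebesgue (U - N) < d"
      using U0(4) emeasure_eq_measure2[OF U0(3)] d(1) by (simp add: ennreal_less_iff)
    then have "measure lebesgue ((U - N) \<union> N) < d"
      using measure_Un_le[OF fmeasurableD[OF U0(3)] fmeasurableD[OF Nm(1)]] Nm(2) by simp
    with U0(1,2) fmeasurable.Un[OF U0(3) Nm(1)]
    have U: "open U" "N \<subseteq> U" "U \<in> lmeasurable" "measure lebesgue U < d" unfolding UN by auto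
    have "\<exists>r>0. \<forall>y. \<bar>y - x\<bar> < r \<longrightarrow> norm (f y - f x) \<le> e * \<bar>y - x\<bar>" if "x \<notin> N" for x
    proof -
      have "(f has_derivative (\<lambda>h. 0)) (at x)" using that by (simp add: N_def has_vector_derivative_def)
      then show ?thesis using e unfolding has_derivative_at_alt by auto
    qed
    then have "\<forall>x. \<exists>r. x \<notin> N \<longrightarrow> r > 0 \<and> (\<forall>y. \<bar>y - x\<bar> < r \<longrightarrow> norm (f y - f x) \<le> e * \<bar>y - x\<bar>)" by blast
    from choice[OF this] obtain r where r: "\<And>x. x \<notin> N \<Longrightarrow> r x > 0"
      "\<And>x y. x \<notin> N \<Longrightarrow> \<bar>y - x\<bar> < r x \<Longrightarrow> norm (f y - f x) \<le> e * \<bar>y - x\<bar>" by blast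
    define \<gamma> where "\<gamma> x = (if x \<in> N then U else ball x (r x))" for x
    have "gauge \<gamma>" using U r(1) by (auto simp: gauge_def \<gamma>_def)
    then obtain D where D: "D tagged_division_of {a..b}" "\<gamma> fine D"
      using fine_division_exists_real by blast
    have Dfin: "finite D" using D(1) by blast
    have Dk: "\<exists>u v. k = {u..v} \<and> u \<le> v \<and> a \<le> u \<and> v \<le> b \<and> x \<in> k" if xk: "(x, k) \<in> D" for x k
    proof -
      obtain u v where "k = {u..v}" using tagged_division_ofD(4)[OF D(1) xk] by auto
      moreover have "x \<in> k" "k \<subseteq> {a..b}" using tagged_division_ofD(2,3)[OF D(1) xk] by auto
      ultimately show ?thesis by auto
    qed
    define F where "F = (\<lambda>(x::real, k::real set). f (Sup k) - f (Inf k))"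
    define len where "len = (\<lambda>(x::real, k::real set). Sup k - Inf k)"
    define D1 where "D1 = {xk \<in> D. fst xk \<in> N}"
    have D1: "D1 \<subseteq> D" "finite D1" using Dfin by (auto simp: D1_def)
    have total: "f b - f a = (\<Sum>xk\<in>D. F xk)"
      using additive_tagged_division_1[OF ab D(1), of f] by (simp add: F_def)
    have lensum: "(\<Sum>xk\<in>D. len xk) = b - a"
      using additive_tagged_division_1[OF ab D(1), of "\<lambda>x. x"] by (simp add: len_def)
    have len0: "len xk \<ge> 0" if "xk \<in> D" for xk
      using that Dk by (cases xk) (fastforce simp: len_def)
    have good: "norm (F xk) \<le> e * len xk" if xkD: "xk \<in> D - D1" for xk
    proof -
      obtain x k where xk: "xk = (x, k)" "(x, k) \<in> D" "x \<notin> N" using xkD by (cases xk) (auto simp: D1_def)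
      obtain u v where k: "k = {u..v}" "u \<le> v" "x \<in> k" using Dk[OF xk(2)] by blast
      have "k \<subseteq> ball x (r x)" using fineD[OF D(2) xk(2)] xk(3) by (simp add: \<gamma>_def)
      moreover have "u \<in> k" "v \<in> k" using k by auto
      ultimately have "u \<in> ball x (r x)" "v \<in> ball x (r x)" by blast+
      then have "\<bar>u - x\<bar> < r x" "\<bar>v - x\<bar> < r x" by (simp_all add: dist_real_def abs_minus_commute)
      then have "norm (f u - f x) \<le> e * \<bar>u - x\<bar>" "norm (f v - f x) \<le> e * \<bar>v - x\<bar>" using r(2)[OF xk(3)] by blast+
      moreover have "norm (f v - f u) \<le> norm (f v - f x) + norm (f u - f x)"
        using norm_triangle_ineq4[of "f v - f x" "f u - f x"] by simp
      moreover have "\<bar>u - x\<bar> = x - u" "\<bar>v - x\<bar> = v - x" using k by auto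
      ultimately have "norm (f v - f u) \<le> e * (v - u)" by (simp add: algebra_simps)
      then show ?thesis using k by (simp add: xk F_def len_def)
    qed
    have bad: "(\<Sum>xk\<in>D1. norm (F xk)) < e"
    proof -
      define n where "n = card D1"
      \<comment> \<open>Absolute continuity speaks of families indexed below n, hence the
        enumeration. The tagged intervals may share endpoints, but their interiors are disjoint,
        which is what \<open>loc_abs_cont\<close> asks for.\<close>
      obtain \<pi> where \<pi>: "bij_betw \<pi> {..<n} D1" using ex_bij_betw_nat_finite[OF D1(2)] by (auto simp: n_def lessThan_atLeast0)
      define s t where "s i = Inf (snd (\<pi> i))" and "t i = Sup (snd (\<pi> i))" for i
      have mem: "\<pi> i \<in> D1" if "i < n" for i using \<pi> that by (auto simp: bij_betw_def)
      have st: "snd (\<pi> i) = {s i..t i} \<and> s i \<le> t i \<and> a \<le> s i \<and> t i \<le> b \<and> {s i..t i} \<subseteq> U" if "i < n" for i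
      proof -
        obtain x k where xk: "\<pi> i = (x, k)" by (cases "\<pi> i")
        have xD: "(x, k) \<in> D" "x \<in> N" using mem[OF that] by (auto simp: D1_def xk)
        obtain u v where k: "k = {u..v}" "u \<le> v" "a \<le> u" "v \<le> b" using Dk[OF xD(1)] by blast
        have "k \<subseteq> U" using fineD[OF D(2) xD(1)] xD(2) by (simp add: \<gamma>_def)
        with k show ?thesis by (simp add: s_def t_def xk)
      qed
      have disj: "disjoint_family_on (\<lambda>i. {s i<..<t i}) {..<n}"
        unfolding disjoint_family_on_def
      proof (intro ballI impI)
        fix i j assume ij: "i \<in> {..<n}" "j \<in> {..<n}" "i \<noteq> j"
        have "\<pi> i \<noteq> \<pi> j" using \<pi> ij by (auto simp: bij_betw_def inj_on_def)
        then have "interior (snd (\<pi> i)) \<inter> interior (snd (\<pi> j)) = {}"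
          using tagged_division_ofD(5)[OF D(1), of "fst (\<pi> i)" "snd (\<pi> i)" "fst (\<pi> j)" "snd (\<pi> j)"] mem[of i] mem[of j] ij
          by (auto simp: D1_def prod_eq_iff)
        moreover have "interior (snd (\<pi> i)) = {s i<..<t i}" "interior (snd (\<pi> j)) = {s j<..<t j}"
          using st[of i] st[of j] ij interior_atLeastAtMost_real by auto
        ultimately show "{s i<..<t i} \<inter> {s j<..<t j} = {}" by simp
      qed
      have "(\<Sum>i<n. t i - s i) = (\<Sum>i<n. measure lebesgue {s i<..<t i})"
        by (intro sum.cong refl) (use st in auto)
      also have "\<dots> = measure lebesgue (\<Union>i<n. {s i<..<t i})"
        by (rule measure_finite_Union[symmetric]) (use disj st in auto)
      also have "\<dots> \<le> measure lebesgue U"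
        by (rule measure_mono_fmeasurable) (use st U in \<open>fastforce+\<close>)
      finally have "(\<Sum>i<n. t i - s i) < d" using U(4) by simp
      then have "(\<Sum>i<n. norm (f (t i) - f (s i))) < e" using st by (intro d(2) disj) auto
      also have "(\<Sum>i<n. norm (f (t i) - f (s i))) = (\<Sum>i<n. norm (F (\<pi> i)))"
        by (simp add: F_def s_def t_def split_beta)
      also have "\<dots> = (\<Sum>xk\<in>D1. norm (F xk))"
        using sum.reindex_bij_betw[OF \<pi>, of "\<lambda>xk. norm (F xk)"] .
      finally show ?thesis .
    qed
    have "norm (f b - f a) \<le> (\<Sum>xk\<in>D. norm (F xk))" unfolding total by (rule norm_sum)
    also have "\<dots> = (\<Sum>xk\<in>D - D1. norm (F xk)) + (\<Sum>xk\<in>D1. norm (F xk))"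
      by (rule sum.subset_diff[OF D1(1) Dfin])
    also have "(\<Sum>xk\<in>D - D1. norm (F xk)) \<le> (\<Sum>xk\<in>D - D1. e * len xk)" by (intro sum_mono good)
    also have "\<dots> \<le> (\<Sum>xk\<in>D. e * len xk)"
      by (rule sum_mono2[OF Dfin]) (use len0 e in auto)
    also have "\<dots> = e * (b - a)" by (simp add: lensum flip: sum_distrib_left)
    finally show ?thesis using bad by simp
  qed
  have "norm (f b - f a) \<le> 0"
  proof (rule field_le_epsilon)
    fix e :: real assume e: "e > 0"
    define e' where "e' = e / (b - a + 1)"
    have "e' > 0" using e ab by (simp add: e'_def)
    from small[OF this] have "norm (f b - f a) \<le> e' * (b - a + 1)" by (simp add: algebra_simps)
    also have "\<dots> = e" using ab by (simp add: e'_def)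
    finally show "norm (f b - f a) \<le> 0 + e" by simp
  qed
  then show ?thesis by simp
qed

text \<open>Subtracting a primitive of c reduces this to derivative 0. Elements of the operator
  domain satisfy their equations almost everywhere; for continuous coefficients and sources this
  makes them classical solutions.\<close>

lemma loc_abs_cont_has_derivative:
  assumes lac: "loc_abs_cont f" and c: "continuous_on UNIV c"
    and ae: "AE x in lebesgue. (f has_vector_derivative c x) (at x)"
  shows "(f has_vector_derivative c x) (at x)"
proof -
  define g where "g x = f x - primitive 0 c x" for x
  have pd: "(primitive 0 c has_vector_derivative c x) (at x)" for x by (rule primitive_has_derivative[OF c])
  have "loc_abs_cont g" unfolding g_def by (rule loc_abs_cont_diff[OF lac loc_abs_cont_C1[OF pd c]])
  moreover have "AE x in lebesgue. (g has_vector_derivative 0) (at x)"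
    using ae
  proof eventually_elim
    case (elim x)
    from has_vector_derivative_diff[OF elim pd[of x]] show ?case unfolding g_def by simp
  qed
  ultimately have "g x = g y" if "y \<le> x" for x y using loc_abs_cont_zero_derivative that by blast
  then have g0: "g x = g 0" for x by (metis linear)
  have "f x = g x + primitive 0 c x" for x by (simp add: g_def)
  then have "f x = g 0 + primitive 0 c x" for x using g0[of x] by metis
  then have "f = (\<lambda>x. g 0 + primitive 0 c x)" by (rule ext)
  moreover have "((\<lambda>x. g 0 + primitive 0 c x) has_vector_derivative 0 + c x) (at x)"
    by (intro has_vector_derivative_add has_vector_derivative_const pd)
  ultimately show ?thesis by simp
qed

section \<open>The operator and its Green's function\<close>

text \<open>Values tending to 0 would produce a uniform limit of translates that lies in the hull
  and is not positive at 0. Positivity on the whole hull enters here.\<close>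

lemma AP_plus_bounded_below:
  assumes "f \<in> AP_plus"
  obtains c where "c > 0" "\<And>x. c \<le> f x"
proof -
  have f: "f \<in> AP" and pos: "\<And>g x. g \<in> AP_hull f \<Longrightarrow> g x > 0" using assms by (auto simp: AP_plus_def)
  have "\<exists>n::nat. \<forall>x. inverse (real (Suc n)) \<le> f x"
  proof (rule ccontr)
    assume "\<not> ?thesis"
    then have "\<forall>n::nat. \<exists>x. f x < inverse (real (Suc n))" by (simp add: not_le)
    from choice[OF this] obtain t where t: "\<And>n::nat. f (t n) < inverse (real (Suc n))" by blast
    obtain r where r: "strict_mono (r :: nat \<Rightarrow> nat)" "uniformly_convergent_on UNIV (\<lambda>n. shift f (t (r n)))"
      using f by (auto simp: AP_def)
    then obtain g where g: "uniform_limit UNIV (\<lambda>n. shift f (t (r n))) g sequentially"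
      unfolding uniformly_convergent_on_def by blast
    have "g \<in> AP_hull f"
      unfolding AP_hull_def
    proof (intro CollectI allI impI)
      fix e :: real assume "e > 0"
      from uniform_limitD[OF g this] obtain n where n: "\<And>x. dist (shift f (t (r n)) x) (g x) < e"
        unfolding eventually_sequentially by blast
      have "norm (g x - shift f (t (r n)) x) \<le> e" for x
        using n[of x] by (simp add: dist_real_def)
      then have "\<forall>x. norm (g x - shift f (t (r n)) x) \<le> e" by blast
      then show "\<exists>t. \<forall>x. norm (g x - shift f t x) \<le> e" by blast
    qed
    then have "g 0 > 0" by (rule pos)
    have "(\<lambda>n. shift f (t (r n)) 0) \<longlonglongrightarrow> g 0" by (rule tendsto_uniform_limitI[OF g]) simp
    moreover have "(\<lambda>n. inverse (real (Suc (r n)))) \<longlonglongrightarrow> 0"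
      using LIMSEQ_subseq_LIMSEQ[OF LIMSEQ_inverse_real_of_nat r(1)] by (simp add: o_def)
    moreover have "\<exists>N. \<forall>n\<ge>N. shift f (t (r n)) 0 \<le> inverse (real (Suc (r n)))"
      using t by (auto simp: shift_def intro: less_imp_le)
    ultimately have "g 0 \<le> 0" by (rule LIMSEQ_le)
    with \<open>g 0 > 0\<close> show False by simp
  qed
  then obtain n :: nat where "\<forall>x. inverse (real (Suc n)) \<le> f x" ..
  then show ?thesis by (intro that[of "inverse (real (Suc n))"]) auto
qed

section \<open>Weighted square integrability on half-lines and on the line\<close>

lemma L2_right_zero: "L2_right (\<lambda>x. 0)"
  by (auto simp: L2_right_def)

lemma integral_reflect_left:
  "integral {0..b} (\<lambda>x. (norm (f (- x)))\<^sup>2) = integral {- b..0} (\<lambda>x. (norm (f x))\<^sup>2)" for f :: "real \<Rightarrow> complex"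
  using Henstock_Kurzweil_Integration.integral_reflect_real[of 0 "- b" "\<lambda>x. (norm (f x))\<^sup>2"] by simp

locale sl_weight =
  fixes w :: "real \<Rightarrow> real" and w0 w1 :: real
  assumes w_cont: "continuous_on UNIV w" and w0: "w0 > 0" and w_ge: "\<And>x. w0 \<le> w x" and w_le: "\<And>x. w x \<le> w1"
begin

lemma w_pos: "w x > 0" using w0 w_ge[of x] by linarith

lemma w_measurable: "w \<in> borel_measurable (lebesgue_on S)" if "S \<in> sets lebesgue"
  by (rule continuous_imp_measurable_on_sets_lebesgue[OF continuous_on_subset[OF w_cont] that]) simp

lemma cont_measurable: "continuous_on UNIV f \<Longrightarrow> S \<in> sets lebesgue \<Longrightarrow> f \<in> borel_measurable (lebesgue_on S)"
  for f :: "real \<Rightarrow> 'b::topological_space"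
  by (rule continuous_imp_measurable_on_sets_lebesgue) (auto intro: continuous_on_subset)

lemma AE_weighted: "(AE x in weighted w UNIV. P x) \<longleftrightarrow> (AE x in lebesgue. P x)"
  unfolding weighted_def lebesgue_on_UNIV_eq
  using w_measurable[of UNIV] w_pos by (subst AE_density) (auto simp: lebesgue_on_UNIV_eq)

lemma L2_weighted_iff:
  assumes f: "continuous_on UNIV f" and S: "S \<in> sets lebesgue"
  shows "f \<in> L2 (weighted w S) \<longleftrightarrow> integrable (lebesgue_on S) (\<lambda>x. w x * (norm (f x))\<^sup>2)"
    "(\<integral>x. (norm (f x))\<^sup>2 \<partial>weighted w S) = (\<integral>x. w x * (norm (f x))\<^sup>2 \<partial>lebesgue_on S)"
proof -
  note m = cont_measurable[OF cont_norm_square[OF f] S] w_measurable[OF S]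
  have nn: "AE x in lebesgue_on S. 0 \<le> w x" using w_pos by (intro AE_I2) (simp add: less_imp_le)
  show "f \<in> L2 (weighted w S) \<longleftrightarrow> integrable (lebesgue_on S) (\<lambda>x. w x * (norm (f x))\<^sup>2)"
    unfolding L2_def weighted_def using integrable_density[OF m nn] cont_measurable[OF f S] by simp
  show "(\<integral>x. (norm (f x))\<^sup>2 \<partial>weighted w S) = (\<integral>x. w x * (norm (f x))\<^sup>2 \<partial>lebesgue_on S)"
    unfolding weighted_def using integral_density[OF m nn] by simp
qed

lemma L2_nrm_square:
  assumes f: "continuous_on UNIV f" and S: "S \<in> sets lebesgue" and L2: "f \<in> L2 (weighted w S)"
  shows "(\<lambda>x. w x * (norm (f x))\<^sup>2) integrable_on S"
    "(L2_nrm (weighted w S) f)\<^sup>2 = integral S (\<lambda>x. w x * (norm (f x))\<^sup>2)"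
proof -
  have i: "integrable (lebesgue_on S) (\<lambda>x. w x * (norm (f x))\<^sup>2)" using L2_weighted_iff(1)[OF f S] L2 by blast
  show ion: "(\<lambda>x. w x * (norm (f x))\<^sup>2) integrable_on S" by (rule integrable_on_lebesgue_on[OF i S])
  have "integral S (\<lambda>x. w x * (norm (f x))\<^sup>2) \<ge> 0"
    by (rule integral_nonneg[OF ion]) (simp add: w_pos less_imp_le)
  then show "(L2_nrm (weighted w S) f)\<^sup>2 = integral S (\<lambda>x. w x * (norm (f x))\<^sup>2)"
    unfolding L2_nrm_def L2_weighted_iff(2)[OF f S] lebesgue_integral_eq_integral[OF i S] by simp
qed

lemma L2_weighted_bound:
  assumes f: "continuous_on UNIV f" and S: "S \<in> sets lebesgue" and L2: "f \<in> L2 (weighted w S)" and cd: "{c..d} \<subseteq> S"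
  shows "integral {c..d} (\<lambda>x. (norm (f x))\<^sup>2) \<le> (L2_nrm (weighted w S) f)\<^sup>2 / w0"
proof -
  note cf = cont_norm_square[OF f]
  have "w0 * integral {c..d} (\<lambda>x. (norm (f x))\<^sup>2) = integral {c..d} (\<lambda>x. w0 * (norm (f x))\<^sup>2)" by simp
  also have "\<dots> \<le> integral {c..d} (\<lambda>x. w x * (norm (f x))\<^sup>2)"
    by (intro integral_le integrable_cont continuous_on_mult continuous_on_const cf w_cont mult_right_mono w_ge) auto
  also have "\<dots> \<le> integral S (\<lambda>x. w x * (norm (f x))\<^sup>2)"
    by (intro integral_subset_le[OF cd] integrable_cont continuous_on_mult cf w_cont L2_nrm_square(1)[OF f S L2])
      (simp add: w_pos less_imp_le)
  also have "\<dots> = (L2_nrm (weighted w S) f)\<^sup>2" by (rule L2_nrm_square(2)[OF f S L2, symmetric])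
  finally show ?thesis using w0 by (simp add: field_simps)
qed

text \<open>Monotone convergence along the truncations to [-k, k]. The endpoint sequences l and u
  let one proof cover both half-lines and the whole line.\<close>

lemma L2_weightedI:
  fixes l u :: "nat \<Rightarrow> real"
  assumes f: "continuous_on UNIV f" and S: "S \<in> sets lebesgue"
    and lu: "\<And>k. S \<inter> {- real k..real k} = {l k..u k}"
    and B: "\<And>k. integral {l k..u k} (\<lambda>x. (norm (f x))\<^sup>2) \<le> B"
  shows "f \<in> L2 (weighted w S)"
proof -
  define g where "g x = w x * (norm (f x))\<^sup>2" for x
  note cf = cont_norm_square[OF f]
  have g: "continuous_on UNIV g" unfolding g_def by (intro continuous_on_mult cf w_cont)
  have g0: "g x \<ge> 0" for x using w_pos[of x] by (simp add: g_def)
  define F where "F k x = (if x \<in> {- real k..real k} then g x else 0)" for k x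
  have Fi: "F k integrable_on S" for k
    unfolding F_def Henstock_Kurzweil_Integration.integrable_restrict_Int Int_commute[of _ S] lu by (rule integrable_cont[OF g])
  have FI: "integral S (F k) = integral {l k..u k} g" for k
    unfolding F_def Henstock_Kurzweil_Integration.integral_restrict_Int Int_commute[of _ S] lu ..
  have Fbd: "norm (integral S (F k)) \<le> w1 * B" for k
  proof -
    have "integral {l k..u k} g \<le> integral {l k..u k} (\<lambda>x. w1 * (norm (f x))\<^sup>2)"
      unfolding g_def
      by (intro integral_le integrable_cont continuous_on_mult continuous_on_const cf w_cont mult_right_mono w_le) auto
    also have "\<dots> = w1 * integral {l k..u k} (\<lambda>x. (norm (f x))\<^sup>2)" by simp
    also have "\<dots> \<le> w1 * B" using w_pos[of 0] w_le[of 0] by (intro mult_left_mono B) auto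
    finally have "integral {l k..u k} g \<le> w1 * B" .
    moreover have "integral {l k..u k} g \<ge> 0" by (intro integral_nonneg integrable_cont g g0)
    ultimately show ?thesis unfolding FI by simp
  qed
  have "g integrable_on S \<and> (\<lambda>k. integral S (F k)) \<longlonglongrightarrow> integral S g"
  proof (rule monotone_convergence_increasing[OF Fi])
    show "F k x \<le> F (Suc k) x" for k x using g0[of x] by (auto simp: F_def)
    show "(\<lambda>k. F k x) \<longlonglongrightarrow> g x" for x
    proof (rule tendsto_eventually)
      obtain N where N: "\<bar>x\<bar> \<le> real N" using real_arch_simple by blast
      have "F k x = g x" if "k \<ge> N" for k using N that by (auto simp: F_def)
      then show "\<forall>\<^sub>F k in sequentially. F k x = g x" unfolding eventually_sequentially by blast
    qed
    show "bounded (range (\<lambda>k. integral S (F k)))" using Fbd by (auto simp: bounded_iff)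
  qed
  then have "g absolutely_integrable_on S" using g0 nonnegative_absolutely_integrable_1 by blast
  then have "integrable (lebesgue_on S) g" by (rule absolutely_integrable_imp_integrable[OF _ S])
  then show ?thesis using L2_weighted_iff(1)[OF f S] unfolding g_def by blast
qed

lemma L2_right_iff: "continuous_on UNIV f \<Longrightarrow> f \<in> L2 (weighted w {0..}) \<longleftrightarrow> L2_right f"
proof
  assume f: "continuous_on UNIV f" and "f \<in> L2 (weighted w {0..})"
  then show "L2_right f" unfolding L2_right_def using L2_weighted_bound[OF f, of "{0..}" 0] by auto
next
  assume f: "continuous_on UNIV f" and "L2_right f"
  then obtain B where B: "\<And>b. integral {0..b} (\<lambda>x. (norm (f x))\<^sup>2) \<le> B" unfolding L2_right_def by blast
  show "f \<in> L2 (weighted w {0..})"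
    by (rule L2_weightedI[OF f, of _ "\<lambda>k. 0" "\<lambda>k. real k" B]) (use B in auto)
qed

lemma L2_left_iff: "continuous_on UNIV f \<Longrightarrow> f \<in> L2 (weighted w {..0}) \<longleftrightarrow> L2_left f"
proof
  assume f: "continuous_on UNIV f" and "f \<in> L2 (weighted w {..0})"
  then show "L2_left f" unfolding L2_left_def L2_right_def integral_reflect_left
    using L2_weighted_bound[OF f, of "{..0}" _ 0] by auto
next
  assume f: "continuous_on UNIV f" and "L2_left f"
  then obtain B where B: "\<And>b. integral {- b..0} (\<lambda>x. (norm (f x))\<^sup>2) \<le> B"
    unfolding L2_left_def L2_right_def integral_reflect_left by blast
  show "f \<in> L2 (weighted w {..0})"
    by (rule L2_weightedI[OF f, of _ "\<lambda>k. - real k" "\<lambda>k. 0" B]) (use B in auto)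
qed

lemma L2_UNIV_iff: "continuous_on UNIV f \<Longrightarrow> f \<in> L2 (weighted w UNIV) \<longleftrightarrow> L2_right f \<and> L2_left f"
proof
  assume f: "continuous_on UNIV f" and "f \<in> L2 (weighted w UNIV)"
  then have bd: "integral {c..d} (\<lambda>x. (norm (f x))\<^sup>2) \<le> (L2_nrm (weighted w UNIV) f)\<^sup>2 / w0" for c d
    using L2_weighted_bound[OF f, of UNIV c d] by simp
  then show "L2_right f \<and> L2_left f" unfolding L2_left_def L2_right_def integral_reflect_left by blast
next
  assume f: "continuous_on UNIV f" and L2: "L2_right f \<and> L2_left f"
  obtain B where B: "\<And>b. integral {0..b} (\<lambda>x. (norm (f x))\<^sup>2) \<le> B" using L2 unfolding L2_right_def by blast
  obtain B' where B': "\<And>b. integral {- b..0} (\<lambda>x. (norm (f x))\<^sup>2) \<le> B'"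
    using L2 unfolding L2_left_def L2_right_def integral_reflect_left by blast
  show "f \<in> L2 (weighted w UNIV)"
  proof (rule L2_weightedI[OF f, of _ "\<lambda>k. - real k" "\<lambda>k. real k" "B' + B"])
    fix k
    show "integral {- real k..real k} (\<lambda>x. (norm (f x))\<^sup>2) \<le> B' + B"
      using integral_split[OF cont_norm_square[OF f], of "- real k" 0 "real k"] B[of "real k"] B'[of "real k"] by simp
  qed auto
qed

end

locale sturm_liouville = sl_weight w w0 w1 for w :: "real \<Rightarrow> real" and w0 w1 :: real +
  fixes p q :: "real \<Rightarrow> real" and z :: complex and p0 p1 q1 :: real
  assumes p_cont: "continuous_on UNIV p" and q_cont: "continuous_on UNIV q"
    and p0: "p0 > 0" and p_ge: "\<And>x. p0 \<le> p x" and p_le: "\<And>x. p x \<le> p1" and q_le: "\<And>x. \<bar>q x\<bar> \<le> q1"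
begin

lemma p_pos: "p x > 0" using p0 p_ge[of x] by linarith

abbreviation "ap \<equiv> \<lambda>x. 1 / p x"
abbreviation "Qz \<equiv> \<lambda>x. complex_of_real (q x) - z * complex_of_real (w x)"
abbreviation "KK \<equiv> max (1 / p0) (q1 + norm z * w1)"

lemma p_coefficients: "sl_coeff ap Qz (1 / p1) KK"
proof
  show "continuous_on UNIV ap" using p_cont p_pos by (intro continuous_intros) (auto simp: less_imp_neq[symmetric])
  show "continuous_on UNIV Qz" using q_cont w_cont by (intro continuous_intros)
  show "1 / p1 > 0" using p_pos[of 0] p_le[of 0] by simp
  show "1 / p1 \<le> 1 / p x" for x using p_pos[of x] p_le[of x] by (simp add: frac_le)
  show "1 / p x \<le> KK" for x using p_ge[of x] p0 by (simp add: frac_le le_max_iff_disj)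
  fix x
  have "norm (Qz x) \<le> norm (complex_of_real (q x)) + norm (z * complex_of_real (w x))" by (rule norm_triangle_ineq4)
  also have "\<dots> \<le> q1 + norm z * w1"
    using q_le[of x] w_pos[of x] w_le[of x] by (intro add_mono) (auto simp: norm_mult intro!: mult_left_mono)
  finally show "norm (Qz x) \<le> KK" by simp
qed

sublocale sl_coeff ap Qz "1 / p1" KK by (rule p_coefficients)

text \<open>The passage from the operator domain to classical solutions: both f and its
  quasi-derivative are absolutely continuous, and the right-hand sides \<open>h / p\<close> and
  \<open>Qz * f - r\<close> are continuous, so the equations extend from almost every point to every
  point.\<close>

lemma regular_inhom:
  assumes f: "f \<in> sl_regular p" and r: "continuous_on UNIV r"
    and ae: "AE x in lebesgue. vector_derivative (quasi_deriv p f) (at x) = Qz x * f x - r x"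
  shows "inhom r f (quasi_deriv p f)"
proof -
  define h where "h = quasi_deriv p f"
  have lf: "loc_abs_cont f" and lh: "loc_abs_cont h"
    and df: "AE x in lebesgue. f differentiable (at x)" and dh: "AE x in lebesgue. h differentiable (at x)"
    using f by (auto simp: sl_regular_def h_def)
  note cf = loc_abs_cont_continuous[OF lf] and ch = loc_abs_cont_continuous[OF lh]
  have 1: "(f has_vector_derivative of_real (1 / p x) * h x) (at x)" for x
  proof (rule loc_abs_cont_has_derivative[OF lf])
    show "continuous_on UNIV (\<lambda>x. complex_of_real (1 / p x) * h x)"
      by (intro continuous_on_mult continuous_on_of_real a_cont ch)
    show "AE x in lebesgue. (f has_vector_derivative of_real (1 / p x) * h x) (at x)"
      using df
    proof eventually_elim
      case (elim x)
      have "of_real (1 / p x) * h x = vector_derivative f (at x)"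
        using p_pos[of x] by (simp add: h_def quasi_deriv_def)
      then show ?case using elim by (simp add: vector_derivative_works)
    qed
  qed
  have 2: "(h has_vector_derivative Qz x * f x - r x) (at x)" for x
  proof (rule loc_abs_cont_has_derivative[OF lh])
    show "continuous_on UNIV (\<lambda>x. Qz x * f x - r x)"
      by (intro continuous_on_diff continuous_on_mult Q_cont cf r)
    show "AE x in lebesgue. (h has_vector_derivative Qz x * f x - r x) (at x)"
      using dh ae
    proof eventually_elim
      case (elim x)
      then show ?case unfolding vector_derivative_works by (simp add: h_def)
    qed
  qed
  show ?thesis using 1 2 unfolding inhom_def h_def by blast
qed

lemma inhom_regular:
  assumes inh: "inhom r f h" and r: "continuous_on UNIV r"
  shows "quasi_deriv p f = h" "f \<in> sl_regular p" "vector_derivative h (at x) = Qz x * f x - r x"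
proof -
  note cf = inhom_cont(1)[OF inh] and ch = inhom_cont(2)[OF inh]
  show qd: "quasi_deriv p f = h"
  proof
    fix x
    show "quasi_deriv p f x = h x"
      using vector_derivative_at[OF inhomD(1)[OF inh, of x]] p_pos[of x] by (simp add: quasi_deriv_def)
  qed
  show "vector_derivative h (at x) = Qz x * f x - r x" by (rule vector_derivative_at[OF inhomD(2)[OF inh]])
  have "loc_abs_cont f"
    by (rule loc_abs_cont_C1[OF inhomD(1)[OF inh]]) (intro continuous_on_mult continuous_on_of_real a_cont ch)
  moreover have "loc_abs_cont h"
    by (rule loc_abs_cont_C1[OF inhomD(2)[OF inh]]) (intro continuous_on_diff continuous_on_mult Q_cont cf r)
  moreover have "f differentiable (at x)" "h differentiable (at x)" for x
    using inhomD[OF inh, of x] by (auto intro: differentiableI_vector)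
  ultimately show "f \<in> sl_regular p" by (simp add: sl_regular_def qd)
qed

lemma sl_op_inhom:
  assumes inh: "inhom r f h" and r: "continuous_on UNIV r"
  shows "sl_op p q w f x = z * f x + r x / of_real (w x)"
  unfolding sl_op_def inhom_regular(1)[OF assms] inhom_regular(3)[OF assms]
  using w_pos[of x] by (simp add: field_simps)

text \<open>The source r corresponds to the right-hand side r / w for the operator. Of the two
  divisions by w0 in the constant, one compares the weighted norm of f with the plain one, the other
  bounds \<open>w * norm (r / w) ^ 2\<close> by \<open>norm r ^ 2 / w0\<close>.\<close>

lemma sl_resolvent:
  assumes z: "z \<notin> sl_spectrum p q w"
  obtains C where "sl_resolvent ap Qz (1 / p1) KK C"
proof -
  define M where "M = weighted w UNIV"
  have zr: "z \<in> resolvent_set M (sl_domain p q w) (sl_op p q w)" using z by (simp add: sl_spectrum_def M_def)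
  then obtain C0 where C0: "\<And>f. f \<in> sl_domain p q w \<Longrightarrow> L2_nrm M f \<le> C0 * L2_nrm M (\<lambda>x. sl_op p q w f x - z * f x)"
    unfolding resolvent_set_def by blast
  have surj: "\<exists>f\<in>sl_domain p q w. AE x in M. sl_op p q w f x - z * f x = g x" if "g \<in> L2 M" for g
    using zr that unfolding resolvent_set_def by blast
  have U: "UNIV \<in> sets lebesgue" by simp
  have nrm0: "L2_nrm M f \<ge> 0" for f unfolding L2_nrm_def by simp
  have g_props: "continuous_on UNIV (\<lambda>x. r x / of_real (w x))" "(\<lambda>x. r x / of_real (w x)) \<in> L2 M"
    if r: "continuous_on UNIV r" and supp: "\<And>x. x \<notin> {x0..x0 + 1} \<Longrightarrow> r x = 0" for r :: "real \<Rightarrow> complex" and x0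
  proof -
    show c: "continuous_on UNIV (\<lambda>x. r x / of_real (w x))"
      using r w_cont w_pos by (intro continuous_intros) (auto simp: less_imp_neq[symmetric])
    have z0: "continuous_on UNIV (\<lambda>x::real. 0::complex)" by simp
    \<comment> \<open>The thresholds x0 + 2 and 1 - x0 lie strictly beyond the support, so the
      comparison there is with the zero function.\<close>
    have "L2_right (\<lambda>x. r x / of_real (w x))"
      by (rule L2_right_le[OF c z0 L2_right_zero, of "x0 + 2" 0]) (simp add: supp)
    moreover have "L2_left (\<lambda>x. r x / of_real (w x))"
      unfolding L2_left_def
      by (rule L2_right_le[OF continuous_on_reflect[OF c] z0 L2_right_zero, of "1 - x0" 0]) (simp add: supp)
    ultimately show "(\<lambda>x. r x / of_real (w x)) \<in> L2 M" unfolding M_def using L2_UNIV_iff[OF c] by blast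
  qed
  have "sl_resolvent ap Qz (1 / p1) KK (C0\<^sup>2 / w0 / w0)"
  proof unfold_locales
    fix r :: "real \<Rightarrow> complex" and x0 :: real
    assume r: "continuous_on UNIV r" and supp: "\<And>x. x \<notin> {x0..x0 + 1} \<Longrightarrow> r x = 0"
    define g where "g x = r x / of_real (w x)" for x
    have g: "continuous_on UNIV g" "g \<in> L2 M" unfolding g_def using g_props[OF r supp] by auto
    obtain f where f: "f \<in> sl_domain p q w" "AE x in M. sl_op p q w f x - z * f x = g x" using surj[OF g(2)] by blast
    have reg: "f \<in> sl_regular p" and fL2: "f \<in> L2 M" using f(1) by (auto simp: sl_domain_def M_def)
    have "AE x in lebesgue. vector_derivative (quasi_deriv p f) (at x) = Qz x * f x - r x"
      using f(2) unfolding M_def AE_weighted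
    proof eventually_elim
      case (elim x)
      have nz: "complex_of_real (w x) \<noteq> 0" using w_pos[of x] by simp
      define D where "D = vector_derivative (quasi_deriv p f) (at x)"
      have "1 / of_real (w x) * (- D + of_real (q x) * f x) - z * f x = r x / of_real (w x)"
        using elim unfolding sl_op_def D_def g_def by simp
      then have "(- D + of_real (q x) * f x) - z * f x * of_real (w x) = r x"
        using nz by (simp add: field_simps)
      then show ?case unfolding D_def[symmetric] by (simp add: algebra_simps)
    qed
    then have inh: "inhom r f (quasi_deriv p f)" by (rule regular_inhom[OF reg r])
    moreover have "L2_right f \<and> L2_left f" using L2_UNIV_iff[OF inhom_cont(1)[OF inh]] fL2 unfolding M_def by blast
    ultimately show "\<exists>f h. inhom r f h \<and> L2_right f \<and> L2_left f" by blast
  next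
    fix r :: "real \<Rightarrow> complex" and x0 :: real and f h c d
    assume r: "continuous_on UNIV r" and supp: "\<And>x. x \<notin> {x0..x0 + 1} \<Longrightarrow> r x = 0"
      and inh: "inhom r f h" and L2: "L2_right f" "L2_left f"
    define g where "g x = r x / of_real (w x)" for x
    have g: "continuous_on UNIV g" "g \<in> L2 M" unfolding g_def using g_props[OF r supp] by auto
    note cf = inhom_cont(1)[OF inh]
    have op: "sl_op p q w f = (\<lambda>x. z * f x + g x)" by (simp add: fun_eq_iff sl_op_inhom[OF inh r] g_def)
    have fL2: "f \<in> L2 M" unfolding M_def using L2_UNIV_iff[OF cf] L2 by blast
    have cop: "continuous_on UNIV (\<lambda>x. z * f x + g x)" using cf g by (intro continuous_intros)
    have "L2_right (\<lambda>x. z * f x + g x)"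
      by (rule L2_right_le[OF cop cf L2(1), of "x0 + 2" "norm z"]) (simp add: g_def supp norm_mult)
    moreover have "L2_left (\<lambda>x. z * f x + g x)"
      unfolding L2_left_def
      by (rule L2_right_le[OF continuous_on_reflect[OF cop] continuous_on_reflect[OF cf] L2(2)[unfolded L2_left_def], of "1 - x0" "norm z"])
        (simp add: g_def supp norm_mult)
    ultimately have "sl_op p q w f \<in> L2 M" unfolding op M_def using L2_UNIV_iff[OF cop] by blast
    then have "f \<in> sl_domain p q w" using fL2 inhom_regular(2)[OF inh r] by (simp add: sl_domain_def M_def)
    from C0[OF this] have "L2_nrm M f \<le> C0 * L2_nrm M g" unfolding op by simp
    then have "(L2_nrm M f)\<^sup>2 \<le> (C0 * L2_nrm M g)\<^sup>2" by (rule power_mono[OF _ nrm0])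
    then have n2: "(L2_nrm M f)\<^sup>2 \<le> C0\<^sup>2 * (L2_nrm M g)\<^sup>2" by (simp add: power_mult_distrib)
    have "(L2_nrm M g)\<^sup>2 = integral UNIV (\<lambda>x. w x * (norm (g x))\<^sup>2)"
      unfolding M_def by (rule L2_nrm_square(2)[OF g(1) U g(2)[unfolded M_def]])
    also have "(\<lambda>x. w x * (norm (g x))\<^sup>2) = (\<lambda>x. if x \<in> {x0..x0 + 1} then w x * (norm (g x))\<^sup>2 else 0)"
      by (auto simp: fun_eq_iff g_def supp)
    also have "integral UNIV \<dots> = integral {x0..x0 + 1} (\<lambda>x. w x * (norm (g x))\<^sup>2)"
      by (rule Henstock_Kurzweil_Integration.integral_restrict_UNIV)
    also have "\<dots> \<le> integral {x0..x0 + 1} (\<lambda>x. 1 / w0 * (norm (r x))\<^sup>2)"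
    proof (rule integral_le)
      fix x
      have "w x * (norm (g x))\<^sup>2 = 1 / w x * (norm (r x))\<^sup>2"
        using w_pos[of x] by (simp add: g_def norm_divide power_divide power2_eq_square field_simps)
      also have "\<dots> \<le> 1 / w0 * (norm (r x))\<^sup>2"
        using w_ge[of x] w0 by (intro mult_right_mono) (auto simp: frac_le)
      finally show "w x * (norm (g x))\<^sup>2 \<le> 1 / w0 * (norm (r x))\<^sup>2" .
    qed (intro integrable_cont continuous_on_mult continuous_on_const cont_norm_square w_cont g r)+
    also have "\<dots> = 1 / w0 * integral {x0..x0 + 1} (\<lambda>x. (norm (r x))\<^sup>2)"
      by (rule Henstock_Kurzweil_Integration.integral_mult_right)
    finally have gn: "(L2_nrm M g)\<^sup>2 \<le> 1 / w0 * integral {x0..x0 + 1} (\<lambda>x. (norm (r x))\<^sup>2)" .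
    have "integral {c..d} (\<lambda>x. (norm (f x))\<^sup>2) \<le> (L2_nrm M f)\<^sup>2 / w0"
      unfolding M_def by (rule L2_weighted_bound[OF cf U fL2[unfolded M_def]]) simp
    also have "\<dots> \<le> C0\<^sup>2 * (1 / w0 * integral {x0..x0 + 1} (\<lambda>x. (norm (r x))\<^sup>2)) / w0"
      using w0 by (intro divide_right_mono order_trans[OF n2] mult_left_mono gn) auto
    finally show "integral {c..d} (\<lambda>x. (norm (f x))\<^sup>2) \<le> C0\<^sup>2 / w0 / w0 * integral {x0..x0 + 1} (\<lambda>x. (norm (r x))\<^sup>2)"
      by (simp add: mult_ac)
  qed
  then show ?thesis by (rule that)
qed

lemma sl_solution_iff: "sl_solution p q w z \<phi> \<longleftrightarrow> sol \<phi> (quasi_deriv p \<phi>)"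
proof
  assume s: "sl_solution p q w z \<phi>"
  then have reg: "\<phi> \<in> sl_regular p"
    and ae: "AE x in lebesgue. - vector_derivative (quasi_deriv p \<phi>) (at x) + complex_of_real (q x) * \<phi> x = z * complex_of_real (w x) * \<phi> x"
    by (auto simp: sl_solution_def)
  show "sol \<phi> (quasi_deriv p \<phi>)"
  proof (rule regular_inhom[OF reg continuous_on_const])
    show "AE x in lebesgue. vector_derivative (quasi_deriv p \<phi>) (at x) = Qz x * \<phi> x - 0"
      using ae
    proof eventually_elim
      case (elim x)
      then show ?case by (simp add: algebra_simps)
    qed
  qed
next
  assume s: "sol \<phi> (quasi_deriv p \<phi>)"
  show "sl_solution p q w z \<phi>"
    unfolding sl_solution_def
    using inhom_regular(2,3)[OF s continuous_on_const] by (simp add: algebra_simps)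
qed

text \<open>A solution that vanishes identically has zero quasi-derivative, and data that are
  nonzero at one point are nonzero everywhere. Nontriviality can thus be tested at 0.\<close>

lemma data_nonzero_iff:
  assumes "sol f h"
  shows "(\<exists>x. f x \<noteq> 0) \<longleftrightarrow> data f h 0 \<noteq> 0"
proof
  assume "\<exists>x. f x \<noteq> 0"
  then obtain x where "data f h x \<noteq> 0" by (auto simp: data_eq_0)
  then show "data f h 0 \<noteq> 0" using data_pos[OF assms] by (metis less_irrefl)
next
  assume nz: "data f h 0 \<noteq> 0"
  show "\<exists>x. f x \<noteq> 0"
  proof (rule ccontr)
    assume "\<not> ?thesis"
    then have f0: "f = (\<lambda>x. 0)" by auto
    have "((\<lambda>x. 0) has_vector_derivative of_real (1 / p 0) * h 0) (at 0)" using inhomD(1)[OF assms, of 0] unfolding f0 .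
    then have "of_real (1 / p 0) * h 0 = 0" using vector_derivative_unique_at has_vector_derivative_const by blast
    then have "h 0 = 0" using p_pos[of 0] by simp
    with f0 nz show False by (simp add: data_eq_0)
  qed
qed

end

text \<open>The differentiability conjunct gives the last one its meaning, since
  \<open>vector_derivative\<close> is total.\<close>

theorem lemma3p7:
  fixes p q w :: "real \<Rightarrow> real" and z :: complex
  assumes "p \<in> AP_plus" and "w \<in> AP_plus" and "q \<in> AP"
    and "z \<notin> sl_spectrum p q w"
  shows "(\<lambda>x. greens p q w z x x) \<in> AP_module (freq_module_v p q w)
    \<and> (\<forall>x. (\<lambda>y. greens p q w z y y) differentiable (at x))
    \<and> (\<lambda>x. vector_derivative (\<lambda>y. greens p q w z y y) (at x)) \<in> AP_module (freq_module_v p q w)"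
proof -
  have p: "p \<in> AP" and w: "w \<in> AP" and q: "q \<in> AP" using assms by (auto simp: AP_plus_def)
  obtain p0 where p0: "p0 > 0" "\<And>x. p0 \<le> p x" by (rule AP_plus_bounded_below[OF assms(1)]) blast
  obtain w0 where w0: "w0 > 0" "\<And>x. w0 \<le> w x" by (rule AP_plus_bounded_below[OF assms(2)]) blast
  obtain p1 where p1: "p1 > 0" "\<And>x. norm (p x) \<le> p1" by (rule AP_bounded[OF p]) blast
  obtain w1 where w1: "w1 > 0" "\<And>x. norm (w x) \<le> w1" by (rule AP_bounded[OF w]) blast
  obtain q1 where q1: "q1 > 0" "\<And>x. norm (q x) \<le> q1" by (rule AP_bounded[OF q]) blast
  interpret sturm_liouville w w0 w1 p q z p0 p1 q1
  proof
    show "p x \<le> p1" for x using p1(2)[of x] by simp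
    show "w x \<le> w1" for x using w1(2)[of x] by simp
    show "\<bar>q x\<bar> \<le> q1" for x using q1(2)[of x] by simp
  qed (use p0 w0 AP_continuous p q w in auto)
  obtain C where "sl_resolvent ap Qz (1 / p1) KK C" by (rule sl_resolvent[OF assms(4)])
  then interpret S: sl_resolvent ap Qz "1 / p1" KK C .
  define f1 h1 where "f1 = \<phi>_plus p q w z" and "h1 = quasi_deriv p f1"
  define f2 h2 where "f2 = \<phi>_minus p q w z" and "h2 = quasi_deriv p f2"
  \<comment> \<open>Existence makes the choice behind \<open>\<phi>_plus\<close> meaningful; from
    here on f1 is treated as an arbitrary Weyl solution.\<close>
  have plus: "weyl_solution p q w z {0..} f1"
  proof -
    obtain f h where fh: "sol f h" "L2_right f" "data f h 0 \<noteq> 0" by (rule S.right_solution_exists)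
    have "sol f (quasi_deriv p f)" using fh(1) inhom_regular(1)[OF fh(1) continuous_on_const] by simp
    then have "weyl_solution p q w z {0..} f"
      unfolding weyl_solution_def sl_solution_iff data_nonzero_iff[OF fh(1)] L2_right_iff[OF inhom_cont(1)[OF fh(1)]]
      using fh by blast
    then show ?thesis unfolding f1_def \<phi>_plus_def by (rule someI[where P = "weyl_solution p q w z {0..}"])
  qed
  have minus: "weyl_solution p q w z {..0} f2"
  proof -
    obtain f h where fh: "sol f h" "L2_left f" "data f h 0 \<noteq> 0" by (rule S.left_solution_exists)
    have "sol f (quasi_deriv p f)" using fh(1) inhom_regular(1)[OF fh(1) continuous_on_const] by simp
    then have "weyl_solution p q w z {..0} f"
      unfolding weyl_solution_def sl_solution_iff data_nonzero_iff[OF fh(1)] L2_left_iff[OF inhom_cont(1)[OF fh(1)]]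
      using fh by blast
    then show ?thesis unfolding f2_def \<phi>_minus_def by (rule someI[where P = "weyl_solution p q w z {..0}"])
  qed
  have s1: "sol f1 h1" and s2: "sol f2 h2"
    using plus minus by (auto simp: weyl_solution_def sl_solution_iff h1_def h2_def)
  have L1: "L2_right f1" using plus L2_right_iff[OF inhom_cont(1)[OF s1]] by (simp add: weyl_solution_def)
  have L2: "L2_left f2" using minus L2_left_iff[OF inhom_cont(1)[OF s2]] by (simp add: weyl_solution_def)
  have d1: "data f1 h1 0 \<noteq> 0" using plus data_nonzero_iff[OF s1] by (simp add: weyl_solution_def)
  have d2: "data f2 h2 0 \<noteq> 0" using minus data_nonzero_iff[OF s2] by (simp add: weyl_solution_def)
  define W where "W = wr f1 h1 f2 h2 0"
  have W: "W \<noteq> 0" unfolding W_def by (rule S.wr_nonzero[OF s1 L1 s2 L2 d1 d2])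
  define G where "G x = f1 x * f2 x / W" for x
  define E where "E x = (f1 x * h2 x + h1 x * f2 x) / W" for x
  have greens: "(\<lambda>x. greens p q w z x x) = G"
    by (simp add: fun_eq_iff greens_def G_def W_def wr_def wronskian_def f1_def[symmetric] f2_def[symmetric] h1_def[symmetric] h2_def[symmetric])
  obtain L where L: "L > 0"
    "\<And>t t' \<delta>. (\<And>s. \<bar>ap (t + s) - ap (t' + s)\<bar> \<le> \<delta>) \<Longrightarrow> (\<And>s. norm (Qz (t + s) - Qz (t' + s)) \<le> \<delta>) \<Longrightarrow> norm (G t - G t') \<le> L * \<delta>"
    "\<And>t t' \<delta>. (\<And>s. \<bar>ap (t + s) - ap (t' + s)\<bar> \<le> \<delta>) \<Longrightarrow> (\<And>s. norm (Qz (t + s) - Qz (t' + s)) \<le> \<delta>) \<Longrightarrow> norm (E t - E t') \<le> L * \<delta>"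
    unfolding G_def E_def W_def by (rule S.diagonal_green_lipschitz[OF s1 L1 s2 L2 W[unfolded W_def]]) blast
  define V where "V x = (p x, q x, w x)" for x
  have V: "V \<in> AP" unfolding V_def by (intro AP_Pair p q w)
  \<comment> \<open>\<open>1 / p0\<^sup>2\<close> is a Lipschitz constant of the reciprocal on
    values at least p0, and \<open>1 + norm z\<close> comes from
    \<open>Qz = q - z * w\<close>.\<close>
  define B where "B = max (1 / p0\<^sup>2) (1 + norm z)"
  have B: "B > 0" unfolding B_def by (simp add: less_max_iff_disj add_pos_nonneg)
  have nearV: "\<bar>ap (t + s) - ap (t' + s)\<bar> \<le> B * d" "norm (Qz (t + s) - Qz (t' + s)) \<le> B * d" if nr: "near V d t t'" for t t' d s
  proof -
    have n: "norm (V (s + t) - V (s + t')) \<le> d" using nr unfolding near_def by blast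
    then have "norm (p (s + t) - p (s + t')) \<le> d" and qw: "norm (q (s + t) - q (s + t'), w (s + t) - w (s + t')) \<le> d"
      unfolding V_def diff_Pair using norm_fst_le norm_snd_le order_trans by blast+
    then have dp: "\<bar>p (t + s) - p (t' + s)\<bar> \<le> d" by (simp add: add.commute)
    have dq: "\<bar>q (t + s) - q (t' + s)\<bar> \<le> d"
      using order_trans[OF norm_fst_le qw] by (simp add: add.commute)
    have dw: "\<bar>w (t + s) - w (t' + s)\<bar> \<le> d"
      using order_trans[OF norm_snd_le qw] by (simp add: add.commute)
    have d: "d \<ge> 0" using dp by linarith
    have pp: "p0\<^sup>2 \<le> p (t + s) * p (t' + s)" unfolding power2_eq_square 
      by (intro mult_mono p_ge) (use p0 p_pos in \<open>simp_all add: less_imp_le\<close>)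
    have "ap (t + s) - ap (t' + s) = (p (t' + s) - p (t + s)) / (p (t + s) * p (t' + s))"
      using p_pos[of "t + s"] p_pos[of "t' + s"] by (simp add: field_simps)
    then have "\<bar>ap (t + s) - ap (t' + s)\<bar> = \<bar>p (t + s) - p (t' + s)\<bar> / (p (t + s) * p (t' + s))"
      using p_pos[of "t + s"] p_pos[of "t' + s"] by (simp add: abs_mult abs_minus_commute)
    also have "\<dots> \<le> d / p0\<^sup>2" using dp pp p0 d by (intro frac_le) auto
    also have "\<dots> = 1 / p0\<^sup>2 * d" by simp
    also have "\<dots> \<le> B * d" using d by (intro mult_right_mono) (auto simp: B_def)
    finally show "\<bar>ap (t + s) - ap (t' + s)\<bar> \<le> B * d" .
    have "Qz (t + s) - Qz (t' + s) = of_real (q (t + s) - q (t' + s)) - z * of_real (w (t + s) - w (t' + s))"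
      by (simp add: algebra_simps)
    also have "norm \<dots> \<le> \<bar>q (t + s) - q (t' + s)\<bar> + norm z * \<bar>w (t + s) - w (t' + s)\<bar>"
      by (rule order_trans[OF norm_triangle_ineq4]) (simp add: norm_mult del: of_real_diff)
    also have "\<dots> \<le> d + norm z * d" by (intro add_mono mult_left_mono dq dw) simp
    also have "\<dots> = (1 + norm z) * d" by (simp add: algebra_simps)
    also have "\<dots> \<le> B * d" using d by (intro mult_right_mono) (auto simp: B_def)
    finally show "norm (Qz (t + s) - Qz (t' + s)) \<le> B * d" .
  qed
  have domI: "dominated V F" if F: "\<And>t t' d. near V d t t' \<Longrightarrow> norm (F t - F t') \<le> c * d" and c: "c > 0" for F :: "real \<Rightarrow> complex" and c
  proof (rule dominatedI)
    fix e :: real assume e: "e > 0"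
    show "\<exists>d>0. \<forall>t s. near V d t s \<longrightarrow> norm (F t - F s) \<le> e"
    proof (intro exI[of _ "e / c"] conjI allI impI)
      show "e / c > 0" using e c by simp
      show "norm (F t - F s) \<le> e" if "near V (e / c) t s" for t s using F[OF that] c by simp
    qed
  qed
  have domG: "dominated V G"
    by (rule domI[of _ "L * B"]) (use L(2)[OF nearV] L(1) B in \<open>auto simp: mult.assoc\<close>)
  have domE: "dominated V E"
    by (rule domI[of _ "L * B"]) (use L(3)[OF nearV] L(1) B in \<open>auto simp: mult.assoc\<close>)
  have doma: "dominated V (\<lambda>x. complex_of_real (ap x))"
  proof (rule domI[OF _ B])
    fix t t' d assume nr: "near V d t t'"
    show "norm (complex_of_real (ap t) - complex_of_real (ap t')) \<le> B * d"
      using nearV(1)[OF nr, of 0] unfolding of_real_diff[symmetric] norm_of_real by simp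
  qed
  obtain BE where BE: "BE > 0" "\<And>x. norm (E x) \<le> BE" by (rule AP_bounded[OF dominated_AP[OF V domE]]) blast
  \<comment> \<open>E is the quasi-derivative of G, for which the Lipschitz bound was obtained. The
    derivative itself is its product with 1 / p, which is dominated as well.\<close>
  have dom': "dominated V (\<lambda>x. complex_of_real (ap x) * E x)"
  proof (rule dominated_mult[OF doma domE])
    show "norm (complex_of_real (ap x)) \<le> max KK BE" for x
      using a_le[of x] p_pos[of x] unfolding norm_of_real by (simp add: le_max_iff_disj)
    show "norm (E x) \<le> max KK BE" for x using BE(2)[of x] by simp
  qed
  have mod: "F \<in> AP_module (freq_module_v p q w)" if "dominated V F" for F
    using dominated_AP[OF V that] dominated_freq_module[OF p q w _ that[unfolded V_def]] by (simp add: AP_module_def)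
  have der: "(G has_vector_derivative complex_of_real (ap x) * E x) (at x)" for x
  proof -
    have "((\<lambda>x. f1 x * f2 x * (1 / W)) has_vector_derivative
        (f1 x * (of_real (ap x) * h2 x) + of_real (ap x) * h1 x * f2 x) * (1 / W)) (at x)"
      by (intro has_vector_derivative_mult_left has_vector_derivative_mult inhomD(1)[OF s1] inhomD(1)[OF s2])
    moreover have "(f1 x * (c * h2 x) + c * h1 x * f2 x) * (1 / W) = c * E x" for c
      unfolding E_def by (simp add: algebra_simps add_divide_distrib)
    then have "(f1 x * (of_real (ap x) * h2 x) + of_real (ap x) * h1 x * f2 x) * (1 / W) = complex_of_real (ap x) * E x" .
    moreover have "(\<lambda>x. f1 x * f2 x * (1 / W)) = G" by (simp add: G_def fun_eq_iff)
    ultimately show ?thesis by simp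
  qed
  have "(\<lambda>x. vector_derivative G (at x)) = (\<lambda>x. complex_of_real (ap x) * E x)"
    by (intro ext vector_derivative_at der)
  with mod[OF domG] mod[OF dom'] der show ?thesis
    unfolding greens using differentiableI_vector[OF der] by metis
qed

end
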